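(* Let $\mathcal{I}$ be a non-degenerate, $B$-bounded, one-dimensional (constant $C_1$), $\rho$-supported sieving system, and fix the parameters $\delta,K,\xi$ and $M\ge 2$ as in the context. Let $\mathbf{b}$ be uniformly distributed in $\mathbb{Z}/P\mathbb{Z}$ and $\mathbf{S}=S_z+\mathbf{b}$. Then, for $x$ sufficiently large: (i) $\mathbb{E}|\mathbf{S}\cap[1,y]|=\sigma y$ and $\mathbb{E}|\mathbf{S}\cap[1,y]|^2=\bigl(1+O(1/\log y)\bigr)(\sigma y)^2$. (ii) For every $H\in\mathfrak{H}$ and $j\in\{0,1,2\}$, $$\mathbb{E}\sum_{q\in\mathcal{Q}_H}\Bigl(\sum_{-Ky<n\le y}\boldsymbol{\lambda}(H;q,n)\Bigr)^j=\bigl(1+O(H^{-(M-2)})\bigr)((K+1)y)^j|\mathcal{Q}_H|.$$ (iii) For every $H\in\mathfrak{H}$ and $j\in\{0,1,2\}$, $$\mathbb{E}\sum_{n\in\mathbf{S}\cap[1,y]}\Bigl(\sum_{q\in\mathcal{Q}_H}\sum_{h\le KH}\boldsymbol{\lambda}(H;q,n-qh)\Bigr)^j=\bigl(1+O(H^{-(M-2)})\bigr)\Bigl(\frac{|\mathcal{Q}_H|KH}{\sigma_2}\Bigr)^j\sigma y.$$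
   Context: A sieving system is a collection of sets $I_p\subset\mathbb{Z}/p\mathbb{Z}$, one per prime $p$ ($p,q$ denote primes); non-degenerate: $|I_p|\le p-1$; $B$-bounded: $|I_p|\le B$; one-dimensional: $\prod_{p\le x}(1-|I_p|/p)\sim C_1/\log x$ with $C_1>0$; $\rho$-supported: $|\{p\le x:|I_p|\ge1\}|\sim\rho x/\log x$ with $\rho>0$. Standing parameters: $\delta\in(0,1/2)$ with $\frac{(4+\delta)10^{2\delta}}{\log(1/(2\delta))}<\rho$, an integer $K\ge2$, a real $\xi>1$. For $w\ge2$: $S_w=\{n\in\mathbb{Z}:n\bmod p\notin I_p\ \forall p\le w\}$, $P(w)=\prod_{p\le w,I_p\ne\emptyset}p$, $\sigma(w)=\prod_{p\le w}(1-|I_p|/p)$; for $u<w$: $S_{u,w}=\{n:n\bmod p\notin I_p\ \forall u<p\le w\}$, $P(u,w)=\prod_{u<p\le w,I_p\ne\emptyset}p$, $\sigma(u,w)=\prod_{u<p\le w}(1-|I_p|/p)$. Let $y=\lceil x(\log x)^\delta\rceil$, $z=y\log\log x/(\log x)^{1/2}$, $P=P(z)$, $\sigma=\sigma(z)$. $\mathfrak{H}=\{H\in\{1,\xi,\xi^2,\dots\}:2y/x\le H\le y/(\xi z)\}$; for $H\in\mathfrak{H}$, $\mathcal{Q}_H$ is a fixed set of primes $q\in(y/(\xi H),y/H]$ with $|I_q|\ge1$ and $|\mathcal{Q}_H|\sim\rho(1-1/\xi)y/(H\log x)$. For $H$, let $P_1=P(H^M)$, $\mathbf{b}_1\equiv\mathbf{b}\pmod{P_1}$,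 $\mathbf{S}_1=S_{H^M}+\mathbf{b}_1$; $P_2=P(H^M,z)$, $\sigma_2=\sigma(H^M,z)$, $\mathbf{b}_2\equiv\mathbf{b}\pmod{P_2}$, $\mathbf{S}_2=S_{H^M,z}+\mathbf{b}_2$ (so $\mathbf{S}=\mathbf{S}_1\cap\mathbf{S}_2$). Let $\mathbf{AP}(J;q,n)=\{n+qh:1\le h\le J\}\cap\mathbf{S}_1$ and $\boldsymbol{\lambda}(H;q,n)=\sigma_2^{-|\mathbf{AP}(KH;q,n)|}$ if $\mathbf{AP}(KH;q,n)\subset\mathbf{S}_2$, and $0$ otherwise. Implied constants may depend on $B,\rho,C_1,\delta,M,K,\xi$.
   Formalization: In (iii) the factor KH on the right is replaced by its integer part, the number of summands h; the formula with KH itself is also proved when M ≤ 3 or KH is an integer, but is false in general for M > 3 (e.g. ξ = 3/2, K = 2, M = 4). *)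

theory Defs
  imports "HOL-Probability.Probability" "HOL-Library.Landau_Symbols"
    "HOL-Computational_Algebra.Primes"
begin

text \<open>
  A subset of \<open>\<int>/p\<int>\<close> is given by its representatives in \<open>{0..<p}\<close>, so that
  ``\<open>n mod p\<close> lies in \<open>I\<^sub>p\<close>'' reads \<open>n mod int p \<in> I p\<close>.
  Values of \<open>I\<close> at non-primes are irrelevant throughout.
\<close>

definition sieving_system :: "(nat \<Rightarrow> int set) \<Rightarrow> bool" where
  "sieving_system I \<longleftrightarrow> (\<forall>p. prime p \<longrightarrow> I p \<subseteq> {0..<int p})"

definition non_degenerate :: "(nat \<Rightarrow> int set) \<Rightarrow> bool" where
  "non_degenerate I \<longleftrightarrow> (\<forall>p. prime p \<longrightarrow> card (I p) \<le> p - 1)"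

definition bounded_by :: "real \<Rightarrow> (nat \<Rightarrow> int set) \<Rightarrow> bool" where
  "bounded_by B I \<longleftrightarrow> (\<forall>p. prime p \<longrightarrow> real (card (I p)) \<le> B)"

definition primes_upto :: "real \<Rightarrow> nat set" where
  "primes_upto w = {p. prime p \<and> real p \<le> w}"

definition primes_between :: "real \<Rightarrow> real \<Rightarrow> nat set" where
  "primes_between u w = {p. prime p \<and> u < real p \<and> real p \<le> w}"

text \<open>
  With \<open>A = primes_upto w\<close> the next three are \<open>S\<^sub>w\<close>, \<open>P(w)\<close>, \<open>\<sigma>(w)\<close>;
  with \<open>A = primes_between u w\<close> they are \<open>S\<^sub>u\<^sub>,\<^sub>w\<close>, \<open>P(u,w)\<close>, \<open>\<sigma>(u,w)\<close>.
\<close>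

definition sifted :: "(nat \<Rightarrow> int set) \<Rightarrow> nat set \<Rightarrow> int set" where
  "sifted I A = {n. \<forall>p\<in>A. n mod int p \<notin> I p}"

definition modulus :: "(nat \<Rightarrow> int set) \<Rightarrow> nat set \<Rightarrow> int" where
  "modulus I A = (\<Prod>p\<in>{p\<in>A. I p \<noteq> {}}. int p)"

definition sieve_density :: "(nat \<Rightarrow> int set) \<Rightarrow> nat set \<Rightarrow> real" where
  "sieve_density I A = (\<Prod>p\<in>A. 1 - real (card (I p)) / real p)"

definition one_dimensional :: "real \<Rightarrow> (nat \<Rightarrow> int set) \<Rightarrow> bool" where
  "one_dimensional C\<^sub>1 I \<longleftrightarrow> C\<^sub>1 > 0 \<and>
     (\<lambda>x. sieve_density I (primes_upto x)) \<sim>[at_top] (\<lambda>x. C\<^sub>1 / ln x)"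

definition supported :: "real \<Rightarrow> (nat \<Rightarrow> int set) \<Rightarrow> bool" where
  "supported \<rho> I \<longleftrightarrow> \<rho> > 0 \<and>
     (\<lambda>x. real (card {p \<in> primes_upto x. card (I p) \<ge> 1})) \<sim>[at_top] (\<lambda>x. \<rho> * x / ln x)"

definition translate :: "int set \<Rightarrow> int \<Rightarrow> int set" where
  "translate S b = (\<lambda>n. n + b) ` S"

definition y_of :: "real \<Rightarrow> real \<Rightarrow> nat" where
  "y_of \<delta> x = nat \<lceil>x * ln x powr \<delta>\<rceil>"

definition z_of :: "real \<Rightarrow> real \<Rightarrow> real" where
  "z_of \<delta> x = real (y_of \<delta> x) * ln (ln x) / ln x powr (1/2)"

definition scales :: "real \<Rightarrow> real \<Rightarrow> real \<Rightarrow> real set" where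
  "scales \<delta> \<xi> x = {H \<in> range (\<lambda>k::nat. \<xi> ^ k).
     2 * real (y_of \<delta> x) / x \<le> H \<and> H \<le> real (y_of \<delta> x) / (\<xi> * z_of \<delta> x)}"

text \<open>
  \<open>Q x H\<close> is the set \<open>Q\<^sub>H\<close> chosen at the given \<open>x\<close>. Its size asymptotic, as
  \<open>x \<rightarrow> \<infinity>\<close>, is uniform over the scales \<open>H\<close> available at \<open>x\<close>.
\<close>

definition admissible_choice ::
  "real \<Rightarrow> real \<Rightarrow> real \<Rightarrow> (nat \<Rightarrow> int set) \<Rightarrow> (real \<Rightarrow> real \<Rightarrow> nat set) \<Rightarrow> bool" where
  "admissible_choice \<rho> \<delta> \<xi> I Q \<longleftrightarrow>
     (\<forall>x. \<forall>H \<in> scales \<delta> \<xi> x.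
        Q x H \<subseteq> {q \<in> primes_between (real (y_of \<delta> x) / (\<xi> * H)) (real (y_of \<delta> x) / H).
                   card (I q) \<ge> 1}) \<and>
     (\<forall>\<epsilon>>0. \<forall>\<^sub>F x in at_top. \<forall>H \<in> scales \<delta> \<xi> x.
        \<bar>real (card (Q x H)) - \<rho> * (1 - 1/\<xi>) * real (y_of \<delta> x) / (H * ln x)\<bar>
          \<le> \<epsilon> * (\<rho> * (1 - 1/\<xi>) * real (y_of \<delta> x) / (H * ln x)))"

text \<open>Expectation over a uniformly distributed \<open>b\<close> in \<open>\<int>/P\<int>\<close>, \<open>P = P(z)\<close>.\<close>

definition expect_shift ::
  "(nat \<Rightarrow> int set) \<Rightarrow> real \<Rightarrow> (int \<Rightarrow> real) \<Rightarrow> real" where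
  "expect_shift I z f =
     measure_pmf.expectation (pmf_of_set {0..<modulus I (primes_upto z)}) f"

definition random_S :: "(nat \<Rightarrow> int set) \<Rightarrow> real \<Rightarrow> int \<Rightarrow> int set" where
  "random_S I z b = translate (sifted I (primes_upto z)) b"

definition random_S1 :: "(nat \<Rightarrow> int set) \<Rightarrow> real \<Rightarrow> real \<Rightarrow> int \<Rightarrow> int set" where
  "random_S1 I M H b =
     (let A = primes_upto (H powr M) in translate (sifted I A) (b mod modulus I A))"

definition random_S2 :: "(nat \<Rightarrow> int set) \<Rightarrow> real \<Rightarrow> real \<Rightarrow> real \<Rightarrow> int \<Rightarrow> int set" where
  "random_S2 I M z H b =
     (let A = primes_between (H powr M) z in translate (sifted I A) (b mod modulus I A))"

definition sigma2 :: "(nat \<Rightarrow> int set) \<Rightarrow> real \<Rightarrow> real \<Rightarrow> real \<Rightarrow> real" where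
  "sigma2 I M z H = sieve_density I (primes_between (H powr M) z)"

definition AP ::
  "(nat \<Rightarrow> int set) \<Rightarrow> real \<Rightarrow> real \<Rightarrow> int \<Rightarrow> real \<Rightarrow> nat \<Rightarrow> int \<Rightarrow> int set" where
  "AP I M H b J q n =
     {n + int q * int h | h. 1 \<le> h \<and> real h \<le> J} \<inter> random_S1 I M H b"

definition lambda_weight ::
  "(nat \<Rightarrow> int set) \<Rightarrow> real \<Rightarrow> nat \<Rightarrow> real \<Rightarrow> int \<Rightarrow> real \<Rightarrow> nat \<Rightarrow> int \<Rightarrow> real" where
  "lambda_weight I M K z b H q n =
     (let ap = AP I M H b (real K * H) q n in
      if ap \<subseteq> random_S2 I M z H b then 1 / sigma2 I M z H ^ card ap else 0)"

text \<open>\<open>a = (1 + O(\<eta>)) m\<close>, the implied constant being absorbed in \<open>\<eta>\<close>.\<close>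

definition rel_close :: "real \<Rightarrow> real \<Rightarrow> real \<Rightarrow> bool" where
  "rel_close \<eta> a m \<longleftrightarrow> \<bar>a - m\<bar> \<le> \<eta> * m"

text \<open>The left-hand sides of the moment estimates over \<open>q\<close> and over \<open>n\<close>.\<close>

definition q_moment ::
  "(nat \<Rightarrow> int set) \<Rightarrow> real \<Rightarrow> nat \<Rightarrow> nat \<Rightarrow> real \<Rightarrow> real \<Rightarrow> nat set \<Rightarrow> nat \<Rightarrow> real" where
  "q_moment I M K y z H QH j =
     expect_shift I z (\<lambda>b. \<Sum>q\<in>QH.
       (\<Sum>n\<in>{- (int K * int y)<..int y}. lambda_weight I M K z b H q n) ^ j)"

definition n_moment ::
  "(nat \<Rightarrow> int set) \<Rightarrow> real \<Rightarrow> nat \<Rightarrow> nat \<Rightarrow> real \<Rightarrow> real \<Rightarrow> nat set \<Rightarrow> nat \<Rightarrow> real" where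
  "n_moment I M K y z H QH j =
     expect_shift I z (\<lambda>b. \<Sum>n\<in>random_S I z b \<inter> {1..int y}.
       (\<Sum>q\<in>QH. \<Sum>h\<in>{h::nat. 1 \<le> h \<and> real h \<le> real K * H}.
          lambda_weight I M K z b H q (n - int q * int h)) ^ j)"

end

theory Submission
  imports Defs "HOL-Number_Theory.Cong" "HOL-Real_Asymp.Real_Asymp"
begin

text \<open>
  In every part the first moment is bounded below and the second moment above; the Cauchy--Schwarz
  inequality supplies the two missing bounds.

  For a finite set \<open>U\<close> with \<open>k\<close> elements, the probability that \<open>U\<close> survives the sieving by the primes
  \<open>p > w\<close> is a product of local factors \<open>1 - |\<Union>\<^sub>u (u - I\<^sub>p)| / p\<close>. The union bound gives at least
  \<open>(1 - O(k\<^sup>2/w)) \<sigma>\<^sub>2\<^sup>k\<close>. For an upper bound one adds back the overlaps of pairs \<open>u, v\<close>, which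
  require \<open>u - v \<in> I\<^sub>p - I\<^sub>p\<close> modulo \<open>p\<close>; Jensen's inequality for \<open>exp\<close> decouples the pairs, so that
  it suffices to average \<open>\<Prod>\<^sub>p (1 + a r\<^sub>p(m) / p) - 1\<close> over families of differences \<open>m\<close>, with
  \<open>a = O(H\<^sup>2)\<close> and \<open>r\<^sub>p(m)\<close> the number of representations of \<open>m\<close> in \<open>I\<^sub>p - I\<^sub>p\<close>. Expanding the product, this
  becomes a count of those \<open>n\<close> in an interval, or primes \<open>q \<in> Q\<^sub>H\<close>, lying in a residue class modulo a
  squarefree \<open>d\<close>.

  The count of primes needs no Brun--Titchmarsh inequality. A Chebyshev-type argument, comparing
  \<open>\<Prod>\<^sub>k (c + d k)\<close> with a factorial, loses only a factor \<open>1 + ln d \<le> \<Prod>\<^sub>p (1 + ln p)\<close>, which is harmless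
  because \<open>\<Sum>\<^sub>p (1 + ln p) / p\<^sup>2 = O(1/w)\<close> over the primes \<open>p > w\<close>.
\<close>

section \<open>Primes in arithmetic progressions\<close>

text \<open>The error \<open>H powr (- (M - 2))\<close> is \<open>H^2 / w\<close> with the cut at
  \<open>w = H powr M\<close>: the points of two progressions form about \<open>H^2\<close> pairs,
  and the collisions of a pair at primes beyond \<open>w\<close> weigh \<open>O(1/w)\<close> on
  average. Summing over integers instead of primes would lose a factor \<open>ln w\<close> here,
  which that exponent does not allow. The obstacle is the remainder in counting residue classes.
  Each modulus \<open>d\<close> costs \<open>O(1)\<close>; summed over all squarefree
  \<open>d\<close> with the coefficient \<open>a\<close> this grows to
  \<open>\<sigma>2 powr (- (a * B))\<close>, that is, to \<open>ln x\<close> raised to a power of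
  order \<open>H^2\<close>. The upper end of the scales gives
  \<open>H * ln (ln x) \<le> sqrt (ln x)\<close>, so the remainder is
  \<open>exp (O (ln x / ln (ln x)))\<close>, negligible against any fixed power of \<open>x\<close>.
  Hence the expansion over \<open>d\<close> never has to be truncated. Part (i) has no scale
  \<open>H\<close>. There the cut is a multiple of \<open>ln y\<close>: large enough for the error
  \<open>1 / ln y\<close>, and small enough for the period of the small primes to be a small power
  of \<open>y\<close>, so that these primes are treated by exact periodicity.\<close>

lemma prod_distinct_primes_dvd:
  fixes N :: nat
  assumes "finite S" "\<And>q. q \<in> S \<Longrightarrow> prime q" "\<And>q. q \<in> S \<Longrightarrow> q dvd N"
  shows "\<Prod>S dvd N"
  using assms
proof (induction S rule: finite_induct)
  case (insert q S)
  have "coprime q (\<Prod>S)"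
    by (rule prod_coprime_right) (use insert in \<open>auto intro!: primes_coprime\<close>)
  with insert show ?case by (auto intro!: divides_mult)
qed auto

text \<open>This says that the exponent of \<open>p\<close> in \<open>m!\<close> is at most
  \<open>m\<close>, stated with a cofactor prime to \<open>p\<close> so that the induction only
  multiplies divisibilities. The multiples of \<open>p\<close> up to \<open>m\<close> contribute
  \<open>p ^ k * fact k\<close> with \<open>k = m div p\<close>, the hypothesis for \<open>k\<close>
  at most doubles that power of \<open>p\<close>, and \<open>2 * k \<le> m\<close>.\<close>

lemma prime_power_fact_bound:
  assumes "prime (p::nat)"
  shows "\<exists>c. coprime p c \<and> fact m dvd p ^ m * c"
proof (induction m rule: less_induct)
  case (less m)
  have p2: "p \<ge> 2" using assms by (simp add: prime_ge_2_nat)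
  show ?case
  proof (cases "m = 0")
    case False
    define k where "k = m div p"
    have "k < m" using False p2 unfolding k_def by simp
    then obtain c where c: "coprime p c" "fact k dvd p ^ k * c" using less by blast
    define D where "D = {j\<in>{1..m}. \<not> p dvd j}"
    have split: "{1..m} = (\<lambda>j. p * j) ` {1..k} \<union> D"
    proof (rule set_eqI)
      fix j
      show "j \<in> {1..m} \<longleftrightarrow> j \<in> (\<lambda>j. p * j) ` {1..k} \<union> D"
      proof (cases "p dvd j")
        case True
        then obtain i where i: "j = p * i" by blast
        have "p * i \<le> m \<longleftrightarrow> i \<le> k" unfolding k_def using p2
          by (simp add: less_eq_div_iff_mult_less_eq mult.commute)
        moreover have "p * i \<ge> 1 \<longleftrightarrow> i \<ge> 1" using p2 by (cases i) auto
        moreover have "j \<in> (\<lambda>j. p * j) ` {1..k} \<longleftrightarrow> i \<in> {1..k}" using i p2 by (auto simp: image_iff)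
        ultimately show ?thesis using i True by (simp add: D_def)
      qed (auto simp: D_def)
    qed
    have "fact m = \<Prod>{1..m}" by (simp add: fact_prod)
    also have "\<dots> = \<Prod>((\<lambda>j. p * j) ` {1..k}) * \<Prod>D"
      unfolding split by (rule prod.union_disjoint) (auto simp: D_def)
    also have "\<Prod>((\<lambda>j. p * j) ` {1..k}) = (\<Prod>j\<in>{1..k}. p * j)"
      by (subst prod.reindex) (use p2 in \<open>auto intro: inj_onI\<close>)
    also have "\<dots> = p ^ k * fact k" by (simp add: prod.distrib fact_prod)
    finally have *: "fact m = p ^ k * fact k * \<Prod>D" .
    have "2 * k \<le> p * k" using p2 by simp
    also have "\<dots> \<le> m" unfolding k_def by simp
    finally have "2 * k \<le> m" .
    hence "p ^ (2*k) dvd p ^ m" by (rule le_imp_power_dvd)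
    have "p ^ k * fact k * \<Prod>D dvd p ^ k * (p ^ k * c) * \<Prod>D"
      using c by (intro mult_dvd_mono) auto
    also have "\<dots> = p ^ (2*k) * (c * \<Prod>D)" by (simp add: power_mult power2_eq_square power_mult_distrib mult_ac flip: power_add)
    also have "\<dots> dvd p ^ m * (c * \<Prod>D)" using \<open>p ^ (2*k) dvd p ^ m\<close> by (rule mult_dvd_mono) auto
    finally have "fact m dvd p ^ m * (c * \<Prod>D)" using * by simp
    moreover have "coprime p (c * \<Prod>D)"
      using c assms by (auto intro!: prod_coprime_right simp: D_def prime_imp_coprime)
    ultimately show ?thesis by blast
  qed (auto intro!: exI[of _ 1])
qed

text \<open>Prime by prime. If \<open>p\<close> divides \<open>d\<close>, the factor
  \<open>d ^ m\<close> alone absorbs the power of \<open>p\<close> in \<open>fact m\<close>.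
  Otherwise \<open>d\<close> is invertible modulo that power, and multiplication by the inverse
  turns the progression into \<open>m\<close> consecutive integers, whose product is divisible by
  \<open>fact m\<close>.\<close>

lemma fact_dvd_AP_product:
  assumes "d > 0" "a + d > (0::nat)"
  shows "fact m dvd d ^ m * (\<Prod>k\<in>{1..m}. a + d * k)"
proof (rule multiplicity_le_imp_dvd)
  let ?\<Pi> = "\<Prod>k\<in>{1..m}. a + d * k"
  have nz: "d ^ m * ?\<Pi> \<noteq> 0" using assms by auto
  show "fact m \<noteq> (0::nat)" by simp
  show "multiplicity p (fact m) \<le> multiplicity p (d ^ m * ?\<Pi>)" if p: "prime p" for p
  proof -
    define L where "L = multiplicity p (fact m :: nat)"
    have Ldvd: "p ^ L dvd fact m" unfolding L_def by (rule multiplicity_dvd)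
    have "p ^ L dvd d ^ m * ?\<Pi>"
    proof (cases "p dvd d")
      case True
      obtain c where c: "coprime p c" "fact m dvd p ^ m * c"
        using prime_power_fact_bound[OF p] by blast
      have "p ^ L dvd p ^ m * c" using Ldvd c dvd_trans by blast
      hence "p ^ L dvd p ^ m" using c(1) by (simp add: coprime_dvd_mult_left_iff)
      also have "p ^ m dvd d ^ m" using True by (rule dvd_power_same)
      finally show ?thesis by simp
    next
      case False
      hence cop: "coprime d (p ^ L)" using p
        by (metis coprime_commute coprime_power_right_iff prime_imp_coprime)
      then obtain e where e: "[d * e = 1] (mod (p ^ L))" using cong_solve_coprime_nat[of d "p ^ L"] by auto
      have "[e ^ m * ?\<Pi> = (\<Prod>k\<in>{1..m}. e * a + k)] (mod (p ^ L))"
      proof -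
        have "e ^ m * ?\<Pi> = (\<Prod>k\<in>{1..m}. e * (a + d * k))" by (simp add: prod.distrib)
        also have "[\<dots> = (\<Prod>k\<in>{1..m}. e * a + k)] (mod (p ^ L))"
        proof (rule cong_prod)
          fix k
          have "[e * a + (d * e) * k = e * a + 1 * k] (mod (p ^ L))"
            by (intro cong_add cong_mult e cong_refl)
          thus "[e * (a + d * k) = e * a + k] (mod (p ^ L))" by (simp add: algebra_simps)
        qed
        finally show ?thesis .
      qed
      moreover have "fact m dvd (\<Prod>k\<in>{1..m}. e * a + k)"
      proof -
        have "fact (e * a) * (\<Prod>k\<in>{1..m}. e * a + k) = fact (e * a + m)"
          by (induction m) (auto simp: algebra_simps)
        also have "\<dots> = fact (e*a) * (fact m * ((e * a + m) choose m))"
          using binomial_fact_lemma[of m "e * a + m"] by (simp add: mult_ac)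
        finally show ?thesis by simp
      qed
      ultimately have "p ^ L dvd e ^ m * ?\<Pi>"
        using Ldvd dvd_trans cong_dvd_iff cong_sym by meson
      moreover have "coprime (p ^ L) e"
        using e by (metis cong_imp_coprime coprime_1_left coprime_commute coprime_mult_left_iff cong_sym)
      ultimately show ?thesis
        by (metis coprime_dvd_mult_right_iff coprime_power_right_iff dvd_mult)
    qed
    thus "multiplicity p (fact m) \<le> multiplicity p (d ^ m * ?\<Pi>)"
      unfolding L_def[symmetric] using nz p by (intro multiplicity_geI) auto
  qed
qed

text \<open>A Stirling bound: successive left-hand sides have the ratio
  \<open>(m + 1) * (1 + 1 / (m + 1)) ^ (m + 1)\<close>, and the power is at most
  \<open>exp 1\<close>.\<close>

lemma Suc_power_le_exp_fact: "real (m + 1) ^ m \<le> exp (real m) * fact m"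
proof (induction m)
  case (Suc m)
  have "real (Suc m + 1) ^ Suc m = ((real (m + 2)) / (real (m+1))) ^ Suc m * (real (m+1) * real (m+1) ^ m)"
    by (simp add: power_divide)
  also have "\<dots> \<le> exp 1 * (real (m+1) * (exp (real m) * fact m))"
  proof (intro mult_mono Suc.IH order_refl)
    have "(1 + 1 / real (Suc m)) ^ Suc m \<le> exp 1"
      by (rule exp_ge_one_plus_x_over_n_power_n) auto
    moreover have "1 + 1 / real (Suc m) = real (m + 2) / real (m+1)" by (simp add: field_simps)
    ultimately show "(real (m + 2) / real (m+1)) ^ Suc m \<le> exp 1" by simp
  qed auto
  also have "\<dots> = exp (real (Suc m)) * fact (Suc m)" by (simp add: exp_add algebra_simps)
  finally show ?case .
qed simp

text \<open>The primes divide the product of the progression, and being larger than \<open>m\<close>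
  they are coprime to \<open>fact m\<close>; so \<open>\<Prod>S * fact m\<close> divides
  \<open>d ^ m\<close> times that product. Each term is at most \<open>d * (m + 1)\<close>, and the
  Stirling bound cancels \<open>fact m\<close>, leaving \<open>exp 1 * d ^ 2\<close> per term. The
  condition \<open>d \<le> q\<close> makes \<open>q div d\<close> at least 1, the first index of the
  product.\<close>

lemma prod_primes_in_AP_le:
  assumes d: "d > (0::nat)" and a: "a < d" and "finite S"
    and S: "\<And>q. q \<in> S \<Longrightarrow> prime q \<and> q mod d = a \<and> d \<le> q \<and> q \<le> a + d * m \<and> m < q"
  shows "real (\<Prod>S) \<le> (exp 1 * real d ^ 2) ^ m"
proof -
  let ?\<Pi> = "\<Prod>k\<in>{1..m}. a + d * k"
  have "q dvd ?\<Pi>" if "q \<in> S" for q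
  proof -
    have q: "q = a + d * (q div d)" using S[OF that] mult_div_mod_eq[of d q] by simp
    have "q div d \<in> {1..m}"
    proof -
      have "d * (q div d) \<le> d * m" using S[OF that] q by linarith
      moreover have "q div d \<ge> 1" using S[OF that] d by (simp add: Suc_leI div_greater_zero_iff)
      ultimately show ?thesis using d by simp
    qed
    hence "a + d * (q div d) dvd ?\<Pi>" by (intro dvd_prodI) auto
    thus ?thesis using q by simp
  qed
  hence "\<Prod>S dvd ?\<Pi>" using S assms by (intro prod_distinct_primes_dvd) auto
  hence "\<Prod>S dvd d ^ m * ?\<Pi>" by (rule dvd_mult)
  moreover have "fact m dvd d ^ m * ?\<Pi>" using d by (intro fact_dvd_AP_product) auto
  moreover have "coprime (\<Prod>S) (fact m)"
  proof (rule prod_coprime_left)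
    fix q assume "q \<in> S"
    thus "coprime q (fact m)" using S[of q] prime_dvd_fact_iff[of q m]
      by (auto intro!: prime_imp_coprime)
  qed
  ultimately have "\<Prod>S * fact m dvd d ^ m * ?\<Pi>" by (rule divides_mult)
  moreover have "d ^ m * ?\<Pi> > 0" using d by auto
  ultimately have "\<Prod>S * fact m \<le> d ^ m * ?\<Pi>" by (rule dvd_imp_le)
  also have "?\<Pi> \<le> (\<Prod>k\<in>{1..m}. d * (m + 1))"
  proof (rule prod_mono)
    fix k assume k: "k \<in> {1..m}"
    have "a + d * k \<le> d + d * m" using a k by (intro add_mono mult_left_mono) auto
    thus "0 \<le> a + d * k \<and> a + d * k \<le> d * (m + 1)" by simp
  qed
  also have "\<dots> = (d * (m+1)) ^ m" by simp
  finally have "\<Prod>S * fact m \<le> d ^ m * (d * (m+1)) ^ m" by simp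
  hence "real (\<Prod>S) * fact m \<le> real d ^ m * (real d * real (m+1)) ^ m"
    by (metis (mono_tags, lifting) of_nat_fact of_nat_le_iff of_nat_mult of_nat_power)
  also have "\<dots> = real d ^ (2*m) * real (m + 1) ^ m" by (simp add: power_mult_distrib power_mult power2_eq_square)
  also have "\<dots> \<le> real d ^ (2*m) * (exp (real m) * fact m)"
    using Suc_power_le_exp_fact by (intro mult_left_mono) auto
  finally have "real (\<Prod>S) \<le> real d ^ (2*m) * exp (real m)" by simp
  also have "\<dots> = (exp 1 * real d ^ 2) ^ m"
    by (simp add: power_mult_distrib power_mult exp_of_nat_mult[symmetric])
  finally show ?thesis .
qed

text \<open>Every counted prime exceeds \<open>N0\<close>, so logarithms turn the product bound into
  a count. The hypothesis \<open>N / d \<le> N0\<close> ensures that the primes exceed the number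
  \<open>m\<close> of terms. The summand 1 is for the one prime that may be smaller than
  \<open>d\<close>, namely the residue itself.\<close>

lemma card_primes_in_AP_le:
  assumes d: "d > (0::nat)" and fin: "finite S" and N0: "N0 > 1" and N: "N > 0" and NN: "N / real d \<le> N0"
    and prm: "\<And>q. q \<in> S \<Longrightarrow> prime q \<and> N0 < real q \<and> real q \<le> N"
    and cong: "\<And>q q'. q \<in> S \<Longrightarrow> q' \<in> S \<Longrightarrow> q mod d = q' mod d"
  shows "real (card S) \<le> 1 + 2 * N / ln N0 * (1 + ln d) / d"
proof (cases "S = {}")
  case True
  thus ?thesis using N N0 d by auto
next
  case False
  then obtain q0 where q0: "q0 \<in> S" by blast
  define a where "a = q0 mod d"
  have a: "a < d" using d by (simp add: a_def)
  define m where "m = nat \<lfloor>N / d\<rfloor>"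
  have m: "real m \<le> N / d" unfolding m_def using N by (simp add: of_nat_floor)
  define S' where "S' = {q\<in>S. d \<le> q}"
  have "real (\<Prod>S') \<le> (exp 1 * real d ^ 2) ^ m"
  proof (rule prod_primes_in_AP_le[OF d a])
    show "finite S'" using fin by (simp add: S'_def)
    fix q assume "q \<in> S'"
    hence q: "q \<in> S" "d \<le> q" by (auto simp: S'_def)
    have qa: "q mod d = a" unfolding a_def using cong q q0 by blast
    have "q \<le> a + d * m"
    proof -
      have "real (q div d) \<le> N / d"
      proof -
        have "d * (q div d) \<le> q" by simp
        hence "real (d * (q div d)) \<le> real q" by (simp only: of_nat_le_iff)
        hence "real (q div d) * real d \<le> N" using prm[OF q(1)] by (simp add: mult.commute)
        thus ?thesis using d by (simp add: pos_le_divide_eq)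
      qed
      hence "q div d \<le> m" unfolding m_def by (simp add: le_nat_floor)
      hence "d * (q div d) \<le> d * m" by simp
      thus ?thesis using qa mult_div_mod_eq[of d q] by linarith
    qed
    moreover have "m < q" using m NN prm[OF q(1)] by linarith
    ultimately show "prime q \<and> q mod d = a \<and> d \<le> q \<and> q \<le> a + d * m \<and> m < q"
      using prm q qa by auto
  qed
  moreover have "N0 ^ card S' \<le> real (\<Prod>S')"
  proof -
    have "(\<Prod>q\<in>S'. N0) \<le> (\<Prod>q\<in>S'. real q)"
      using N0 prm by (intro prod_mono) (auto simp: S'_def less_imp_le)
    thus ?thesis by simp
  qed
  ultimately have "N0 ^ card S' \<le> (exp 1 * real d ^ 2) ^ m" by linarith
  hence "ln (N0 ^ card S') \<le> ln ((exp 1 * real d ^ 2) ^ m)" using N0 by (subst ln_le_cancel_iff) (use d in auto)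
  hence "real (card S') * ln N0 \<le> real m * (1 + 2 * ln d)"
    using N0 d by (simp add: ln_realpow ln_mult)
  also have "\<dots> \<le> N / d * (2 * (1 + ln d))" using m N d by (intro mult_mono) auto
  finally have "real (card S') \<le> N / d * (2 * (1 + ln d)) / ln N0"
    using N0 by (subst pos_le_divide_eq) auto
  moreover have "card S \<le> card S' + 1"
  proof -
    have "S \<subseteq> S' \<union> {a}"
    proof
      fix q assume q: "q \<in> S"
      show "q \<in> S' \<union> {a}"
      proof (cases "q < d")
        case True
        thus ?thesis using cong[OF q q0] by (simp add: a_def)
      next
        case False
        thus ?thesis using q by (simp add: S'_def)
      qed
    qed
    hence "card S \<le> card (S' \<union> {a})" using fin by (intro card_mono) (auto simp: S'_def)
    also have "\<dots> \<le> card S' + card {a}" by (rule card_Un_le)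
    finally show ?thesis by simp
  qed
  ultimately show ?thesis by (simp add: field_simps)
qed

section \<open>Chebyshev bounds for primorials and for sums over primes\<close>

lemma prod_primes_doubling_le: "\<Prod>{p. prime p \<and> n < p \<and> p \<le> 2 * n} \<le> (4::nat) ^ n"
proof -
  let ?S = "{p. prime p \<and> n < p \<and> p \<le> 2 * n}"
  have eq: "fact n * fact n * ((2 * n) choose n) = (fact (2 * n) :: nat)"
    using binomial_fact_lemma[of n "2 * n"] by simp
  have "\<Prod>?S dvd ((2 * n) choose n)"
  proof (rule prod_distinct_primes_dvd)
    show "finite ?S" by (rule finite_subset[of _ "{..2*n}"]) auto
    fix q assume q: "q \<in> ?S"
    hence "q dvd fact n * fact n * ((2 * n) choose n)" unfolding eq by (simp add: prime_dvd_fact_iff)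
    moreover have "\<not> q dvd fact n" using q by (simp add: prime_dvd_fact_iff)
    ultimately show "q dvd ((2 * n) choose n)" using q by (simp add: prime_dvd_mult_iff)
  qed auto
  hence "\<Prod>?S \<le> ((2 * n) choose n)" by (rule dvd_imp_le) simp
  also have "\<dots> \<le> 2 ^ (2 * n)" by (rule binomial_le_pow2)
  finally show ?thesis by (simp add: power_mult)
qed

text \<open>Induction along \<open>k = (n + 1) div 2\<close> with the doubling bound. The base 16 in
  place of 4 pays for the rounding up at odd \<open>n\<close>: there
  \<open>64 ^ k \<le> 16 ^ (2 * k - 1)\<close> amounts to \<open>k \<ge> 2\<close>, which holds
  since \<open>n > 1\<close>.\<close>

lemma primorial_le: "\<Prod>{p. prime p \<and> p \<le> n} \<le> (16::nat) ^ n"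
proof (induction n rule: less_induct)
  case (less n)
  let ?S = "\<lambda>n. {p::nat. prime p \<and> p \<le> n}"
  show ?case
  proof (cases "n \<le> 1")
    case True
    hence "?S n = {}" by (auto dest: prime_ge_2_nat)
    thus ?thesis by (simp only: prod.empty) simp
  next
    case False
    define k where "k = (n + 1) div 2"
    have k: "k < n" "n \<le> 2 * k" using False by (auto simp: k_def)
    have fin: "finite (?S m)" for m by (rule finite_subset[of _ "{..m}"]) auto
    have fin2: "finite {p. prime p \<and> k < p \<and> p \<le> 2 * k}" by (rule finite_subset[of _ "{..2*k}"]) auto
    have "\<Prod>(?S n) \<le> \<Prod>(?S k \<union> {p. prime p \<and> k < p \<and> p \<le> 2 * k})"
    proof (intro dvd_imp_le prod_dvd_prod_subset)
      show "?S n \<subseteq> ?S k \<union> {p. prime p \<and> k < p \<and> p \<le> 2 * k}" using k by auto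
      show "0 < \<Prod>(?S k \<union> {p. prime p \<and> k < p \<and> p \<le> 2 * k})"
        by (rule prod_pos) (auto intro: prime_gt_0_nat)
    qed (use fin fin2 in simp)
    also have "\<dots> = \<Prod>(?S k) * \<Prod>{p. prime p \<and> k < p \<and> p \<le> 2 * k}"
      using fin fin2 by (intro prod.union_disjoint) auto
    also have "\<dots> \<le> 16 ^ k * 4 ^ k" using less.IH[OF k(1)] prod_primes_doubling_le by (intro mult_mono) auto
    also have "\<dots> \<le> 16 ^ n"
    proof (cases "n = 2 * k")
      case True
      have "(64::nat) ^ k \<le> 256 ^ k" by (rule power_mono) auto
      thus ?thesis using True by (simp add: power_mult power_mult_distrib[symmetric])
    next
      case f: False
      have "2 \<le> k" using False f unfolding k_def by presburger
      then obtain i where i: "k = i + 2" by (metis le_add_diff_inverse2)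
      have n: "n = 2 * i + 3" using f k i by (auto simp: k_def)
      have "(64::nat) ^ i \<le> 256 ^ i" by (rule power_mono) auto
      thus ?thesis by (simp add: n i power_add power_mult power_mult_distrib[symmetric])
    qed
    finally show ?thesis .
  qed
qed

text \<open>The primes of a dyadic block have total logarithm at most \<open>2 * n\<close>; this is
  what removes the factor \<open>ln n\<close> that a sum over all integers of the block would
  carry.\<close>

lemma sum_ln_primes_doubling_le:
  assumes "n \<ge> 1"
  shows "(\<Sum>p\<in>{p. prime p \<and> n < p \<and> p \<le> 2 * n}. (1 + ln (real p)) / real p ^ 2) \<le> 6 / real n"
proof -
  let ?S = "{p. prime p \<and> n < p \<and> p \<le> 2 * n}"
  have fin: "finite ?S" by (rule finite_subset[of _ "{..2*n}"]) auto
  have "(\<Sum>p\<in>?S. (1 + ln (real p)) / real p ^ 2) \<le> (\<Sum>p\<in>?S. 3 * ln (real p) / real n ^ 2)"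
  proof (rule sum_mono, rule frac_le)
    fix p assume p: "p \<in> ?S"
    \<comment> \<open>From \<open>ln 2 \<ge> 2/3\<close> one gets \<open>1 \<le> 2 * ln p\<close>,
      so the 1 in the numerator is absorbed.\<close>
    have "ln 2 \<le> ln (real p)" using p prime_ge_2_nat[of p] by (subst ln_le_cancel_iff) auto
    thus "1 + ln (real p) \<le> 3 * ln (real p)" "0 \<le> 3 * ln (real p)" using ln2_ge_two_thirds by auto
    show "real n ^ 2 \<le> real p ^ 2" using p by (intro power_mono) auto
  qed (use assms in auto)
  also have "\<dots> = 3 / real n ^ 2 * (\<Sum>p\<in>?S. ln (real p))" by (simp add: sum_distrib_left sum_divide_distrib)
  also have "\<dots> \<le> 3 / real n ^ 2 * (real n * 2)"
  proof (rule mult_left_mono)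
    have "(\<Sum>p\<in>?S. ln (real p)) = ln (\<Prod>p\<in>?S. real p)"
      by (rule ln_prod[symmetric]) (auto simp: fin prime_gt_0_nat)
    also have "\<dots> = ln (real (\<Prod>?S))" by simp
    also have "\<dots> \<le> ln (4 ^ n)"
    proof (subst ln_le_cancel_iff)
      show "0 < real (\<Prod>?S)" by (auto intro!: prod_pos simp: prime_gt_0_nat)
      show "real (\<Prod>?S) \<le> 4 ^ n" using prod_primes_doubling_le[of n]
        by (metis of_nat_le_iff of_nat_numeral of_nat_power)
    qed auto
    also have "ln (4 ^ n :: real) = real n * (2 * ln 2)"
      using ln_realpow[of 2 2] by (simp add: ln_realpow)
    also have "\<dots> \<le> real n * 2" using ln_2_less_1 by (intro mult_left_mono) auto
    finally show "(\<Sum>p\<in>?S. ln (real p)) \<le> real n * 2" .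
  qed auto
  also have "\<dots> = 6 / real n" using assms by (simp add: power2_eq_square)
  finally show ?thesis .
qed

text \<open>Dyadic blocks starting at \<open>n = \<lfloor>w\<rfloor>\<close>: the geometric series
  of the block bounds \<open>6 / n\<close> gives \<open>12 / n\<close>, and
  \<open>w \<le> 2 * n\<close> turns this into \<open>24 / w\<close>. The factor
  \<open>24 / w\<close> in the later error terms comes from here.\<close>

lemma sum_ln_over_square_primes_le:
  assumes "finite F" "w \<ge> 1" and F: "\<And>p. p \<in> F \<Longrightarrow> prime p \<and> w < real p"
  shows "(\<Sum>p\<in>F. (1 + ln (real p)) / real p ^ 2) \<le> 24 / w"
proof -
  define n where "n = nat \<lfloor>w\<rfloor>"
  have n1: "n \<ge> 1" using assms by (simp add: n_def le_nat_floor)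
  let ?S = "\<lambda>j. {p. prime p \<and> n < p \<and> p \<le> 2 ^ j * n}"
  let ?f = "\<lambda>p. (1 + ln (real p)) / real p ^ 2"
  have fin: "finite (?S j)" for j by (rule finite_subset[of _ "{..2^j*n}"]) auto
  have nn: "?f p \<ge> 0" if "prime p" for p
  proof -
    have "real p \<ge> 1" using prime_ge_1_nat[OF that] by simp
    thus ?thesis by simp
  qed
  have dyadic: "(\<Sum>p\<in>?S j. ?f p) \<le> 12 / real n * (1 - 1 / 2 ^ j)" for j
  proof (induction j)
    case (Suc j)
    have "?S (Suc j) \<subseteq> ?S j \<union> {p. prime p \<and> 2 ^ j * n < p \<and> p \<le> 2 * (2 ^ j * n)}" by auto
    hence "(\<Sum>p\<in>?S (Suc j). ?f p) \<le> (\<Sum>p\<in>?S j \<union> {p. prime p \<and> 2 ^ j * n < p \<and> p \<le> 2 * (2 ^ j * n)}. ?f p)"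
      using fin nn by (intro sum_mono2) (auto intro: finite_subset[of _ "{..2 * (2 ^ j * n)}"])
    also have "\<dots> = (\<Sum>p\<in>?S j. ?f p) + (\<Sum>p\<in>{p. prime p \<and> 2 ^ j * n < p \<and> p \<le> 2 * (2 ^ j * n)}. ?f p)"
      using fin by (intro sum.union_disjoint) (auto intro: finite_subset[of _ "{..2 * (2 ^ j * n)}"])
    also have "\<dots> \<le> 12 / real n * (1 - 1 / 2 ^ j) + 6 / real (2 ^ j * n)"
      using n1 by (intro add_mono Suc.IH sum_ln_primes_doubling_le) (auto simp: Suc_le_eq)
    also have "\<dots> = 12 / real n * (1 - 1 / 2 ^ Suc j)" using n1 by (simp add: field_simps)
    finally show ?case .
  next
    case 0
    have "?S 0 = {}" by auto
    thus ?case by (simp only: sum.empty) simp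
  qed
  obtain j where j: "\<And>p. p \<in> F \<Longrightarrow> p \<le> 2 ^ j * n"
  proof -
    obtain b where b: "\<And>p. p \<in> F \<Longrightarrow> p \<le> b" using assms(1) by (meson finite_nat_set_iff_bounded_le)
    have "b \<le> 2 ^ b * 1" by (simp add: less_imp_le)
    also have "\<dots> \<le> 2 ^ b * n" using n1 by (intro mult_left_mono) auto
    finally show ?thesis using b that[of b] order_trans by blast
  qed
  have "F \<subseteq> ?S j"
  proof
    fix p assume p: "p \<in> F"
    have "real n \<le> w" using assms(2) by (simp add: n_def of_nat_floor)
    hence "n < p" using F[OF p] by linarith
    thus "p \<in> ?S j" using F[OF p] j[OF p] by simp
  qed
  hence "(\<Sum>p\<in>F. ?f p) \<le> (\<Sum>p\<in>?S j. ?f p)" using fin nn by (intro sum_mono2) auto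
  also have "\<dots> \<le> 12 / real n * (1 - 1 / 2 ^ j)" by (rule dyadic)
  also have "\<dots> \<le> 12 / real n" using n1 by (simp add: field_simps)
  also have "\<dots> \<le> 24 / w"
  proof -
    have "w \<le> 2 * real n" using n1 unfolding n_def by linarith
    thus ?thesis using assms(2) n1 by (simp add: field_simps)
  qed
  finally show ?thesis .
qed

section \<open>Means over residues and survival probabilities\<close>

definition residue_mean :: "int \<Rightarrow> (int \<Rightarrow> real) \<Rightarrow> real" where
  "residue_mean m f = (\<Sum>b\<in>{0..<m}. f b) / real_of_int m"

definition survivors :: "(nat \<Rightarrow> int set) \<Rightarrow> nat \<Rightarrow> int set \<Rightarrow> int set" where
  "survivors I p U = {r \<in> {0..<int p}. \<forall>u\<in>U. (u - r) mod int p \<notin> I p}"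

text \<open>The probability that all of \<open>U\<close> survives the randomly shifted sieve by the
  primes of \<open>A\<close>, defined through its local factors and identified with a mean over
  shifts in \<open>residue_mean_survival\<close>.\<close>

definition survival :: "(nat \<Rightarrow> int set) \<Rightarrow> nat set \<Rightarrow> int set \<Rightarrow> real" where
  "survival I A U = (\<Prod>p\<in>A. real (card (survivors I p U)) / real p)"

lemma residue_mean_mono:
  "m > 0 \<Longrightarrow> (\<And>b. b \<in> {0..<m} \<Longrightarrow> f b \<le> g b) \<Longrightarrow> residue_mean m f \<le> residue_mean m g"
  unfolding residue_mean_def by (intro divide_right_mono sum_mono) auto

lemma residue_mean_sum: "residue_mean m (\<lambda>b. \<Sum>i\<in>S. f i b) = (\<Sum>i\<in>S. residue_mean m (f i))"
  unfolding residue_mean_def by (subst sum.swap) (simp add: sum_divide_distrib)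

lemma residue_mean_cmult: "residue_mean m (\<lambda>b. c * f b) = c * residue_mean m f"
  unfolding residue_mean_def by (simp add: sum_distrib_left)

lemma residue_mean_multc: "residue_mean m (\<lambda>b. f b * c) = residue_mean m f * c"
  unfolding residue_mean_def by (simp add: sum_distrib_right)

lemma residue_mean_const: "m > 0 \<Longrightarrow> residue_mean m (\<lambda>b. c) = c"
  unfolding residue_mean_def by simp

lemma residue_mean_weighted_lower:
  assumes "m > 0" "\<And>r. x r \<ge> (0::real)" "\<And>r. F r \<ge> c"
  shows "residue_mean m (\<lambda>r. x r * F r) \<ge> residue_mean m x * c"
  unfolding residue_mean_multc[symmetric] using assms by (intro residue_mean_mono mult_left_mono) auto

lemma residue_mean_weighted_upper:
  assumes "m > 0" "\<And>r. x r \<ge> (0::real)" "\<And>r. x r \<noteq> 0 \<Longrightarrow> F r \<le> c"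
  shows "residue_mean m (\<lambda>r. x r * F r) \<le> residue_mean m x * c"
  unfolding residue_mean_multc[symmetric]
proof (rule residue_mean_mono[OF assms(1)])
  fix r show "x r * F r \<le> x r * c" using assms(2,3)[of r] by (cases "x r = 0") (auto intro: mult_left_mono)
qed

text \<open>The Chinese remainder theorem read as independence: the two reductions of a uniform
  residue modulo \<open>m * n\<close> are uniform and independent.\<close>

lemma residue_mean_mult:
  assumes "coprime m n" "m > 0" "n > 0"
  shows "residue_mean (m * n) (\<lambda>b. G (b mod m) (b mod n)) = residue_mean m (\<lambda>r. residue_mean n (G r))"
proof -
  let ?f = "\<lambda>b. (b mod m, b mod n)"
  have inj: "inj_on ?f {0..<m * n}"
  proof (rule inj_onI)
    fix a b assume ab: "a \<in> {0..<m * n}" "b \<in> {0..<m * n}" "?f a = ?f b"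
    hence "[a = b] (mod m)" "[a = b] (mod n)" by (auto simp: cong_def)
    hence "[a = b] (mod (m * n))" using assms(1) by (intro coprime_cong_mult) auto
    thus "a = b" using ab by (simp add: cong_def)
  qed
  have sub: "?f ` {0..<m * n} \<subseteq> {0..<m} \<times> {0..<n}" using assms by auto
  have "card (?f ` {0..<m * n}) = card ({0..<m} \<times> {0..<n})"
    using inj assms by (simp add: card_image card_cartesian_product nat_mult_distrib)
  hence img: "?f ` {0..<m * n} = {0..<m} \<times> {0..<n}" using sub by (intro card_subset_eq) auto
  have "(\<Sum>b\<in>{0..<m * n}. G (b mod m) (b mod n)) = (\<Sum>b\<in>{0..<m*n}. (\<lambda>(r, s). G r s) (?f b))" by simp
  also have "\<dots> = (\<Sum>(r, s)\<in>?f ` {0..<m*n}. G r s)" using inj by (simp add: sum.reindex)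
  also have "\<dots> = (\<Sum>r\<in>{0..<m}. \<Sum>s\<in>{0..<n}. G r s)" by (simp add: img sum.cartesian_product)
  finally show ?thesis unfolding residue_mean_def by (simp add: sum_divide_distrib divide_divide_eq_left mult.commute)
qed

lemma residue_mean_prod_primes:
  assumes "finite F" "\<And>p. p \<in> F \<Longrightarrow> prime p"
  shows "residue_mean (\<Prod>p\<in>F. int p) (\<lambda>b. \<Prod>p\<in>F. g p (b mod int p)) = (\<Prod>p\<in>F. residue_mean (int p) (g p))"
  using assms
proof (induction F rule: finite_induct)
  case empty
  show ?case by (simp add: residue_mean_def)
next
  case (insert q F)
  let ?P = "\<Prod>p\<in>F. int p"
  have pos: "?P > 0" using insert by (auto intro!: prod_pos simp: prime_gt_0_nat)
  have cop: "coprime (int q) ?P"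
    by (rule prod_coprime_right) (use insert in \<open>auto intro!: primes_coprime\<close>)
  have "residue_mean (\<Prod>p\<in>insert q F. int p) (\<lambda>b. \<Prod>p\<in>insert q F. g p (b mod int p))
      = residue_mean (int q * ?P) (\<lambda>b. g q (b mod int q) * (\<Prod>p\<in>F. g p ((b mod ?P) mod int p)))"
  proof -
    have "(b mod ?P) mod int p = b mod int p" if "p \<in> F" for b p
      using that insert.hyps by (intro mod_mod_cancel dvd_prodI) auto
    thus ?thesis using insert.hyps by simp
  qed
  also have "\<dots> = residue_mean (int q) (\<lambda>r. residue_mean ?P (\<lambda>s. g q r * (\<Prod>p\<in>F. g p (s mod int p))))"
    using residue_mean_mult[OF cop, of "\<lambda>r s. g q r * (\<Prod>p\<in>F. g p (s mod int p))"] pos insert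
    by (simp add: prime_gt_0_nat)
  also have "\<dots> = residue_mean (int q) (g q) * residue_mean ?P (\<lambda>s. \<Prod>p\<in>F. g p (s mod int p))"
    by (simp add: residue_mean_cmult residue_mean_multc)
  finally show ?case using insert by simp
qed

lemma mem_translate_sifted: "n \<in> translate (sifted I A) b \<longleftrightarrow> (\<forall>p\<in>A. (n - b) mod int p \<notin> I p)"
proof -
  have "n \<in> translate (sifted I A) b \<longleftrightarrow> n - b \<in> sifted I A"
    by (auto simp: translate_def image_iff) (metis diff_add_cancel)
  thus ?thesis by (simp add: sifted_def)
qed

lemma modulus_pos: "(\<And>p. p \<in> A \<Longrightarrow> prime p) \<Longrightarrow> modulus I A > 0"
  unfolding modulus_def by (auto intro!: prod_pos simp: prime_gt_0_nat)

lemma mod_modulus_cong: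
  assumes "finite A" "p \<in> A" "I p \<noteq> {}"
  shows "(u - b mod modulus I A) mod int p = (u - b) mod int p"
proof -
  have "int p dvd modulus I A" unfolding modulus_def using assms by (intro dvd_prodI) auto
  hence "(b mod modulus I A) mod int p = b mod int p" by (rule mod_mod_cancel)
  thus ?thesis by (metis mod_diff_right_eq)
qed

text \<open>Reducing \<open>b\<close> may change its residue at primes of \<open>A\<close> that do
  not divide the modulus, but these have \<open>I p = {}\<close> and impose no condition.\<close>

lemma mem_translate_sifted_mod:
  assumes "finite A"
  shows "n \<in> translate (sifted I A) (b mod modulus I A) \<longleftrightarrow> n \<in> translate (sifted I A) b"
  unfolding mem_translate_sifted using mod_modulus_cong[OF assms] by (metis empty_iff)

lemma residue_mean_survival:
  assumes "finite A" "\<And>p. p \<in> A \<Longrightarrow> prime p"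
  shows "residue_mean (modulus I A) (\<lambda>b. of_bool (U \<subseteq> translate (sifted I A) b)) = survival I A U"
proof -
  let ?F = "{p\<in>A. I p \<noteq> {}}"
  let ?g = "\<lambda>p r. of_bool (\<forall>u\<in>U. (u - r) mod int p \<notin> I p) :: real"
  have "of_bool (U \<subseteq> translate (sifted I A) b) = (\<Prod>p\<in>?F. ?g p (b mod int p))" for b
  proof -
    have "U \<subseteq> translate (sifted I A) b \<longleftrightarrow> (\<forall>p\<in>?F. \<forall>u\<in>U. (u - b mod int p) mod int p \<notin> I p)"
      by (auto simp: subset_iff mem_translate_sifted mod_diff_right_eq)
    thus ?thesis using assms(1)
      by (cases "U \<subseteq> translate (sifted I A) b") (auto simp: prod_zero_iff)
  qed
  hence "residue_mean (modulus I A) (\<lambda>b. of_bool (U \<subseteq> translate (sifted I A) b))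
      = residue_mean (\<Prod>p\<in>?F. int p) (\<lambda>b. \<Prod>p\<in>?F. ?g p (b mod int p))"
    by (simp add: modulus_def)
  also have "\<dots> = (\<Prod>p\<in>?F. residue_mean (int p) (?g p))"
    by (rule residue_mean_prod_primes) (use assms in auto)
  also have "\<dots> = (\<Prod>p\<in>?F. real (card (survivors I p U)) / real p)"
  proof (rule prod.cong)
    fix p assume "p \<in> ?F"
    have "(\<Sum>r\<in>{0..<int p}. ?g p r) = (\<Sum>r\<in>survivors I p U. 1)"
      unfolding survivors_def by (rule sum.mono_neutral_cong_right) auto
    thus "residue_mean (int p) (?g p) = real (card (survivors I p U)) / real p" by (simp add: residue_mean_def)
  qed auto
  \<comment> \<open>The modulus omits the primes with empty \<open>I p\<close>; their local factor
    is 1.\<close>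
  also have "\<dots> = survival I A U" unfolding survival_def
  proof (rule prod.mono_neutral_left)
    show "\<forall>p\<in>A - ?F. real (card (survivors I p U)) / real p = 1"
    proof
      fix p assume p: "p \<in> A - ?F"
      hence "survivors I p U = {0..<int p}" by (auto simp: survivors_def)
      hence "card (survivors I p U) = p" by simp
      thus "real (card (survivors I p U)) / real p = 1" using p assms(2)[of p] by (simp add: prime_gt_0_nat)
    qed
  qed (use assms in auto)
  finally show ?thesis .
qed

section \<open>Local combinatorics of the sets \<open>I p\<close>: blocked shifts and
  collisions\<close>

locale sieve =
  fixes I :: "nat \<Rightarrow> int set" and B :: real
  assumes sieving: "sieving_system I" and nondeg: "non_degenerate I" and bound: "bounded_by B I"
begin

lemma I_sub: "prime p \<Longrightarrow> I p \<subseteq> {0..<int p}"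
  using sieving by (simp add: sieving_system_def)

lemma finite_I [intro]: "prime p \<Longrightarrow> finite (I p)"
  using I_sub finite_subset by blast

lemma card_I: "prime p \<Longrightarrow> real (card (I p)) \<le> B"
  using bound by (simp add: bounded_by_def)

lemma B_nonneg: "B \<ge> 0"
  using card_I[OF two_is_prime_nat] by linarith

lemma card_I_less: "prime p \<Longrightarrow> card (I p) < p"
  using nondeg by (metis non_degenerate_def diff_less le_less_trans less_one prime_gt_0_nat)

lemma density_factor:
  assumes "prime p"
  shows "0 < 1 - real (card (I p)) / real p" "1 - real (card (I p)) / real p \<le> 1"
  using card_I_less[OF assms] by (auto simp: field_simps)

lemma sieve_density_pos:
  "(\<And>p. p \<in> A \<Longrightarrow> prime p) \<Longrightarrow> sieve_density I A > 0"
  unfolding sieve_density_def by (intro prod_pos density_factor) auto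

lemma sieve_density_le_1:
  "(\<And>p. p \<in> A \<Longrightarrow> prime p) \<Longrightarrow> sieve_density I A \<le> 1"
  unfolding sieve_density_def by (intro prod_le_1) (auto intro!: density_factor less_imp_le[OF density_factor(1)] simp del: diff_ge_0_iff_ge)

definition blocked :: "nat \<Rightarrow> int \<Rightarrow> int set" where
  "blocked p u = {r \<in> {0..<int p}. (u - r) mod int p \<in> I p}"

text \<open>The diagonal value \<open>m = 0\<close> is set to \<open>0\<close>, so that sums over ordered pairs may include equal ones.\<close>

definition collisions :: "nat \<Rightarrow> int \<Rightarrow> real" where
  "collisions p m = (if m = 0 then 0 else real (card {(i, j) \<in> I p \<times> I p. [i - j = m] (mod int p)}))"

lemma collisions_nonneg: "collisions p m \<ge> 0"
  by (simp add: collisions_def)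

lemma inj_on_diff_mod: "inj_on (\<lambda>r. (u - r) mod int p) {0..<int p}"
proof (rule inj_onI)
  fix a b assume *: "a \<in> {0..<int p}" "b \<in> {0..<int p}" "(u - a) mod int p = (u - b) mod int p"
  hence "[u - a = u - b] (mod int p)" by (simp add: cong_def)
  hence "[u - (u - a) = u - (u - b)] (mod int p)" by (rule cong_diff[OF cong_refl])
  hence "[a = b] (mod int p)" by (simp only: diff_diff_eq2 add_diff_cancel_left')
  thus "a = b" using * by (simp add: cong_def)
qed

lemma card_blocked:
  assumes "prime p"
  shows "card (blocked p u) = card (I p)"
proof (rule bij_betw_same_card[of "\<lambda>r. (u - r) mod int p"])
  have "(\<lambda>r. (u - r) mod int p) ` blocked p u = I p"
  proof (intro equalityI subsetI)
    fix i assume i: "i \<in> I p"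
    hence "i \<in> {0..<int p}" using I_sub[OF assms] by auto
    hence "(u - (u - i) mod int p) mod int p = i" by (simp add: mod_diff_right_eq)
    moreover have "(u - i) mod int p \<in> {0..<int p}" using assms by (simp add: prime_gt_0_nat)
    ultimately show "i \<in> (\<lambda>r. (u - r) mod int p) ` blocked p u"
      using i by (intro image_eqI[of _ _ "(u - i) mod int p"]) (auto simp: blocked_def)
  qed (auto simp: blocked_def)
  moreover have "inj_on (\<lambda>r. (u - r) mod int p) (blocked p u)"
    by (rule inj_on_subset[OF inj_on_diff_mod]) (auto simp: blocked_def)
  ultimately show "bij_betw (\<lambda>r. (u - r) mod int p) (blocked p u) (I p)" by (simp add: bij_betw_def)
qed

lemma finite_blocked [simp]: "finite (blocked p u)"
  unfolding blocked_def by (rule finite_subset[of _ "{0..<int p}"]) auto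

text \<open>A shift \<open>r\<close> that blocks both \<open>u\<close> and \<open>v\<close> yields
  the pair of residues of \<open>u - r\<close> and \<open>v - r\<close> in \<open>I p\<close>, whose
  difference is \<open>u - v\<close>; either residue determines the shift.\<close>

lemma card_blocked_Int_le:
  assumes "prime p" "u \<noteq> v"
  shows "real (card (blocked p u \<inter> blocked p v)) \<le> collisions p (u - v)"
proof -
  let ?f = "\<lambda>r. ((u - r) mod int p, (v - r) mod int p)"
  have "card (blocked p u \<inter> blocked p v) \<le> card {(i, j) \<in> I p \<times> I p. [i - j = u - v] (mod int p)}"
  proof (rule card_inj_on_le[of ?f])
    have "inj_on (\<lambda>r. (u - r) mod int p) (blocked p u \<inter> blocked p v)"
      by (rule inj_on_subset[OF inj_on_diff_mod]) (auto simp: blocked_def)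
    thus "inj_on ?f (blocked p u \<inter> blocked p v)" by (auto simp: inj_on_def)
    show "finite {(i, j) \<in> I p \<times> I p. [i - j = u - v] (mod int p)}"
      using finite_I[OF assms(1)] by (auto intro: finite_subset[of _ "I p \<times> I p"])
    have "[(u - r) mod int p - (v - r) mod int p = u - v] (mod int p)" for r
      by (simp add: cong_def mod_diff_eq)
    thus "?f ` (blocked p u \<inter> blocked p v) \<subseteq> {(i, j) \<in> I p \<times> I p. [i - j = u - v] (mod int p)}"
      by (auto simp: blocked_def)
  qed
  thus ?thesis using assms(2) by (simp add: collisions_def)
qed

lemma card_Un_blocked_le:
  assumes "prime p" "finite U"
  shows "real (card (\<Union>u\<in>U. blocked p u)) \<le> real (card U) * real (card (I p))"
proof -
  have "card (\<Union>u\<in>U. blocked p u) \<le> (\<Sum>u\<in>U. card (blocked p u))" using assms by (intro card_UN_le)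
  also have "\<dots> = card U * card (I p)" using assms by (simp add: card_blocked)
  finally show ?thesis by (metis of_nat_le_iff of_nat_mult)
qed

text \<open>Bonferroni's inequality. Summation over ordered pairs counts every overlap twice, which
  only weakens the bound and spares a choice of order on \<open>U\<close>.\<close>

lemma card_Un_blocked_ge:
  assumes "prime p" "finite U"
  shows "real (card (\<Union>u\<in>U. blocked p u)) \<ge> real (card U) * real (card (I p)) - (\<Sum>u\<in>U. \<Sum>v\<in>U. collisions p (u - v))"
  using assms(2)
proof (induction U rule: finite_induct)
  case (insert a U)
  let ?X = "\<Union>u\<in>U. blocked p u"
  have "real (card (blocked p a \<inter> ?X)) \<le> (\<Sum>u\<in>U. real (card (blocked p a \<inter> blocked p u)))"
  proof -
    have "card (\<Union>u\<in>U. blocked p a \<inter> blocked p u) \<le> (\<Sum>u\<in>U. card (blocked p a \<inter> blocked p u))"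
      using insert.hyps by (intro card_UN_le)
    hence "card (blocked p a \<inter> ?X) \<le> (\<Sum>u\<in>U. card (blocked p a \<inter> blocked p u))" by simp
    thus ?thesis by (simp flip: of_nat_sum)
  qed
  also have "\<dots> \<le> (\<Sum>u\<in>U. collisions p (a - u))"
    using insert.hyps assms(1) by (intro sum_mono card_blocked_Int_le) auto
  finally have 1: "real (card (blocked p a \<inter> ?X)) \<le> (\<Sum>u\<in>U. collisions p (a - u))" .
  have 2: "real (card (blocked p a \<union> ?X)) + real (card (blocked p a \<inter> ?X)) = real (card (I p)) + real (card ?X)"
    using card_Un_Int[of "blocked p a" ?X] insert.hyps card_blocked[OF assms(1)]
    by (metis finite_UN_I finite_blocked of_nat_add)
  have 3: "(\<Sum>u\<in>U. collisions p (a - u)) + (\<Sum>u\<in>U. \<Sum>v\<in>U. collisions p (u - v))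
     \<le> (\<Sum>u\<in>insert a U. \<Sum>v\<in>insert a U. collisions p (u - v))"
  proof -
    have "0 \<le> (\<Sum>u\<in>U. collisions p (u - a))" "collisions p (a - a) \<ge> 0"
      by (auto intro!: sum_nonneg collisions_nonneg)
    thus ?thesis using insert.hyps by (simp add: sum.distrib)
  qed
  have "real (card (\<Union>u\<in>insert a U. blocked p u)) = real (card (blocked p a \<union> ?X))" by simp
  moreover have "real (card (insert a U)) * real (card (I p)) = real (card (I p)) + real (card U) * real (card (I p))"
    using insert.hyps by (simp add: algebra_simps)
  ultimately show ?case using 1 2 3 insert.IH by linarith
qed auto

lemma card_survivors:
  assumes "prime p" "finite U"
  shows "real (card (survivors I p U)) / real p = 1 - real (card (\<Union>u\<in>U. blocked p u)) / real p"
proof -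
  have "survivors I p U = {0..<int p} - (\<Union>u\<in>U. blocked p u)" by (auto simp: survivors_def blocked_def)
  moreover have sub: "(\<Union>u\<in>U. blocked p u) \<subseteq> {0..<int p}" by (auto simp: blocked_def)
  moreover have "card (\<Union>u\<in>U. blocked p u) \<le> p" using card_mono[OF _ sub] by simp
  ultimately have "real (card (survivors I p U)) = real p - real (card (\<Union>u\<in>U. blocked p u))"
    using assms(2) by (simp add: card_Diff_subset of_nat_diff)
  thus ?thesis using assms(1) by (simp add: field_simps prime_gt_0_nat)
qed

lemma survival_singleton:
  assumes "\<And>p. p \<in> A \<Longrightarrow> prime p"
  shows "survival I A {u} = sieve_density I A"
  unfolding survival_def sieve_density_def
  by (rule prod.cong) (auto simp: card_survivors card_blocked assms)

end

section \<open>Bounds for survival probabilities\<close>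

lemma exp_le_one_plus_mult_exp:
  fixes t c :: real
  assumes "0 \<le> t" "t \<le> c"
  shows "exp t \<le> 1 + t * exp c"
proof -
  have "1 - t \<le> exp (- t)" using exp_ge_add_one_self[of "- t"] by simp
  hence "(1 - t) * exp t \<le> exp (- t) * exp t" by (intro mult_right_mono) auto
  hence "exp t \<le> 1 + t * exp t" by (simp add: algebra_simps flip: exp_add)
  also have "\<dots> \<le> 1 + t * exp c" using assms by (intro add_mono mult_left_mono) auto
  finally show ?thesis .
qed

text \<open>Convexity of \<open>exp\<close> at the average of the numbers
  \<open>card S * x i\<close>. A joint exponential splits into one exponential per index, at the
  price of the factor \<open>card S\<close> in the exponent.\<close>

lemma exp_sum_le_mean:
  fixes x :: "'a \<Rightarrow> real"
  assumes "finite S" "S \<noteq> {}"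
  shows "exp (\<Sum>i\<in>S. x i) \<le> (\<Sum>i\<in>S. exp (real (card S) * x i)) / real (card S)"
proof -
  let ?n = "real (card S)"
  have n: "?n > 0" using assms by (simp add: card_gt_0_iff)
  have "exp (\<Sum>i\<in>S. (1 / ?n) *\<^sub>R (?n * x i)) \<le> (\<Sum>i\<in>S. (1 / ?n) * exp (?n * x i))"
    using assms n by (intro convex_on_sum[OF _ _ exp_convex]) (auto simp: card_gt_0_iff)
  thus ?thesis using n by (simp add: sum_divide_distrib)
qed

lemma ln_one_minus_ge:
  fixes b :: real
  assumes "0 \<le> b" "b < 1"
  shows "b \<le> - ln (1 - b)"
  using ln_add_one_self_le_self2[of "- b"] assms by simp

context sieve
begin

lemma density_ratio_le:
  assumes "prime p"
  shows "real (card (I p)) / real p \<le> - ln (1 - real (card (I p)) / real p)"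
  using density_factor[OF assms] by (intro ln_one_minus_ge) auto

text \<open>Exponentials of sums of \<open>card (I p) / p\<close> thus become powers of the sieve
  density, so that a lower bound for the density is all that has to be known about them.\<close>

lemma sum_density_ratio_le:
  assumes "finite A" "\<And>p. p \<in> A \<Longrightarrow> prime p"
  shows "(\<Sum>p\<in>A. real (card (I p)) / real p) \<le> - ln (sieve_density I A)"
proof -
  have "ln (sieve_density I A) = (\<Sum>p\<in>A. ln (1 - real (card (I p)) / real p))"
    unfolding sieve_density_def
  proof (rule ln_prod)
    show "1 - real (card (I p)) / real p \<noteq> 0" if "p \<in> A" for p
      using density_factor(1)[OF assms(2)[OF that]] by linarith
  qed (rule assms)
  moreover have "(\<Sum>p\<in>A. real (card (I p)) / real p) \<le> (\<Sum>p\<in>A. - ln (1 - real (card (I p)) / real p))"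
    using assms by (intro sum_mono density_ratio_le) auto
  ultimately show ?thesis by (simp add: sum_negf)
qed

text \<open>With \<open>n = card U\<close> and \<open>b = card (I p) / p\<close> the union bound
  makes each local factor at least \<open>1 - n * b\<close>. By Bernoulli
  \<open>(1 - b) ^ n * (1 + n * b) \<le> (1 - b ^ 2) ^ n \<le> 1\<close>, and multiplication by
  \<open>1 - n * b\<close> gives \<open>(1 - b) ^ n * (1 - (n * b) ^ 2) \<le> 1 - n * b\<close>. The
  product of the factors \<open>1 - (n * b) ^ 2\<close> is estimated by the Weierstrass
  inequality.\<close>

lemma survival_ge:
  assumes A: "finite A" "w \<ge> 1" "\<And>p. p \<in> A \<Longrightarrow> prime p \<and> w < real p"
    and U: "finite U" "real (card U) \<le> k" "k * B \<le> w"
  shows "survival I A U \<ge> sieve_density I A ^ card U * (1 - (k * B) ^ 2 * (24 / w))"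
proof -
  let ?k = "real (card U)" and ?b = "\<lambda>p. real (card (I p)) / real p"
  have kb: "?k * ?b p \<le> 1" "0 \<le> ?b p" "?b p \<le> 1" "?k * ?b p \<le> k * B / real p" if "p \<in> A" for p
  proof -
    have p: "prime p" "w < real p" "real p > 0" using A that by (auto simp: prime_gt_0_nat)
    have "?k * real (card (I p)) \<le> k * B" using U card_I[OF p(1)] by (intro mult_mono) auto
    thus "?k * ?b p \<le> k * B / real p" using p by (simp add: divide_right_mono)
    also have "\<dots> \<le> 1" using U p by simp
    finally show "?k * ?b p \<le> 1" .
    show "0 \<le> ?b p" "?b p \<le> 1" using density_factor[OF p(1)] by auto
  qed
  have local_factor: "(1 - ?b p) ^ card U * (1 - (?k * ?b p) ^ 2) \<le> 1 - ?k * ?b p" if p: "p \<in> A" for p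
  proof -
    have "(1 - ?b p) ^ card U * (1 + ?k * ?b p) \<le> (1 - ?b p) ^ card U * (1 + ?b p) ^ card U"
      using kb[OF p] Bernoulli_inequality[of "?b p" "card U"] order_trans[OF _ kb(2)[OF p], of "- 1"]
      by (intro mult_left_mono) auto
    also have "\<dots> = (1 - ?b p ^ 2) ^ card U" by (simp add: power_mult_distrib[symmetric] power2_eq_square algebra_simps)
    also have "\<dots> \<le> 1" using kb[OF p] by (intro power_le_one) (auto simp: power_le_one)
    finally have "(1 - ?b p) ^ card U * (1 + ?k * ?b p) * (1 - ?k * ?b p) \<le> 1 * (1 - ?k * ?b p)"
      using kb[OF p] by (intro mult_right_mono) auto
    moreover have "(1 + ?k * ?b p) * (1 - ?k * ?b p) = 1 - (?k * ?b p) ^ 2"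
      by (simp add: power2_eq_square algebra_simps)
    ultimately show ?thesis by (simp only: mult.assoc mult_1)
  qed
  have "sieve_density I A ^ card U * (1 - (k * B) ^ 2 * (24 / w))
      \<le> (\<Prod>p\<in>A. (1 - ?b p) ^ card U) * (\<Prod>p\<in>A. 1 - (?k * ?b p) ^ 2)"
  proof -
    have eq: "sieve_density I A ^ card U = (\<Prod>p\<in>A. (1 - ?b p) ^ card U)"
      by (simp add: sieve_density_def prod_power_distrib)
    have "1 - (k * B) ^ 2 * (24 / w) \<le> 1 - (\<Sum>p\<in>A. (?k * ?b p) ^ 2)"
    proof -
      have "(\<Sum>p\<in>A. (?k * ?b p) ^ 2) \<le> (\<Sum>p\<in>A. (k * B) ^ 2 * ((1 + ln (real p)) / real p ^ 2))"
      proof (rule sum_mono)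
        fix p assume p: "p \<in> A"
        have p0: "real p \<ge> 1" using A(2,3) p by fastforce
        have "(?k * ?b p) ^ 2 \<le> (k * B / real p) ^ 2" using kb[OF p] by (intro power_mono) auto
        also have "\<dots> = (k * B) ^ 2 * (1 / real p ^ 2)" by (simp add: power_divide)
        also have "\<dots> \<le> (k * B) ^ 2 * ((1 + ln (real p)) / real p ^ 2)"
          using p0 by (intro mult_left_mono divide_right_mono) auto
        finally show "(?k * ?b p) ^ 2 \<le> (k * B) ^ 2 * ((1 + ln (real p)) / real p ^ 2)" .
      qed
      also have "\<dots> = (k * B) ^ 2 * (\<Sum>p\<in>A. (1 + ln (real p)) / real p ^ 2)" by (simp add: sum_distrib_left)
      also have "\<dots> \<le> (k * B) ^ 2 * (24 / w)"
        using A by (intro mult_left_mono sum_ln_over_square_primes_le) auto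
      finally show ?thesis by simp
    qed
    also have "\<dots> \<le> (\<Prod>p\<in>A. 1 - (?k * ?b p) ^ 2)"
      by (rule Weierstrass_prod_ineq) (use kb in \<open>auto intro!: power_le_one\<close>)
    finally have "1 - (k * B) ^ 2 * (24 / w) \<le> (\<Prod>p\<in>A. 1 - (?k * ?b p) ^ 2)" .
    thus ?thesis unfolding eq using kb by (intro mult_left_mono prod_nonneg) auto
  qed
  also have "\<dots> = (\<Prod>p\<in>A. (1 - ?b p) ^ card U * (1 - (?k * ?b p) ^ 2))" by (simp add: prod.distrib)
  also have "\<dots> \<le> survival I A U" unfolding survival_def
  proof (rule prod_mono)
    fix p assume p: "p \<in> A"
    have "real (card (\<Union>u\<in>U. blocked p u)) / real p \<le> ?k * real (card (I p)) / real p"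
      using card_Un_blocked_le[of p U] A p U by (intro divide_right_mono) auto
    hence "1 - ?k * ?b p \<le> real (card (survivors I p U)) / real p"
      using card_survivors[of p U] A p U by simp
    moreover have "0 \<le> 1 - (?k * ?b p) ^ 2" using kb[OF p] by (simp add: power_le_one)
    ultimately show "0 \<le> (1 - ?b p) ^ card U * (1 - (?k * ?b p) ^ 2) \<and>
        (1 - ?b p) ^ card U * (1 - (?k * ?b p) ^ 2) \<le> real (card (survivors I p U)) / real p"
      using local_factor[OF p] kb[OF p] by auto
  qed
  finally show ?thesis .
qed

text \<open>For given \<open>m\<close>, the second residue of a pair determines the first.\<close>

lemma collisions_le_B:
  assumes "prime p"
  shows "collisions p m \<le> B"
proof -
  let ?C = "{(i, j) \<in> I p \<times> I p. [i - j = m] (mod int p)}"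
  have "card ?C \<le> card (I p)"
  proof (rule card_inj_on_le[of snd])
    show "inj_on snd ?C"
    proof (rule inj_onI, clarsimp)
      fix i j k assume *: "i \<in> I p" "k \<in> I p" "[i - j = m] (mod int p)" "[k - j = m] (mod int p)"
      have "[i - j + j = k - j + j] (mod int p)" using * by (intro cong_add) (auto simp: cong_def)
      hence "[i = k] (mod int p)" by simp
      moreover have "i \<in> {0..<int p}" "k \<in> {0..<int p}" using * I_sub[OF assms] by auto
      ultimately show "i = k" by (simp add: cong_def)
    qed
  qed (use finite_I[OF assms] in auto)
  thus ?thesis using card_I[OF assms] B_nonneg by (simp add: collisions_def)
qed

text \<open>Subtracting 1 removes the empty set of primes from the expansion of the product, so that
  only moduli greater than 1 have to be counted.\<close>

definition pair_err :: "nat set \<Rightarrow> real \<Rightarrow> int \<Rightarrow> real" where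
  "pair_err A a m = (\<Prod>p\<in>A. 1 + a * collisions p m / real p) - 1"

lemma pair_err_nonneg: "a \<ge> 0 \<Longrightarrow> pair_err A a m \<ge> 0"
proof -
  assume "a \<ge> 0"
  hence "(\<Prod>p\<in>A. 1) \<le> (\<Prod>p\<in>A. 1 + a * collisions p m / real p)"
    using collisions_nonneg by (intro prod_mono) auto
  thus ?thesis by (simp add: pair_err_def)
qed

lemma pair_err_0 [simp]: "pair_err A a 0 = 0"
  by (simp add: pair_err_def collisions_def)

lemma survival_le_prod:
  assumes A: "\<And>p. p \<in> A \<Longrightarrow> prime p \<and> w < real p" and U: "finite U" "2 * real (card U) * B \<le> w"
  shows "survival I A U \<le> sieve_density I A ^ card U *
           (\<Prod>p\<in>A. 1 + 2 * (\<Sum>u\<in>U. \<Sum>v\<in>U. collisions p (u - v)) / real p)"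
proof -
  let ?k = "real (card U)" and ?b = "\<lambda>p. real (card (I p)) / real p"
  let ?R = "\<lambda>p. \<Sum>u\<in>U. \<Sum>v\<in>U. collisions p (u - v)"
  have "survival I A U \<le> (\<Prod>p\<in>A. (1 - ?b p) ^ card U * (1 + 2 * ?R p / real p))"
    unfolding survival_def
  proof (rule prod_mono)
    fix p assume "p \<in> A"
    hence p: "prime p" "w < real p" "real p > 0" using A by (auto simp: prime_gt_0_nat)
    have R: "?R p \<ge> 0" by (intro sum_nonneg collisions_nonneg)
    have "?k * real (card (I p)) \<le> ?k * B" using card_I[OF p(1)] by (intro mult_left_mono) auto
    hence "2 * (?k * real (card (I p))) \<le> real p" using U p by linarith
    hence kb: "?k * ?b p \<le> 1 / 2" using p by (simp add: field_simps)
    have b: "?b p \<le> 1" using density_factor[OF p(1)] by auto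
    have "real (card (survivors I p U)) / real p \<le> 1 - ?k * ?b p + ?R p / real p"
    proof -
      have "(?k * real (card (I p)) - ?R p) / real p \<le> real (card (\<Union>u\<in>U. blocked p u)) / real p"
        using card_Un_blocked_ge[OF p(1) U(1)] by (rule divide_right_mono) auto
      thus ?thesis unfolding card_survivors[OF p(1) U(1)] by (simp add: diff_divide_distrib)
    qed
    \<comment> \<open>For \<open>t \<le> 1/2\<close> and \<open>r \<ge> 0\<close> one has
      \<open>1 - t + r \<le> (1 - t) * (1 + 2 * r)\<close>, which turns the overlaps into a separate
      factor; the assumption \<open>2 * card U * B \<le> w\<close> provides
      \<open>t \<le> 1/2\<close>.\<close>
    also have "\<dots> \<le> (1 - ?k * ?b p) * (1 + 2 * ?R p / real p)"
    proof -
      have "1 - t + r \<le> (1 - t) * (1 + 2 * r)" if "t \<le> 1 / 2" "r \<ge> 0" for t r :: real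
        using mult_left_mono[OF that] by (simp add: algebra_simps)
      from this[of "?k * ?b p" "?R p / real p"] show ?thesis using kb R p by simp
    qed
    also have "\<dots> \<le> (1 - ?b p) ^ card U * (1 + 2 * ?R p / real p)"
      using Bernoulli_inequality[of "- ?b p" "card U"] b R p by (intro mult_right_mono) auto
    finally show "0 \<le> real (card (survivors I p U)) / real p \<and>
       real (card (survivors I p U)) / real p \<le> (1 - ?b p) ^ card U * (1 + 2 * ?R p / real p)" by simp
  qed
  also have "\<dots> = sieve_density I A ^ card U * (\<Prod>p\<in>A. 1 + 2 * ?R p / real p)"
    by (simp add: prod.distrib sieve_density_def prod_power_distrib)
  finally show ?thesis .
qed

text \<open>The pairs are indexed by a fixed set \<open>J\<close> instead of \<open>U\<close>: then
  \<open>T\<close> and \<open>a\<close> do not vary with \<open>U\<close>, and for fixed indices the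
  difference \<open>e i - e j\<close> will be a linear form in the variables that are averaged
  later. In \<open>a\<close>, the factor \<open>T\<close> is the price of Jensen's inequality, the 2
  comes from the local bound, and the exponential from \<open>exp t \<le> 1 + t * exp c\<close> with
  \<open>c = 2 * T * B / w\<close>, a common bound for the exponents.\<close>

lemma survival_le:
  assumes A: "finite A" "\<And>p. p \<in> A \<Longrightarrow> prime p \<and> w < real p" "w > 0"
    and U: "U \<subseteq> e ` J" "2 * real (card U) * B \<le> w" and J: "finite J" "J \<noteq> {}"
    and T: "T = real (card J) ^ 2" "a = 2 * T * exp (2 * T * B / w)"
  shows "survival I A U \<le> sieve_density I A ^ card U *
           (1 + (\<Sum>i\<in>J. \<Sum>j\<in>J. pair_err A a (e i - e j)) / T)"
proof -
  have primes: "prime p" "w < real p" "real p > 0" if "p \<in> A" for p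
    using A that by (auto simp: prime_gt_0_nat)
  let ?R = "\<lambda>p. \<Sum>u\<in>U. \<Sum>v\<in>U. collisions p (u - v)"
  let ?c = "\<lambda>p t. collisions p (e (fst t) - e (snd t))"
  have finU: "finite U" using U J finite_subset by blast
  have T0: "T > 0" using J by (simp add: T card_gt_0_iff)
  have cardJJ: "real (card (J \<times> J)) = T" by (simp add: T card_cartesian_product power2_eq_square)
  \<comment> \<open>One index is chosen for every element of \<open>U\<close>; the other pairs of
    indices only add nonnegative terms.\<close>
  obtain J' where J': "J' \<subseteq> J" "inj_on e J'" "U = e ` J'" using U(1) by (meson subset_image_inj)
  have R_le: "?R p \<le> (\<Sum>t\<in>J \<times> J. ?c p t)" for p
  proof -
    have "?R p = (\<Sum>i\<in>J'. \<Sum>j\<in>J'. collisions p (e i - e j))" using J' by (simp add: sum.reindex)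
    also have "\<dots> = (\<Sum>t\<in>J' \<times> J'. ?c p t)" by (simp add: sum.cartesian_product split_beta)
    also have "\<dots> \<le> (\<Sum>t\<in>J \<times> J. ?c p t)" using J J' by (intro sum_mono2) (auto simp: collisions_nonneg)
    finally show ?thesis .
  qed
  have "(\<Prod>p\<in>A. 1 + 2 * ?R p / real p) \<le> (\<Prod>p\<in>A. exp (2 * ?R p / real p))"
    by (intro prod_mono) (auto intro!: sum_nonneg divide_nonneg_nonneg add_nonneg_nonneg simp: collisions_nonneg)
  also have "\<dots> \<le> exp (\<Sum>p\<in>A. 2 * (\<Sum>t\<in>J \<times> J. ?c p t) / real p)"
    using R_le A(1) by (simp flip: exp_sum add: sum_mono divide_right_mono)
  also have "\<dots> = exp (\<Sum>t\<in>J \<times> J. \<Sum>p\<in>A. 2 * ?c p t / real p)"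
    by (subst sum.swap) (simp add: sum_distrib_left sum_divide_distrib)
  also have "\<dots> \<le> (\<Sum>t\<in>J \<times> J. exp (T * (\<Sum>p\<in>A. 2 * ?c p t / real p))) / T"
    using exp_sum_le_mean[of "J \<times> J" "\<lambda>t. \<Sum>p\<in>A. 2 * ?c p t / real p"] J cardJJ by simp
  also have "\<dots> \<le> (\<Sum>t\<in>J \<times> J. 1 + pair_err A a (e (fst t) - e (snd t))) / T"
  proof (intro divide_right_mono sum_mono)
    fix t assume "t \<in> J \<times> J"
    have "exp (T * (\<Sum>p\<in>A. 2 * ?c p t / real p)) = (\<Prod>p\<in>A. exp (T * (2 * ?c p t / real p)))"
      using A(1) by (simp add: sum_distrib_left exp_sum)
    also have "\<dots> \<le> (\<Prod>p\<in>A. 1 + a * ?c p t / real p)"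
    proof (intro prod_mono conjI)
      fix p assume p: "p \<in> A"
      have "T * (2 * ?c p t / real p) \<le> 2 * T * B / w"
      proof -
        have "?c p t / real p \<le> B / w"
          using primes[OF p] A(3) B_nonneg by (intro frac_le collisions_le_B) auto
        hence "2 * T * (?c p t / real p) \<le> 2 * T * (B / w)" using T0 by (intro mult_left_mono) auto
        thus ?thesis by (simp add: mult_ac)
      qed
      hence "exp (T * (2 * ?c p t / real p)) \<le> 1 + T * (2 * ?c p t / real p) * exp (2 * T * B / w)"
        using T0 by (intro exp_le_one_plus_mult_exp) (auto simp: collisions_nonneg)
      thus "exp (T * (2 * ?c p t / real p)) \<le> 1 + a * ?c p t / real p" by (simp add: T(2) mult_ac)
    qed auto
    finally show "exp (T * (\<Sum>p\<in>A. 2 * ?c p t / real p)) \<le> 1 + pair_err A a (e (fst t) - e (snd t))"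
      by (simp add: pair_err_def)
  qed (use T0 in auto)
  also have "\<dots> = 1 + (\<Sum>i\<in>J. \<Sum>j\<in>J. pair_err A a (e i - e j)) / T"
    using T0 cardJJ by (simp add: sum.distrib add_divide_distrib sum.cartesian_product split_beta)
  finally have "(\<Prod>p\<in>A. 1 + 2 * ?R p / real p) \<le> 1 + (\<Sum>i\<in>J. \<Sum>j\<in>J. pair_err A a (e i - e j)) / T" .
  moreover have "sieve_density I A ^ card U \<ge> 0" using sieve_density_pos[of A] primes by (simp add: less_imp_le)
  ultimately have "sieve_density I A ^ card U * (\<Prod>p\<in>A. 1 + 2 * ?R p / real p) \<le>
      sieve_density I A ^ card U * (1 + (\<Sum>i\<in>J. \<Sum>j\<in>J. pair_err A a (e i - e j)) / T)"
    by (rule mult_left_mono)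
  with survival_le_prod[of A w U, OF A(2) finU U(2)] show ?thesis by (rule order_trans)
qed

text \<open>For \<open>m t \<noteq> 0\<close> the product counts the ways to choose, for each
  \<open>p\<close> in \<open>D\<close>, a pair from \<open>I p\<close> with difference
  \<open>m t\<close> modulo \<open>p\<close>. After the sums are exchanged, a choice of pairs
  prescribes the residue of \<open>m t\<close> at every \<open>p\<close> in \<open>D\<close>, and
  the hypothesis bounds the number of such \<open>t\<close>.\<close>

lemma sum_prod_collisions_le:
  assumes D: "finite D" "D \<noteq> {}" "\<And>p. p \<in> D \<Longrightarrow> prime p" and S: "finite S"
    and count: "\<And>c. real (card {t \<in> S. m t \<noteq> 0 \<and> (\<forall>p\<in>D. [m t = c p] (mod int p))}) \<le> N"
  shows "(\<Sum>t\<in>S. \<Prod>p\<in>D. collisions p (m t)) \<le> (\<Prod>p\<in>D. real (card (I p)) ^ 2) * N"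
proof -
  let ?S = "{t \<in> S. m t \<noteq> 0}"
  let ?hit = "\<lambda>t f. \<forall>p\<in>D. [m t = fst (f p) - snd (f p)] (mod int p)"
  let ?F = "PiE D (\<lambda>p. I p \<times> I p)"
  have finF: "finite ?F" using D by (intro finite_PiE) auto
  have "(\<Sum>t\<in>S. \<Prod>p\<in>D. collisions p (m t)) = (\<Sum>t\<in>?S. \<Prod>p\<in>D. collisions p (m t))"
    using S D by (intro sum.mono_neutral_right) (auto simp: collisions_def prod_zero_iff)
  also have "\<dots> = (\<Sum>t\<in>?S. \<Sum>f\<in>?F. of_bool (?hit t f))"
  proof (rule sum.cong)
    fix t assume t: "t \<in> ?S"
    have "(\<Prod>p\<in>D. collisions p (m t)) = (\<Prod>p\<in>D. \<Sum>x\<in>I p \<times> I p. of_bool ([m t = fst x - snd x] (mod int p)))"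
    proof (rule prod.cong)
      fix p assume p: "p \<in> D"
      have "(\<Sum>x\<in>I p \<times> I p. of_bool ([m t = fst x - snd x] (mod int p)) :: real)
          = real (card ((I p \<times> I p) \<inter> {x. [m t = fst x - snd x] (mod int p)}))"
        using finite_I[OF D(3)[OF p]] by (subst sum_of_bool_eq) auto
      also have "(I p \<times> I p) \<inter> {x. [m t = fst x - snd x] (mod int p)} = {(i, j) \<in> I p \<times> I p. [i - j = m t] (mod int p)}"
        by (auto simp: cong_sym_eq)
      finally show "collisions p (m t) = (\<Sum>x\<in>I p \<times> I p. of_bool ([m t = fst x - snd x] (mod int p)))"
        using t by (simp add: collisions_def)
    qed auto
    also have "\<dots> = (\<Sum>f\<in>?F. \<Prod>p\<in>D. of_bool ([m t = fst (f p) - snd (f p)] (mod int p)))"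
      using D by (intro prod_sum_PiE) auto
    also have "\<dots> = (\<Sum>f\<in>?F. of_bool (?hit t f))"
    proof (rule sum.cong)
      fix f
      show "(\<Prod>p\<in>D. of_bool ([m t = fst (f p) - snd (f p)] (mod int p)))
          = (of_bool (?hit t f) :: real)"
        using D(1) by (cases "?hit t f") (auto simp: prod_zero_iff)
    qed auto
    finally show "(\<Prod>p\<in>D. collisions p (m t)) = (\<Sum>f\<in>?F. of_bool (?hit t f))" .
  qed auto
  also have "\<dots> = (\<Sum>f\<in>?F. \<Sum>t\<in>?S. of_bool (?hit t f))"
    by (rule sum.swap)
  also have "\<dots> \<le> (\<Sum>f\<in>?F. N)"
  proof (rule sum_mono)
    fix f
    have "(\<Sum>t\<in>?S. of_bool (?hit t f) :: real)
      = real (card (?S \<inter> {t. ?hit t f}))"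
      using S by (subst sum_of_bool_eq) auto
    also have "?S \<inter> {t. ?hit t f} =
       {t \<in> S. m t \<noteq> 0 \<and> ?hit t f}" by auto
    finally show "(\<Sum>t\<in>?S. of_bool (?hit t f)) \<le> N"
      using count[of "\<lambda>p. fst (f p) - snd (f p)"] by simp
  qed
  also have "\<dots> = (\<Prod>p\<in>D. real (card (I p)) ^ 2) * N"
    using D(1) by (simp add: card_PiE card_cartesian_product power2_eq_square)
  finally show ?thesis .
qed

text \<open>The two terms of the counting hypothesis are summed separately over the nonempty
  \<open>D\<close>. The main terms carry \<open>1 / p ^ 2\<close>, so their product is close to 1.
  The remainders carry only \<open>1 / p\<close>, and their product is as large as a negative power
  of the sieve density; this is affordable because \<open>R\<close> will be very small compared with
  \<open>X\<close>.\<close>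

lemma sum_pair_err_le:
  assumes A: "finite A" "w \<ge> 1" "\<And>p. p \<in> A \<Longrightarrow> prime p \<and> w < real p"
    and S: "finite S" and pos: "a \<ge> 0" "X \<ge> 0" "R \<ge> 0"
    and count: "\<And>D c. D \<subseteq> A \<Longrightarrow> D \<noteq> {} \<Longrightarrow>
       real (card {t \<in> S. m t \<noteq> 0 \<and> (\<forall>p\<in>D. [m t = c p] (mod int p))}) \<le> X * (\<Prod>p\<in>D. (1 + ln (real p)) / real p) + R"
  shows "(\<Sum>t\<in>S. pair_err A a (m t)) \<le> X * (exp (a * B ^ 2 * (24 / w)) - 1) + R * sieve_density I A powr (- (a * B))"
proof -
  have primes: "prime p" "w < real p" "real p > 0" "real p \<ge> 1" "finite (I p)" if "p \<in> A" for p
    using A(2) A(3)[OF that] by (auto simp: prime_gt_0_nat)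
  let ?P = "Pow A - {{}}"
  let ?f = "\<lambda>p. a * real (card (I p)) ^ 2 * (1 + ln (real p)) / real p ^ 2"
  let ?g = "\<lambda>p. a * real (card (I p)) ^ 2 / real p"
  have expand: "(\<Prod>p\<in>A. 1 + h p) - 1 = (\<Sum>D\<in>?P. \<Prod>p\<in>D. h p)" for h :: "nat \<Rightarrow> real"
  proof -
    have "(\<Prod>p\<in>A. h p + 1) = (\<Sum>D\<in>Pow A. \<Prod>p\<in>D. h p)" using prod_add[OF A(1), of h "\<lambda>_. 1"] by simp
    also have "\<dots> = (\<Prod>p\<in>{}. h p) + (\<Sum>D\<in>?P. \<Prod>p\<in>D. h p)" using A(1) by (intro sum.remove) auto
    finally show ?thesis by (simp add: add.commute)
  qed
  have "(\<Sum>t\<in>S. pair_err A a (m t)) = (\<Sum>D\<in>?P. \<Sum>t\<in>S. \<Prod>p\<in>D. a * collisions p (m t) / real p)"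
    unfolding pair_err_def expand by (rule sum.swap)
  also have "\<dots> \<le> (\<Sum>D\<in>?P. X * (\<Prod>p\<in>D. ?f p) + R * (\<Prod>p\<in>D. ?g p))"
  proof (rule sum_mono)
    fix D assume D: "D \<in> ?P"
    have "(\<Sum>t\<in>S. \<Prod>p\<in>D. a * collisions p (m t) / real p)
        = (\<Prod>p\<in>D. a / real p) * (\<Sum>t\<in>S. \<Prod>p\<in>D. collisions p (m t))"
      by (simp add: sum_distrib_left prod.distrib[symmetric])
    also have "\<dots> \<le> (\<Prod>p\<in>D. a / real p) * ((\<Prod>p\<in>D. real (card (I p)) ^ 2) * (X * (\<Prod>p\<in>D. (1 + ln (real p)) / real p) + R))"
      using D A(1) S primes pos
      by (intro mult_left_mono sum_prod_collisions_le count prod_nonneg) (auto intro: finite_subset)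
    also have "\<dots> = X * (\<Prod>p\<in>D. ?f p) + R * (\<Prod>p\<in>D. ?g p)"
    proof -
      have "(\<Prod>p\<in>D. a / real p) * ((\<Prod>p\<in>D. real (card (I p)) ^ 2) * (\<Prod>p\<in>D. (1 + ln (real p)) / real p)) = (\<Prod>p\<in>D. ?f p)"
        unfolding prod.distrib[symmetric] by (rule prod.cong) (auto simp: power2_eq_square)
      moreover have "(\<Prod>p\<in>D. a / real p) * (\<Prod>p\<in>D. real (card (I p)) ^ 2) = (\<Prod>p\<in>D. ?g p)"
        unfolding prod.distrib[symmetric] by (rule prod.cong) auto
      ultimately show ?thesis by (metis (no_types, lifting) distrib_left mult.assoc mult.commute)
    qed
    finally show "(\<Sum>t\<in>S. \<Prod>p\<in>D. a * collisions p (m t) / real p) \<le> X * (\<Prod>p\<in>D. ?f p) + R * (\<Prod>p\<in>D. ?g p)" .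
  qed
  also have "\<dots> = X * ((\<Prod>p\<in>A. 1 + ?f p) - 1) + R * ((\<Prod>p\<in>A. 1 + ?g p) - 1)"
    by (simp only: sum.distrib expand sum_distrib_left)
  also have "\<dots> \<le> X * (exp (a * B ^ 2 * (24 / w)) - 1) + R * sieve_density I A powr (- (a * B))"
  proof (intro add_mono mult_left_mono diff_right_mono pos)
    have "(\<Prod>p\<in>A. 1 + ?f p) \<le> (\<Prod>p\<in>A. exp (?f p))" using primes pos
      by (intro prod_mono conjI add_nonneg_nonneg divide_nonneg_nonneg mult_nonneg_nonneg) auto
    also have "\<dots> = exp (\<Sum>p\<in>A. ?f p)" using A(1) by (simp add: exp_sum)
    also have "\<dots> \<le> exp (a * B ^ 2 * (24 / w))"
    proof -
      have "(\<Sum>p\<in>A. ?f p) \<le> (\<Sum>p\<in>A. a * B ^ 2 * ((1 + ln (real p)) / real p ^ 2))"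
      proof (rule sum_mono)
        fix p assume p: "p \<in> A"
        have "a * real (card (I p)) ^ 2 * ((1 + ln (real p)) / real p ^ 2) \<le> a * B ^ 2 * ((1 + ln (real p)) / real p ^ 2)"
          using primes[OF p] card_I[of p] pos by (intro mult_right_mono mult_left_mono power_mono) auto
        thus "?f p \<le> a * B ^ 2 * ((1 + ln (real p)) / real p ^ 2)" by simp
      qed
      also have "\<dots> = a * B ^ 2 * (\<Sum>p\<in>A. (1 + ln (real p)) / real p ^ 2)" by (simp add: sum_distrib_left)
      also have "\<dots> \<le> a * B ^ 2 * (24 / w)"
        using A pos by (intro mult_left_mono sum_ln_over_square_primes_le) auto
      finally show ?thesis by simp
    qed
    finally show "(\<Prod>p\<in>A. 1 + ?f p) \<le> exp (a * B ^ 2 * (24 / w))" .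
    have "(\<Prod>p\<in>A. 1 + ?g p) \<le> (\<Prod>p\<in>A. exp (?g p))" using primes pos
      by (intro prod_mono conjI add_nonneg_nonneg divide_nonneg_nonneg mult_nonneg_nonneg) auto
    also have "\<dots> = exp (\<Sum>p\<in>A. ?g p)" using A(1) by (simp add: exp_sum)
    also have "\<dots> \<le> exp (a * B * (- ln (sieve_density I A)))"
    proof -
      \<comment> \<open>Only one of the two factors \<open>card (I p)\<close> is replaced by
        \<open>B\<close>; the other is kept so that the density bounds the sum.\<close>
      have "(\<Sum>p\<in>A. ?g p) \<le> (\<Sum>p\<in>A. a * B * (real (card (I p)) / real p))"
      proof (rule sum_mono)
        fix p assume p: "p \<in> A"
        have "a * (real (card (I p)) * (real (card (I p)) / real p)) \<le> a * (B * (real (card (I p)) / real p))"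
          using primes[OF p] card_I[of p] pos by (intro mult_right_mono mult_left_mono) auto
        thus "?g p \<le> a * B * (real (card (I p)) / real p)" by (simp add: power2_eq_square)
      qed
      also have "\<dots> = a * B * (\<Sum>p\<in>A. real (card (I p)) / real p)" by (simp add: sum_distrib_left)
      also have "\<dots> \<le> a * B * (- ln (sieve_density I A))"
        using A pos B_nonneg by (intro mult_left_mono sum_density_ratio_le) auto
      finally show ?thesis by simp
    qed
    also have "\<dots> = sieve_density I A powr (- (a * B))"
      using sieve_density_pos[of A] primes by (simp add: powr_def)
    finally show "(\<Prod>p\<in>A. 1 + ?g p) - 1 \<le> sieve_density I A powr (- (a * B))" by simp
  qed
  finally show ?thesis .
qed

end

section \<open>Moments with two ranges of primes\<close>

lemma rel_close_twice:
  fixes a X e :: real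
  assumes "(1 - 2 * e) * X \<le> a" "a \<le> (1 + 2 * e) * X"
  shows "rel_close (2 * e) a X"
proof -
  have "X - 2 * e * X \<le> a" using assms(1) by (simp only: left_diff_distrib mult_1)
  moreover have "a \<le> X + 2 * e * X" using assms(2) by (simp only: distrib_right mult_1)
  ultimately show ?thesis unfolding rel_close_def by (simp only: abs_le_iff) linarith
qed

text \<open>Here \<open>m0\<close>, \<open>m1\<close>, \<open>m2\<close> are the total mass and the
  first two moments. The upper bound for \<open>m1\<close> follows from that for \<open>m2\<close>
  because \<open>1 + 2 * e \<le> (1 + e) ^ 2\<close>, the lower bound for \<open>m2\<close> from
  that for \<open>m1\<close> because \<open>1 - 2 * e \<le> (1 - e) ^ 2\<close>.\<close>

lemma moments_close_aux:
  fixes m0 m1 m2 m e :: real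
  assumes nn: "m0 \<ge> 0" "m2 \<ge> 0" "m \<ge> 0" "e \<ge> 0" and CS: "m1 ^ 2 \<le> m0 * m2"
    and lower: "(1 - e) * (m0 * m) \<le> m1" and upper: "m2 \<le> (1 + 2 * e) * (m0 * m ^ 2)"
  shows "rel_close (2 * e) m1 (m0 * m)" and "rel_close (2 * e) m2 (m0 * m ^ 2)"
proof -
  have e12: "1 + 2 * e \<le> (1 + e) ^ 2" "1 - 2 * e \<le> (1 - e) ^ 2"
    by (simp_all add: power2_eq_square algebra_simps)
  have sq: "m0 * (c * (m0 * m ^ 2)) = c * (m0 * m) ^ 2" for c
    by (simp only: power_mult_distrib power2_eq_square mult_ac)
  have X: "m0 * m \<ge> 0" using nn by simp
  have "m1 ^ 2 \<le> m0 * ((1 + 2 * e) * (m0 * m ^ 2))"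
    using CS mult_left_mono[OF upper nn(1)] by (rule order_trans)
  also have "\<dots> \<le> (1 + e) ^ 2 * (m0 * m) ^ 2" unfolding sq by (intro mult_right_mono e12 zero_le_power2)
  also have "\<dots> = ((1 + e) * (m0 * m)) ^ 2" by (rule power_mult_distrib[symmetric])
  finally have "m1 \<le> (1 + e) * (m0 * m)"
    by (rule power2_le_imp_le) (intro mult_nonneg_nonneg X, use nn in simp)
  also have "\<dots> \<le> (1 + 2 * e) * (m0 * m)" by (rule mult_right_mono[OF _ X]) (use nn in simp)
  finally have m1: "m1 \<le> (1 + 2 * e) * (m0 * m)" .
  have "(1 - 2 * e) * (m0 * m) \<le> (1 - e) * (m0 * m)" by (rule mult_right_mono[OF _ X]) (use nn in simp)
  thus "rel_close (2 * e) m1 (m0 * m)" using lower m1 by (intro rel_close_twice) (rule order_trans)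
  have "(1 - 2 * e) * (m0 * m ^ 2) \<le> m2"
  proof (cases "m0 = 0 \<or> e > 1")
    case True
    have "(1 - 2 * e) * (m0 * m ^ 2) \<le> 0"
    proof (cases "m0 = 0")
      case False
      hence "1 - 2 * e \<le> 0" using True by simp
      thus ?thesis by (rule mult_nonpos_nonneg) (use nn in simp)
    qed simp
    thus ?thesis using nn(2) by (rule order_trans)
  next
    case False
    have "m0 * ((1 - 2 * e) * (m0 * m ^ 2)) \<le> (1 - e) ^ 2 * (m0 * m) ^ 2"
      unfolding sq by (intro mult_right_mono e12 zero_le_power2)
    also have "\<dots> = ((1 - e) * (m0 * m)) ^ 2" by (rule power_mult_distrib[symmetric])
    also have "\<dots> \<le> m1 ^ 2"
      by (rule power_mono[OF lower]) (intro mult_nonneg_nonneg X, use False in simp)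
    also note CS
    finally have "m0 * ((1 - 2 * e) * (m0 * m ^ 2)) \<le> m0 * m2" .
    moreover have "m0 > 0" using False nn(1) by simp
    ultimately show ?thesis by (rule mult_left_le_imp_le)
  qed
  thus "rel_close (2 * e) m2 (m0 * m ^ 2)" using upper by (rule rel_close_twice)
qed

text \<open>The weights \<open>c\<close> carry the probability of a shift and, for the moments over
  \<open>n\<close>, also the indicator that \<open>n\<close> survives; the mass is then itself a
  moment, of order 0.\<close>

lemma moments_close:
  fixes c f :: "'a \<Rightarrow> real"
  assumes c: "\<And>i. i \<in> S \<Longrightarrow> c i \<ge> 0" and m: "m \<ge> 0" and e: "e \<ge> 0"
    and lower: "(1 - e) * ((\<Sum>i\<in>S. c i) * m) \<le> (\<Sum>i\<in>S. c i * f i)"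
    and upper: "(\<Sum>i\<in>S. c i * f i ^ 2) \<le> (1 + 2 * e) * ((\<Sum>i\<in>S. c i) * m ^ 2)"
  shows "rel_close (2 * e) (\<Sum>i\<in>S. c i * f i) ((\<Sum>i\<in>S. c i) * m)"
    and "rel_close (2 * e) (\<Sum>i\<in>S. c i * f i ^ 2) ((\<Sum>i\<in>S. c i) * m ^ 2)"
proof -
  have "(\<Sum>i\<in>S. sqrt (c i) * (sqrt (c i) * f i))\<^sup>2 \<le> (\<Sum>i\<in>S. (sqrt (c i))\<^sup>2) * (\<Sum>i\<in>S. (sqrt (c i) * f i)\<^sup>2)"
    by (rule Cauchy_Schwarz_ineq_sum)
  moreover have "(\<Sum>i\<in>S. sqrt (c i) * (sqrt (c i) * f i)) = (\<Sum>i\<in>S. c i * f i)"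
    by (rule sum.cong) (simp_all add: c mult.assoc[symmetric])
  moreover have "(\<Sum>i\<in>S. (sqrt (c i))\<^sup>2) = (\<Sum>i\<in>S. c i)"
    by (rule sum.cong) (simp_all add: c)
  moreover have "(\<Sum>i\<in>S. (sqrt (c i) * f i)\<^sup>2) = (\<Sum>i\<in>S. c i * f i ^ 2)"
    by (rule sum.cong) (simp_all add: c power_mult_distrib)
  ultimately have CS: "(\<Sum>i\<in>S. c i * f i) ^ 2 \<le> (\<Sum>i\<in>S. c i) * (\<Sum>i\<in>S. c i * f i ^ 2)" by simp
  have m0: "0 \<le> (\<Sum>i\<in>S. c i)" by (intro sum_nonneg c)
  have m2: "0 \<le> (\<Sum>i\<in>S. c i * f i ^ 2)" by (intro sum_nonneg mult_nonneg_nonneg c zero_le_power2)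
  from moments_close_aux[OF m0 m2 m e CS lower upper]
  show "rel_close (2 * e) (\<Sum>i\<in>S. c i * f i) ((\<Sum>i\<in>S. c i) * m)"
    and "rel_close (2 * e) (\<Sum>i\<in>S. c i * f i ^ 2) ((\<Sum>i\<in>S. c i) * m ^ 2)" by blast+
qed

lemma card_cong_class_le:
  fixes S :: "int set"
  assumes d: "d > (0::nat)" and S: "S \<subseteq> {l<..l + int Y}"
    and cong: "\<And>n n'. n \<in> S \<Longrightarrow> n' \<in> S \<Longrightarrow> [n = n'] (mod int d)"
  shows "real (card S) \<le> real Y / real d + 1"
proof (cases "S = {}")
  case False
  then obtain n0 where "n0 \<in> S" by blast
  hence "l < n0" "n0 \<le> l + int Y" using S by auto
  hence Y: "Y \<ge> 1" by linarith
  \<comment> \<open>Counting from \<open>l + 1\<close>, the least possible element, makes the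
    quotients start at 0.\<close>
  let ?f = "\<lambda>n. (n - l - 1) div int d"
  have "inj_on ?f S"
  proof (rule inj_onI)
    fix n n' assume n: "n \<in> S" "n' \<in> S" "?f n = ?f n'"
    have md: "(n - l - 1) mod int d = (n' - l - 1) mod int d"
      using cong_diff[OF cong_diff[OF cong[OF n(1,2)] cong_refl] cong_refl] unfolding cong_def .
    have "n - l - 1 = ?f n * int d + (n - l - 1) mod int d" by (rule div_mult_mod_eq[symmetric])
    also have "\<dots> = ?f n' * int d + (n' - l - 1) mod int d" by (simp only: n(3) md)
    also have "\<dots> = n' - l - 1" by (rule div_mult_mod_eq)
    finally have "n - l - 1 = n' - l - 1" .
    thus "n = n'" by simp
  qed
  moreover have "?f ` S \<subseteq> {0..int ((Y - 1) div d)}"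
  proof
    fix k assume "k \<in> ?f ` S"
    then obtain n where n: "n \<in> S" "k = ?f n" by blast
    hence n': "l < n" "n \<le> l + int Y" using S by auto
    have "?f n \<le> (int Y - 1) div int d" using n' d by (intro zdiv_mono1) auto
    also have "\<dots> = int ((Y - 1) div d)" using Y by (simp add: zdiv_int of_nat_diff)
    finally show "k \<in> {0..int ((Y - 1) div d)}" using n n' d by (simp add: pos_imp_zdiv_nonneg_iff)
  qed
  ultimately have "card S \<le> card {0..int ((Y - 1) div d)}" by (rule card_inj_on_le) simp
  also have "\<dots> = (Y - 1) div d + 1" by simp
  finally have "real (card S) \<le> real ((Y - 1) div d) + 1" by linarith
  also have "real ((Y - 1) div d) \<le> real Y / real d"
  proof -
    have "d * ((Y - 1) div d) \<le> Y - 1" by simp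
    hence "d * ((Y - 1) div d) \<le> Y" by linarith
    hence "real (d * ((Y - 1) div d)) \<le> real Y" by (simp only: of_nat_le_iff)
    hence "real d * real ((Y - 1) div d) \<le> real Y" by (simp only: of_nat_mult)
    thus ?thesis using d by (simp add: field_simps)
  qed
  finally show ?thesis by simp
qed simp

lemma cong_mod_prod_primes:
  fixes D :: "nat set"
  assumes "finite D" "\<And>p. p \<in> D \<Longrightarrow> prime p" "\<And>p. p \<in> D \<Longrightarrow> [m = n] (mod int p)"
  shows "[m = n] (mod int (\<Prod>D))"
proof -
  have "[m = n] (mod (\<Prod>p\<in>D. int p))"
    using assms by (intro cong_cong_prod_coprime) (auto intro!: primes_coprime)
  thus ?thesis by simp
qed

text \<open>By \<open>1 + ln (s * t) \<le> (1 + ln s) * (1 + ln t)\<close> for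
  \<open>s, t \<ge> 1\<close>. This distributes the logarithmic loss of the prime count over the
  prime divisors of the modulus.\<close>

lemma one_plus_ln_prod_le:
  assumes "finite D" "\<And>p. p \<in> D \<Longrightarrow> (1::nat) \<le> p"
  shows "1 + ln (real (\<Prod>D)) \<le> (\<Prod>p\<in>D. 1 + ln (real p))"
  using assms
proof (induction D rule: finite_induct)
  case (insert p D)
  have pos: "real (\<Prod>D) \<ge> 1" using insert.prems by (simp add: prod_ge_1)
  have p: "real p \<ge> 1" using insert.prems[of p] by simp
  have "1 + ln (real (\<Prod>(insert p D))) = 1 + ln (real p) + ln (real (\<Prod>D))"
    proof -
    have "ln (real p * real (\<Prod>D)) = ln (real p) + ln (real (\<Prod>D))" using p pos by (intro ln_mult_pos) linarith+
    thus ?thesis using insert.hyps by simp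
  qed
  also have "\<dots> \<le> (1 + ln (real p)) * (1 + ln (real (\<Prod>D)))"
    using p pos by (simp add: algebra_simps)
  also have "\<dots> \<le> (1 + ln (real p)) * (\<Prod>p\<in>D. 1 + ln (real p))"
    using insert p by (intro mult_left_mono) auto
  finally show ?case using insert.hyps by simp
qed auto

text \<open>The ranges are abstract because the setting serves twice: with
  \<open>w = H powr M\<close> and \<open>L = \<lfloor>K * H\<rfloor>\<close> for the moments of the
  weights, and with \<open>w = ln y / 8\<close> and \<open>L = 1\<close> for the number of
  survivors. The condition \<open>L < w\<close> makes differences of steps invertible modulo the
  primes of \<open>A2\<close>; \<open>4 * L * B \<le> w\<close> admits the union of two
  progressions, with up to \<open>2 * L\<close> points, in the survival bounds.\<close>

locale sieve_scale = sieve +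
  fixes A1 A2 :: "nat set" and w :: real and L :: nat
  assumes fin: "finite A1" "finite A2" and disj: "A1 \<inter> A2 = {}"
    and primes1: "\<And>p. p \<in> A1 \<Longrightarrow> prime p"
    and primes2: "\<And>p. p \<in> A2 \<Longrightarrow> prime p \<and> w < real p"
    and w1: "w \<ge> 1" and L1: "L \<ge> 1" and Lw: "real L < w" and LB: "4 * real L * B \<le> w"
begin

text \<open>
  \<open>lam r s q n\<close> is the weight \<open>\<lambda>(H;q,n)\<close> as a function of \<open>b\<^sub>1 = r\<close> and \<open>b\<^sub>2 = s\<close>. The pairs
  that two progressions of length \<open>L\<close> can form number \<open>T\<close>, and \<open>a\<close> is the coefficient
  that the lemma \<open>survival_le\<close> produces for them.
\<close>

definition "\<sigma>1 = sieve_density I A1"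
definition "\<sigma>2 = sieve_density I A2"
definition "P1 = modulus I A1"
definition "P2 = modulus I A2"
definition "S1 b = translate (sifted I A1) b"
definition "S2 b = translate (sifted I A2) b"
definition "T = (2 * real L) ^ 2"
definition "a = 2 * T * exp (2 * T * B / w)"
definition "V q n = (\<lambda>h. n + int q * int h) ` {1..L}"
definition "lam r s q n = (if V q n \<inter> S1 r \<subseteq> S2 s then 1 / \<sigma>2 ^ card (V q n \<inter> S1 r) else 0)"
text \<open>The bound that \<open>sum_pair_err_le\<close> gives for a count with main coefficient
  \<open>X\<close> and remainder \<open>R\<close>.\<close>

definition "err X R = X * (exp (a * B ^ 2 * (24 / w)) - 1) + R * \<sigma>2 powr (- (a * B))"

lemma primes2D: "p \<in> A2 \<Longrightarrow> prime p" "p \<in> A2 \<Longrightarrow> w < real p" "p \<in> A2 \<Longrightarrow> real p \<ge> 1"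
proof -
  assume p: "p \<in> A2"
  show "prime p" "w < real p" using primes2[OF p] by auto
  thus "real p \<ge> 1" using w1 by linarith
qed

lemma \<sigma>2_bounds: "0 < \<sigma>2" "\<sigma>2 \<le> 1" "1 \<le> 1 / \<sigma>2"
proof -
  show 1: "0 < \<sigma>2" "\<sigma>2 \<le> 1" unfolding \<sigma>2_def
    by (rule sieve_density_pos sieve_density_le_1, erule primes2D)+
  thus "1 \<le> 1 / \<sigma>2" by simp
qed

lemma \<sigma>1_pos: "0 < \<sigma>1"
  unfolding \<sigma>1_def by (rule sieve_density_pos) (rule primes1)

lemma P_pos: "P1 > 0" "P2 > 0"
  unfolding P1_def P2_def by (rule modulus_pos, erule primes1 primes2D)+

lemma modulus_Un: "modulus I (A1 \<union> A2) = P1 * P2"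
proof -
  have "{p \<in> A1 \<union> A2. I p \<noteq> {}} = {p \<in> A1. I p \<noteq> {}} \<union> {p \<in> A2. I p \<noteq> {}}" by auto
  moreover have "{p \<in> A1. I p \<noteq> {}} \<inter> {p \<in> A2. I p \<noteq> {}} = {}" using disj by auto
  ultimately show ?thesis unfolding modulus_def P1_def P2_def using fin
    by (simp add: prod.union_disjoint)
qed

lemma density_Un: "sieve_density I (A1 \<union> A2) = \<sigma>1 * \<sigma>2"
  unfolding sieve_density_def \<sigma>1_def \<sigma>2_def using fin disj by (intro prod.union_disjoint) auto

lemma coprime_P: "coprime P1 P2"
  unfolding P1_def P2_def modulus_def
proof (rule prod_coprime_left, rule prod_coprime_right)
  fix p q assume "p \<in> {p \<in> A1. I p \<noteq> {}}" "q \<in> {p \<in> A2. I p \<noteq> {}}"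
  hence "prime p" "prime q" "p \<noteq> q" using primes1 primes2D disj by auto
  thus "coprime (int p) (int q)" by (simp add: primes_coprime)
qed

lemma S_periodic: "S1 (b mod P1) = S1 b" "S2 (b mod P2) = S2 b"
  unfolding S1_def S2_def P1_def P2_def using mem_translate_sifted_mod fin by blast+

text \<open>The large primes are averaged first, with the residue at the small ones frozen.\<close>

lemma mean_split:
  assumes "\<And>b. f b = G (b mod P1) (b mod P2)"
  shows "residue_mean (P1 * P2) f = residue_mean P1 (\<lambda>r. residue_mean P2 (\<lambda>s. G r s))"
proof -
  have "f = (\<lambda>b. G (b mod P1) (b mod P2))" using assms by (rule ext)
  thus ?thesis using residue_mean_mult[OF coprime_P P_pos, of G] by simp
qed

lemma mean_S1: "residue_mean P1 (\<lambda>r. of_bool (n \<in> S1 r)) = \<sigma>1"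
  using residue_mean_survival[of A1 I "{n}"] fin primes1 survival_singleton[of A1 n]
  by (simp add: S1_def P1_def \<sigma>1_def)

lemma mean_S2: "residue_mean P2 (\<lambda>s. of_bool (U \<subseteq> S2 s)) = survival I A2 U"
  using residue_mean_survival[of A2 I U] fin primes2D by (simp add: S2_def P2_def)

lemma finite_V [simp]: "finite (V q n)"
  by (simp add: V_def)

lemma card_V_le: "card (V q n \<inter> X) \<le> L"
proof -
  have "card (V q n \<inter> X) \<le> card (V q n)" by (intro card_mono) auto
  also have "\<dots> \<le> card {1..L}" unfolding V_def by (rule card_image_le) auto
  finally show ?thesis by simp
qed

lemma lam_nonneg: "lam r s q n \<ge> 0"
  using \<sigma>2_bounds by (simp add: lam_def)

lemma lam_le: "lam r s q n \<le> 1 / \<sigma>2 ^ L"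
proof -
  have "1 / \<sigma>2 ^ card (V q n \<inter> S1 r) \<le> 1 / \<sigma>2 ^ L"
    using \<sigma>2_bounds card_V_le by (intro frac_le power_decreasing) auto
  thus ?thesis using \<sigma>2_bounds by (simp add: lam_def)
qed

lemma a_nonneg: "a \<ge> 0"
  by (simp add: a_def T_def)

lemma T_pos: "T > 0"
  using L1 by (simp add: T_def)

text \<open>For fixed \<open>r\<close> the points of the progression in \<open>S1 r\<close> form a
  fixed set, and the weight is normalised by the main term of their survival probability.\<close>

lemma mean_lam_ge:
  "residue_mean P2 (\<lambda>s. lam r s q n) \<ge> 1 - (real L * B) ^ 2 * (24 / w)"
proof -
  let ?U = "V q n \<inter> S1 r"
  have "lam r s q n = 1 / \<sigma>2 ^ card ?U * of_bool (?U \<subseteq> S2 s)" for s by (simp add: lam_def)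
  hence eq: "residue_mean P2 (\<lambda>s. lam r s q n) = 1 / \<sigma>2 ^ card ?U * survival I A2 ?U"
    by (simp only: residue_mean_cmult mean_S2)
  have "\<sigma>2 ^ card ?U * (1 - (real L * B) ^ 2 * (24 / w)) \<le> survival I A2 ?U"
    unfolding \<sigma>2_def using card_V_le[of q n "S1 r"] LB B_nonneg
    by (intro survival_ge fin w1 primes2) (auto intro: order_trans[OF _ LB] mult_right_mono)
  thus ?thesis unfolding eq using \<sigma>2_bounds by (simp add: field_simps)
qed

text \<open>A point is addressed by a Boolean, which selects one of two progressions, and by its
  step; a point common to both has two addresses.\<close>

definition pos_of :: "nat \<Rightarrow> int \<Rightarrow> nat \<Rightarrow> int \<Rightarrow> bool \<times> nat \<Rightarrow> int" where
  "pos_of q n q' n' t = (if fst t then n' + int q' * int (snd t) else n + int q * int (snd t))"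

definition "J = (UNIV :: bool set) \<times> {1..L}"

text \<open>The relative error of \<open>survival_le\<close> for the union of two
  progressions.\<close>

definition cross_err :: "nat \<Rightarrow> int \<Rightarrow> nat \<Rightarrow> int \<Rightarrow> real" where
  "cross_err q n q' n' =
     (\<Sum>i\<in>J. \<Sum>j\<in>J. pair_err A2 a (pos_of q n q' n' i - pos_of q n q' n' j)) / T"

lemma J_card: "finite J" "J \<noteq> {}" "real (card J) = 2 * real L"
  using L1 by (auto simp: J_def card_cartesian_product)

lemma cross_err_nonneg: "cross_err q n q' n' \<ge> 0"
  unfolding cross_err_def using T_pos a_nonneg
  by (intro divide_nonneg_nonneg sum_nonneg pair_err_nonneg) auto

text \<open>Points common to both progressions are normalised twice but have to survive only once,
  hence the extra power of \<open>1 / \<sigma>2\<close>.\<close>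

lemma mean_lam_lam_le:
  "residue_mean P2 (\<lambda>s. lam r s q n * lam r s q' n') \<le>
     (1 + cross_err q n q' n') / \<sigma>2 ^ card (V q n \<inter> V q' n' \<inter> S1 r)"
proof -
  let ?U = "V q n \<inter> S1 r" and ?U' = "V q' n' \<inter> S1 r"
  have "lam r s q n * lam r s q' n' = 1 / (\<sigma>2 ^ card ?U * \<sigma>2 ^ card ?U') * of_bool (?U \<union> ?U' \<subseteq> S2 s)" for s
    by (simp add: lam_def)
  hence eq: "residue_mean P2 (\<lambda>s. lam r s q n * lam r s q' n') = survival I A2 (?U \<union> ?U') / (\<sigma>2 ^ card ?U * \<sigma>2 ^ card ?U')"
    by (simp only: residue_mean_cmult mean_S2) simp
  have "card (?U \<union> ?U') + card (?U \<inter> ?U') = card ?U + card ?U'"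
    by (rule card_Un_Int[symmetric]) auto
  moreover have "?U \<inter> ?U' = V q n \<inter> V q' n' \<inter> S1 r" by auto
  ultimately have pow: "\<sigma>2 ^ card ?U * \<sigma>2 ^ card ?U' = \<sigma>2 ^ card (?U \<union> ?U') * \<sigma>2 ^ card (V q n \<inter> V q' n' \<inter> S1 r)"
    by (metis power_add)
  have "card (?U \<union> ?U') \<le> card ?U + card ?U'" by (rule card_Un_le)
  also have "\<dots> \<le> 2 * L" using card_V_le[of q n "S1 r"] card_V_le[of q' n' "S1 r"] by simp
  finally have card: "2 * real (card (?U \<union> ?U')) * B \<le> w"
    using LB B_nonneg by (intro order_trans[OF mult_right_mono LB]) auto
  have sub: "?U \<union> ?U' \<subseteq> pos_of q n q' n' ` J"
  proof -
    have "n + int q * int h \<in> pos_of q n q' n' ` J" "n' + int q' * int h \<in> pos_of q n q' n' ` J" if "h \<in> {1..L}" for h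
      using that by (auto simp: pos_of_def J_def intro: image_eqI[of _ _ "(False, h)"] image_eqI[of _ _ "(True, h)"])
    thus ?thesis by (auto simp: V_def)
  qed
  have "survival I A2 (?U \<union> ?U') \<le> \<sigma>2 ^ card (?U \<union> ?U') * (1 + cross_err q n q' n')"
    unfolding \<sigma>2_def cross_err_def
    using fin primes2 w1 sub card J_card by (intro survival_le) (auto simp: T_def a_def)
  hence "residue_mean P2 (\<lambda>s. lam r s q n * lam r s q' n') \<le>
     \<sigma>2 ^ card (?U \<union> ?U') * (1 + cross_err q n q' n') / (\<sigma>2 ^ card (?U \<union> ?U') * \<sigma>2 ^ card (V q n \<inter> V q' n' \<inter> S1 r))"
    unfolding eq pow using \<sigma>2_bounds by (intro divide_right_mono) auto
  thus ?thesis using \<sigma>2_bounds by simp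
qed

lemma cong_cancel_linear:
  assumes "p \<in> A2" "k \<noteq> 0" "\<bar>k\<bar> \<le> int L" "[c + m * k = c'] (mod int p)" "[c + m' * k = c'] (mod int p)"
  shows "[m = m'] (mod int p)"
proof -
  have "[c + m * k = c + m' * k] (mod int p)" using assms(4,5) cong_sym cong_trans by blast
  hence "[m * k = m' * k] (mod int p)" using cong_add_lcancel by blast
  moreover have "coprime k (int p)"
  proof -
    have "real L < real p" using primes2D[OF assms(1)] Lw by linarith
    hence "\<not> int p dvd k" using assms(2,3) zdvd_not_zless[of "\<bar>k\<bar>" "int p"] by auto
    thus ?thesis using primes2D(1)[OF assms(1)]
      by (metis coprime_commute prime_imp_coprime prime_nat_int_transfer)
  qed
  ultimately show ?thesis using cong_mult_rcancel by blast
qed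

lemma subset_A2:
  assumes "D \<subseteq> A2"
  shows "finite D" "p \<in> D \<Longrightarrow> p \<ge> 1" "p \<in> D \<Longrightarrow> prime p" "\<Prod>D > 0"
proof -
  show "finite D" using assms fin finite_subset by blast
  have *: "prime p" if "p \<in> D" for p using that assms primes2D by blast
  show "p \<in> D \<Longrightarrow> p \<ge> 1" "p \<in> D \<Longrightarrow> prime p" using * prime_ge_1_nat by blast+
  show "\<Prod>D > 0" using * by (intro prod_pos) (auto simp: prime_gt_0_nat)
qed

lemma sum_pair_err_primes_le:
  assumes Q: "finite Q" "\<And>q. q \<in> Q \<Longrightarrow> prime q \<and> N0 < real q \<and> real q \<le> N"
    and N: "N0 > 1" "N > 0" "N \<le> w * N0" and k: "k \<noteq> 0" "\<bar>k\<bar> \<le> int L"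
  shows "(\<Sum>q\<in>Q. pair_err A2 a (c + int q * k)) \<le> err (2 * N / ln N0) 1"
  unfolding err_def \<sigma>2_def
proof (rule sum_pair_err_le)
  fix D :: "nat set" and c' :: "nat \<Rightarrow> int"
  assume D: "D \<subseteq> A2" "D \<noteq> {}"
  let ?S = "{q \<in> Q. c + int q * k \<noteq> 0 \<and> (\<forall>p\<in>D. [c + int q * k = c' p] (mod int p))}"
  note finD = subset_A2(1)[OF D(1)] and pD = subset_A2(2,3)[OF D(1)] and d0 = subset_A2(4)[OF D(1)]
  obtain p0 where p0: "p0 \<in> D" using D by blast
  \<comment> \<open>As \<open>D\<close> is nonempty, the modulus exceeds \<open>w\<close>, and
    \<open>N \<le> w * N0\<close> then yields the condition \<open>N / d \<le> N0\<close> of the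
    prime count.\<close>
  have "p0 \<le> \<Prod>D" using p0 finD d0 by (intro dvd_imp_le) (auto intro: dvd_prodI)
  hence dw: "w < real (\<Prod>D)" using primes2D[of p0] p0 D by (metis le_less_trans less_le_trans of_nat_le_iff subsetD linorder_not_le order_less_imp_le)
  have "real (card ?S) \<le> 1 + 2 * N / ln N0 * (1 + ln (real (\<Prod>D))) / real (\<Prod>D)"
  proof (rule card_primes_in_AP_le[OF d0 _ N(1,2)])
    show "finite ?S" using Q by simp
    have "N \<le> real (\<Prod>D) * N0" using N(3) dw N(1) by (meson less_imp_le mult_right_mono order_trans zero_less_one)
    thus "N / real (\<Prod>D) \<le> N0" using d0 by (simp only: pos_divide_le_eq of_nat_0_less_iff mult.commute)
    show "prime q \<and> N0 < real q \<and> real q \<le> N" if "q \<in> ?S" for q using that Q by simp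
    fix q q' assume q: "q \<in> ?S" "q' \<in> ?S"
    have "[int q = int q'] (mod int (\<Prod>D))"
    proof (rule cong_mod_prod_primes[OF finD pD(2)])
      fix p assume "p \<in> D"
      hence "p \<in> A2" "[c + int q * k = c' p] (mod int p)" "[c + int q' * k = c' p] (mod int p)"
        using q D(1) by auto
      thus "[int q = int q'] (mod int p)" using cong_cancel_linear[OF _ k] by blast
    qed
    thus "q mod (\<Prod>D) = q' mod (\<Prod>D)" using cong_int_iff cong_def by blast
  qed
  also have "\<dots> \<le> 1 + 2 * N / ln N0 * (\<Prod>p\<in>D. 1 + ln (real p)) / real (\<Prod>D)"
    using N one_plus_ln_prod_le[OF finD pD(1)] by (intro add_left_mono divide_right_mono mult_left_mono) (simp_all del: of_nat_prod)
  also have "\<dots> = 2 * N / ln N0 * (\<Prod>p\<in>D. (1 + ln (real p)) / real p) + 1"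
    by (simp add: prod_dividef)
  finally show "real (card ?S) \<le> 2 * N / ln N0 * (\<Prod>p\<in>D. (1 + ln (real p)) / real p) + 1" .
qed (use Q N fin primes2 w1 a_nonneg in auto)

lemma sum_pair_err_interval_le:
  assumes S: "S \<subseteq> {l<..l + int Y}" and k: "k \<noteq> 0" "\<bar>k\<bar> \<le> int L"
  shows "(\<Sum>n\<in>S. pair_err A2 a (c + n * k)) \<le> err (real Y) 1"
  unfolding err_def \<sigma>2_def
proof (rule sum_pair_err_le)
  show "finite S" using S by (rule finite_subset) auto
  fix D :: "nat set" and c' :: "nat \<Rightarrow> int"
  assume D: "D \<subseteq> A2" "D \<noteq> {}"
  let ?S = "{n \<in> S. c + n * k \<noteq> 0 \<and> (\<forall>p\<in>D. [c + n * k = c' p] (mod int p))}"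
  note finD = subset_A2(1)[OF D(1)] and pD = subset_A2(2,3)[OF D(1)] and d0 = subset_A2(4)[OF D(1)]
  have "real (card ?S) \<le> real Y / real (\<Prod>D) + 1"
  proof (rule card_cong_class_le[OF d0])
    show "?S \<subseteq> {l<..l + int Y}" using S by auto
    fix n n' assume n: "n \<in> ?S" "n' \<in> ?S"
    show "[n = n'] (mod int (\<Prod>D))"
    proof (rule cong_mod_prod_primes[OF finD pD(2)])
      fix p assume "p \<in> D"
      hence "p \<in> A2" "[c + n * k = c' p] (mod int p)" "[c + n' * k = c' p] (mod int p)"
        using n D(1) by auto
      thus "[n = n'] (mod int p)" using cong_cancel_linear[OF _ k] by blast
    qed
  qed
  also have "real Y / real (\<Prod>D) = real Y * (\<Prod>p\<in>D. 1 / real p)" by (simp add: prod_dividef)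
  also have "\<dots> \<le> real Y * (\<Prod>p\<in>D. (1 + ln (real p)) / real p)"
    using pD by (intro mult_left_mono prod_mono conjI divide_right_mono) fastforce+
  finally show "real (card ?S) \<le> real Y * (\<Prod>p\<in>D. (1 + ln (real p)) / real p) + 1" by simp
qed (use fin primes2 w1 a_nonneg in auto)


section \<open>Moments over the primes \<open>q\<close>\<close>

definition "E f = residue_mean (P1 * P2) f"

lemma PP_pos: "P1 * P2 > 0"
  using P_pos by simp

lemma lam_periodic: "lam b b q n = lam (b mod P1) (b mod P2) q n"
  by (simp add: lam_def S_periodic)

lemma E_lam_ge: "E (\<lambda>b. lam b b q n) \<ge> 1 - (real L * B) ^ 2 * (24 / w)"
proof -
  have "E (\<lambda>b. lam b b q n) = residue_mean P1 (\<lambda>r. residue_mean P2 (\<lambda>s. lam r s q n))"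
    unfolding E_def by (rule mean_split) (rule lam_periodic)
  also have "\<dots> \<ge> residue_mean P1 (\<lambda>r. 1 - (real L * B) ^ 2 * (24 / w))"
    using P_pos mean_lam_ge by (intro residue_mean_mono) auto
  finally show ?thesis using P_pos by (simp add: residue_mean_const)
qed

lemma mean_lam_lam_trivial: "residue_mean P2 (\<lambda>s. lam r s q n * lam r s q' n') \<le> 1 / \<sigma>2 ^ (2 * L)"
proof -
  have "residue_mean P2 (\<lambda>s. lam r s q n * lam r s q' n') \<le> residue_mean P2 (\<lambda>s. 1 / \<sigma>2 ^ (2 * L))"
  proof (rule residue_mean_mono[OF P_pos(2)])
    fix s
    have "lam r s q n * lam r s q' n' \<le> (1 / \<sigma>2 ^ L) * (1 / \<sigma>2 ^ L)"
      using \<sigma>2_bounds by (intro mult_mono lam_le lam_nonneg) auto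
    thus "lam r s q n * lam r s q' n' \<le> 1 / \<sigma>2 ^ (2 * L)" by (simp add: mult_2 power_add)
  qed
  thus ?thesis using P_pos by (simp add: residue_mean_const)
qed

text \<open>Progressions with the same \<open>q\<close> meet only for few \<open>n'\<close>; for
  these the pointwise bound \<open>1 / \<sigma>2 ^ (2 * L)\<close> is good enough.\<close>

lemma E_lam_lam_le:
  "E (\<lambda>b. lam b b q n * lam b b q n') \<le> 1 + cross_err q n q n' + of_bool (V q n \<inter> V q n' \<noteq> {}) / \<sigma>2 ^ (2 * L)"
proof -
  let ?c = "1 + cross_err q n q n' + of_bool (V q n \<inter> V q n' \<noteq> {}) / \<sigma>2 ^ (2 * L)"
  have "E (\<lambda>b. lam b b q n * lam b b q n') = residue_mean P1 (\<lambda>r. residue_mean P2 (\<lambda>s. lam r s q n * lam r s q n'))"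
    unfolding E_def by (rule mean_split) (metis lam_periodic)
  also have "\<dots> \<le> residue_mean P1 (\<lambda>r. ?c)"
  proof (rule residue_mean_mono[OF P_pos(1)])
    fix r
    show "residue_mean P2 (\<lambda>s. lam r s q n * lam r s q n') \<le> ?c"
    proof (cases "V q n \<inter> V q n' = {}")
      case True
      thus ?thesis using mean_lam_lam_le[of r q n q n'] by simp
    next
      case False
      thus ?thesis using mean_lam_lam_trivial[of r q n q n'] cross_err_nonneg[of q n q n'] by simp
    qed
  qed
  finally show ?thesis using P_pos by (simp add: residue_mean_const)
qed

text \<open>There are exactly \<open>T\<close> pairs of addresses, so \<open>cross_err\<close> is an
  average over them and a uniform bound for each pair suffices.\<close>

lemma cross_err_sum_le:
  assumes "\<And>i j. i \<in> J \<Longrightarrow> j \<in> J \<Longrightarrow>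
     (\<Sum>x\<in>X. pair_err A2 a (pos_of (q x) (n x) (q' x) (n' x) i - pos_of (q x) (n x) (q' x) (n' x) j)) \<le> c"
  shows "(\<Sum>x\<in>X. cross_err (q x) (n x) (q' x) (n' x)) \<le> c"
proof -
  let ?p = "\<lambda>x i j. pair_err A2 a (pos_of (q x) (n x) (q' x) (n' x) i - pos_of (q x) (n x) (q' x) (n' x) j)"
  have "(\<Sum>x\<in>X. cross_err (q x) (n x) (q' x) (n' x)) = (\<Sum>x\<in>X. \<Sum>i\<in>J. \<Sum>j\<in>J. ?p x i j) / T"
    by (simp add: cross_err_def sum_divide_distrib)
  also have "(\<Sum>x\<in>X. \<Sum>i\<in>J. \<Sum>j\<in>J. ?p x i j) = (\<Sum>i\<in>J. \<Sum>x\<in>X. \<Sum>j\<in>J. ?p x i j)" by (rule sum.swap)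
  also have "\<dots> = (\<Sum>i\<in>J. \<Sum>j\<in>J. \<Sum>x\<in>X. ?p x i j)" by (intro sum.cong refl) (rule sum.swap)
  also have "\<dots> \<le> (\<Sum>i\<in>J. \<Sum>j\<in>J. c)" using assms by (intro sum_mono) auto
  also have "\<dots> = T * c" using J_card by (simp add: T_def power2_eq_square)
  finally show ?thesis using T_pos by (simp add: divide_right_mono)
qed

text \<open>The four smallness conditions control, in order, the loss in the lower bound,
  differences within one progression (averaged over \<open>q\<close>), differences between two
  progressions (averaged over \<open>n'\<close>), and intersecting progressions. Cross errors and
  intersections cost \<open>\<eta>\<close> each, whence \<open>1 + 2 * \<eta>\<close> for the second
  moment.\<close>

lemma q_moments:
  fixes N N0 \<eta> :: real and Y :: nat
  assumes Q: "finite Q" "\<And>q. q \<in> Q \<Longrightarrow> prime q \<and> N0 < real q \<and> real q \<le> N"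
    and N: "N0 > 1" "N > 0" "N \<le> w * N0" and \<eta>: "\<eta> \<ge> 0"
    and small: "(real L * B) ^ 2 * (24 / w) \<le> \<eta>" "err (2 * N / ln N0) 1 \<le> \<eta> * real (card Q)"
      "err (real Y) 1 \<le> \<eta> * real Y" "2 * real L / \<sigma>2 ^ (2 * L) \<le> \<eta> * real Y"
    and R: "R = {l<..l + int Y}"
  shows "rel_close (2 * \<eta>) (E (\<lambda>b. \<Sum>q\<in>Q. (\<Sum>n\<in>R. lam b b q n) ^ 1)) (real Y ^ 1 * real (card Q))"
    and "rel_close (2 * \<eta>) (E (\<lambda>b. \<Sum>q\<in>Q. (\<Sum>n\<in>R. lam b b q n) ^ 2)) (real Y ^ 2 * real (card Q))"
proof -
  have finR: "finite R" "card R = Y" by (simp_all add: R)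
  let ?S = "{0..<P1 * P2} \<times> Q"
  let ?c = "\<lambda>x::int \<times> nat. 1 / real_of_int (P1 * P2)"
  let ?f = "\<lambda>x. \<Sum>n\<in>R. lam (fst x) (fst x) (snd x) n"
  have conv: "E (\<lambda>b. \<Sum>q\<in>Q. (\<Sum>n\<in>R. lam b b q n) ^ j) = (\<Sum>x\<in>?S. ?c x * ?f x ^ j)" for j
    unfolding E_def residue_mean_def
    by (simp add: sum.cartesian_product split_beta sum_divide_distrib)
  have mass: "(\<Sum>x\<in>?S. ?c x) = real (card Q)" using P_pos by (simp add: card_cartesian_product)
  have m1: "(\<Sum>x\<in>?S. ?c x * ?f x) \<ge> (1 - \<eta>) * ((\<Sum>x\<in>?S. ?c x) * real Y)"
  proof -
    have "(\<Sum>x\<in>?S. ?c x * ?f x) = E (\<lambda>b. \<Sum>q\<in>Q. \<Sum>n\<in>R. lam b b q n)" using conv[of 1] by simp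
    also have "\<dots> = (\<Sum>q\<in>Q. \<Sum>n\<in>R. E (\<lambda>b. lam b b q n))" unfolding E_def by (simp add: residue_mean_sum)
    also have "\<dots> \<ge> (\<Sum>q\<in>Q. \<Sum>n\<in>R. 1 - \<eta>)"
      using E_lam_ge small(1) by (intro sum_mono) (meson diff_left_mono order_trans)
    finally show ?thesis unfolding mass using finR by (simp add: mult_ac)
  qed
  have m2: "(\<Sum>x\<in>?S. ?c x * ?f x ^ 2) \<le> (1 + 2 * \<eta>) * ((\<Sum>x\<in>?S. ?c x) * real Y ^ 2)"
  proof -
    let ?X = "Q \<times> R \<times> R"
    have sq: "(\<Sum>n\<in>R. g n) ^ 2 = (\<Sum>n\<in>R. \<Sum>n'\<in>R. g n * g n')" for g :: "int \<Rightarrow> real"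
      by (simp add: power2_eq_square sum_product)
    have "(\<Sum>x\<in>?S. ?c x * ?f x ^ 2) = E (\<lambda>b. \<Sum>q\<in>Q. \<Sum>n\<in>R. \<Sum>n'\<in>R. lam b b q n * lam b b q n')"
      using conv[of 2] by (simp add: sq)
    also have "\<dots> = (\<Sum>q\<in>Q. \<Sum>n\<in>R. \<Sum>n'\<in>R. E (\<lambda>b. lam b b q n * lam b b q n'))"
      unfolding E_def by (simp add: residue_mean_sum)
    also have "\<dots> \<le> (\<Sum>q\<in>Q. \<Sum>n\<in>R. \<Sum>n'\<in>R. 1 + cross_err q n q n' + of_bool (V q n \<inter> V q n' \<noteq> {}) / \<sigma>2 ^ (2 * L))"
      by (intro sum_mono E_lam_lam_le)
    also have "\<dots> = real (card Q) * real Y ^ 2 + (\<Sum>q\<in>Q. \<Sum>n\<in>R. \<Sum>n'\<in>R. cross_err q n q n')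
        + (\<Sum>q\<in>Q. \<Sum>n\<in>R. \<Sum>n'\<in>R. of_bool (V q n \<inter> V q n' \<noteq> {}) / \<sigma>2 ^ (2 * L))"
      by (simp add: sum.distrib finR power2_eq_square)
    also have "(\<Sum>q\<in>Q. \<Sum>n\<in>R. \<Sum>n'\<in>R. of_bool (V q n \<inter> V q n' \<noteq> {}) / \<sigma>2 ^ (2 * L)) \<le> (\<Sum>q\<in>Q. \<Sum>n\<in>R. \<eta> * real Y)"
    proof (intro sum_mono)
      fix q n assume q: "q \<in> Q"
      have "{n'. V q n \<inter> V q n' \<noteq> {}} \<subseteq> (\<lambda>i. n + int q * i) ` {- int L<..int L}"
      proof
        fix n' assume "n' \<in> {n'. V q n \<inter> V q n' \<noteq> {}}"
        then obtain m where "m \<in> V q n" "m \<in> V q n'" by blast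
        then obtain h h' where h: "h \<in> {1..L}" "h' \<in> {1..L}" "m = n + int q * int h" "m = n' + int q * int h'"
          unfolding V_def by blast
        hence "n' = n + int q * (int h - int h')" by (simp add: algebra_simps)
        moreover have "int h - int h' \<in> {- int L<..int L}" using h by auto
        ultimately show "n' \<in> (\<lambda>i. n + int q * i) ` {- int L<..int L}" by blast
      qed
      hence "card (R \<inter> {n'. V q n \<inter> V q n' \<noteq> {}}) \<le> card ((\<lambda>i. n + int q * i) ` {- int L<..int L})"
        by (intro card_mono) auto
      also have "\<dots> \<le> card {- int L<..int L}" by (intro card_image_le) auto
      finally have card: "real (card (R \<inter> {n'. V q n \<inter> V q n' \<noteq> {}})) \<le> 2 * real L" by simp
      have "(\<Sum>n'\<in>R. of_bool (V q n \<inter> V q n' \<noteq> {}) / \<sigma>2 ^ (2 * L)) =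
          (\<Sum>n'\<in>R. of_bool (V q n \<inter> V q n' \<noteq> {})) / \<sigma>2 ^ (2 * L)" by (rule sum_divide_distrib[symmetric])
      also have "(\<Sum>n'\<in>R. of_bool (V q n \<inter> V q n' \<noteq> {}) :: real) = real (card (R \<inter> {n'. V q n \<inter> V q n' \<noteq> {}}))"
        using finR by (subst sum_of_bool_eq) auto
      also have "\<dots> / \<sigma>2 ^ (2 * L) \<le> 2 * real L / \<sigma>2 ^ (2 * L)"
        using card \<sigma>2_bounds by (intro divide_right_mono) auto
      finally show "(\<Sum>n'\<in>R. of_bool (V q n \<inter> V q n' \<noteq> {}) / \<sigma>2 ^ (2 * L)) \<le> \<eta> * real Y"
        using small(4) by linarith
    qed
    also have "(\<Sum>q\<in>Q. \<Sum>n\<in>R. \<Sum>n'\<in>R. cross_err q n q n') \<le> real (card Q) * (real Y * (\<eta> * real Y))"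
    proof -
      have "(\<Sum>x\<in>?X. cross_err (fst x) (fst (snd x)) (fst x) (snd (snd x))) \<le> real (card Q) * (real Y * (\<eta> * real Y))"
      proof (rule cross_err_sum_le)
        fix i j assume ij: "i \<in> J" "j \<in> J"
        let ?e = "\<lambda>q n n'. pair_err A2 a (pos_of q n q n' i - pos_of q n q n' j)"
        let ?k = "int (snd i) - int (snd j)"
        have kL: "\<bar>?k\<bar> \<le> int L" using ij by (auto simp: J_def)
        have "(\<Sum>q\<in>Q. \<Sum>n\<in>R. \<Sum>n'\<in>R. ?e q n n') \<le> real (card Q) * (real Y * (\<eta> * real Y))"
        \<comment> \<open>Two points of the same progression differ by \<open>q\<close> times a
          difference of steps, free of \<open>n\<close> and \<open>n'\<close>, so the sum over
          \<open>q\<close> must save. On different progressions \<open>n'\<close> enters with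
          coefficient 1 or -1, and the sum over the interval saves.\<close>
        proof (cases "fst i = fst j")
          case True
          have e: "?e q n n' = pair_err A2 a (0 + int q * ?k)" for q n n'
            using True by (simp add: pos_of_def algebra_simps)
          have "(\<Sum>q\<in>Q. ?e q n n') \<le> \<eta> * real (card Q)" for n n'
          proof (cases "?k = 0")
            case True
            thus ?thesis unfolding e using \<eta> by simp
          next
            case False
            show ?thesis unfolding e
              by (rule order_trans[OF sum_pair_err_primes_le[OF Q N False kL] small(2)])
          qed
          hence "(\<Sum>n\<in>R. \<Sum>n'\<in>R. \<Sum>q\<in>Q. ?e q n n') \<le> (\<Sum>n\<in>R. \<Sum>n'\<in>R. \<eta> * real (card Q))" by (intro sum_mono) auto
          also have "\<dots> = real (card Q) * (real Y * (\<eta> * real Y))" using finR by simp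
          also have "(\<Sum>n\<in>R. \<Sum>n'\<in>R. \<Sum>q\<in>Q. ?e q n n') = (\<Sum>q\<in>Q. \<Sum>n\<in>R. \<Sum>n'\<in>R. ?e q n n')"
          proof -
            have "(\<Sum>n\<in>R. \<Sum>n'\<in>R. \<Sum>q\<in>Q. ?e q n n') = (\<Sum>n\<in>R. \<Sum>q\<in>Q. \<Sum>n'\<in>R. ?e q n n')"
              by (intro sum.cong refl) (rule sum.swap)
            also have "\<dots> = (\<Sum>q\<in>Q. \<Sum>n\<in>R. \<Sum>n'\<in>R. ?e q n n')" by (rule sum.swap)
            finally show ?thesis .
          qed
          finally show ?thesis .
        next
          case False
          define s :: int where "s = (if fst i then 1 else - 1)"
          have e: "?e q n n' = pair_err A2 a ((int q * ?k - s * n) + n' * s)" for q n n'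
            using False by (simp add: pos_of_def s_def algebra_simps)
          have s: "s \<noteq> 0" "\<bar>s\<bar> \<le> int L" using L1 by (auto simp: s_def)
          have "(\<Sum>n'\<in>R. ?e q n n') \<le> \<eta> * real Y" for q n
            unfolding e using sum_pair_err_interval_le[of R l Y, OF _ s] small(3) R by (auto intro: order_trans)
          hence "(\<Sum>q\<in>Q. \<Sum>n\<in>R. \<Sum>n'\<in>R. ?e q n n') \<le> (\<Sum>q\<in>Q. \<Sum>n\<in>R. \<eta> * real Y)" by (intro sum_mono) auto
          thus ?thesis using finR by simp
        qed
        thus "(\<Sum>x\<in>?X. pair_err A2 a (pos_of (fst x) (fst (snd x)) (fst x) (snd (snd x)) i
              - pos_of (fst x) (fst (snd x)) (fst x) (snd (snd x)) j)) \<le> real (card Q) * (real Y * (\<eta> * real Y))"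
          by (simp add: sum.cartesian_product split_beta)
      qed
      thus ?thesis by (simp add: sum.cartesian_product split_beta)
    qed
    finally show ?thesis unfolding mass using finR by (simp add: algebra_simps power2_eq_square)
  qed
  have c: "?c x \<ge> 0" for x using P_pos by simp
  show "rel_close (2 * \<eta>) (E (\<lambda>b. \<Sum>q\<in>Q. (\<Sum>n\<in>R. lam b b q n) ^ 1)) (real Y ^ 1 * real (card Q))"
    using moments_close(1)[of ?S ?c "real Y" \<eta> ?f, OF c _ \<eta> m1 m2] unfolding conv mass by (simp add: mult.commute)
  show "rel_close (2 * \<eta>) (E (\<lambda>b. \<Sum>q\<in>Q. (\<Sum>n\<in>R. lam b b q n) ^ 2)) (real Y ^ 2 * real (card Q))"
    using moments_close(2)[of ?S ?c "real Y" \<eta> ?f, OF c _ \<eta> m1 m2] unfolding conv mass by (simp add: mult.commute)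
qed

section \<open>Moments over the survivors \<open>n\<close>\<close>

lemma E_S: "E (\<lambda>b. of_bool (n \<in> S1 b) * of_bool (n \<in> S2 b)) = \<sigma>1 * \<sigma>2"
proof -
  have "E (\<lambda>b. of_bool (n \<in> S1 b) * of_bool (n \<in> S2 b)) =
      residue_mean P1 (\<lambda>r. residue_mean P2 (\<lambda>s. of_bool (n \<in> S1 r) * of_bool ({n} \<subseteq> S2 s)))"
    unfolding E_def by (rule mean_split) (simp add: S_periodic)
  also have "\<dots> = \<sigma>1 * survival I A2 {n}"
    by (simp only: residue_mean_cmult mean_S2 residue_mean_multc mean_S1)
  also have "survival I A2 {n} = \<sigma>2" unfolding \<sigma>2_def by (rule survival_singleton) (rule primes2D)
  finally show ?thesis .
qed

lemma mem_V: "h \<in> {1..L} \<Longrightarrow> n \<in> V q (n - int q * int h)"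
  unfolding V_def by (rule image_eqI[of _ _ h]) auto

text \<open>\<open>n\<close> is the point of step \<open>h\<close> on the progression based at
  \<open>n - q * h\<close>; if it lies in \<open>S1 r\<close>, a nonzero weight forces it into
  \<open>S2 s\<close>. The mean thus carries the density \<open>\<sigma>1\<close> instead of
  \<open>\<sigma>1 * \<sigma>2\<close>, which is the origin of the factor
  \<open>1 / \<sigma>2\<close> in (iii).\<close>

lemma S2_redundant:
  assumes "h \<in> {1..L}"
  shows "of_bool (n \<in> S1 r) * of_bool (n \<in> S2 s) * lam r s q (n - int q * int h)
    = of_bool (n \<in> S1 r) * lam r s q (n - int q * int h)"
  using mem_V[OF assms, of n q] by (auto simp: lam_def)

lemma E_S_lam_ge:
  assumes "h \<in> {1..L}"
  shows "E (\<lambda>b. of_bool (n \<in> S1 b) * of_bool (n \<in> S2 b) * lam b b q (n - int q * int h))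
    \<ge> \<sigma>1 * (1 - (real L * B) ^ 2 * (24 / w))"
proof -
  let ?l = "\<lambda>r s. lam r s q (n - int q * int h)"
  have "E (\<lambda>b. of_bool (n \<in> S1 b) * ?l b b) = residue_mean P1 (\<lambda>r. residue_mean P2 (\<lambda>s. of_bool (n \<in> S1 r) * ?l r s))"
    unfolding E_def by (rule mean_split) (simp add: S_periodic lam_periodic[symmetric])
  also have "\<dots> = residue_mean P1 (\<lambda>r. of_bool (n \<in> S1 r) * residue_mean P2 (\<lambda>s. ?l r s))"
    by (simp only: residue_mean_cmult)
  also have "\<dots> \<ge> residue_mean P1 (\<lambda>r. of_bool (n \<in> S1 r)) * (1 - (real L * B) ^ 2 * (24 / w))"
    by (rule residue_mean_weighted_lower[OF P_pos(1) _ mean_lam_ge]) simp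
  finally show ?thesis unfolding mean_S1 S2_redundant[OF assms] .
qed

text \<open>For \<open>q \<noteq> q'\<close> the progressions through \<open>n\<close> meet only in
  \<open>n\<close>: from \<open>q * (i - h) = q' * (j - h')\<close> the prime \<open>q\<close>
  divides \<open>j - h'\<close>, whose absolute value is less than \<open>L < q\<close>. This common
  point accounts for one factor \<open>1 / \<sigma>2\<close>. For \<open>q = q'\<close> the
  pointwise bound is used, such pairs being rare.\<close>

lemma E_S_lam_lam_le:
  assumes h: "h \<in> {1..L}" "h' \<in> {1..L}" and q: "prime q" "prime q'" "L < q"
  shows "E (\<lambda>b. of_bool (n \<in> S1 b) * of_bool (n \<in> S2 b) *
        (lam b b q (n - int q * int h) * lam b b q' (n - int q' * int h')))
    \<le> \<sigma>1 / \<sigma>2 * (1 + cross_err q (n - int q * int h) q' (n - int q' * int h') + of_bool (q = q') / \<sigma>2 ^ (2 * L))"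
proof -
  let ?m = "n - int q * int h" and ?m' = "n - int q' * int h'"
  let ?ll = "\<lambda>r s. lam r s q ?m * lam r s q' ?m'"
  let ?c = "1 + cross_err q ?m q' ?m' + of_bool (q = q') / \<sigma>2 ^ (2 * L)"
  have "E (\<lambda>b. of_bool (n \<in> S1 b) * ?ll b b) = residue_mean P1 (\<lambda>r. residue_mean P2 (\<lambda>s. of_bool (n \<in> S1 r) * ?ll r s))"
    unfolding E_def by (rule mean_split) (simp add: S_periodic lam_periodic[symmetric])
  also have "\<dots> = residue_mean P1 (\<lambda>r. of_bool (n \<in> S1 r) * residue_mean P2 (\<lambda>s. ?ll r s))"
    by (simp only: residue_mean_cmult)
  also have "\<dots> \<le> residue_mean P1 (\<lambda>r. of_bool (n \<in> S1 r)) * (1 / \<sigma>2 * ?c)"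
  proof (rule residue_mean_weighted_upper[OF P_pos(1)])
    fix r assume "of_bool (n \<in> S1 r) \<noteq> (0::real)"
    hence n: "n \<in> S1 r" by simp
    have e0: "cross_err q ?m q' ?m' \<ge> 0" by (rule cross_err_nonneg)
    show "residue_mean P2 (\<lambda>s. ?ll r s) \<le> 1 / \<sigma>2 * ?c"
    proof (cases "q = q'")
      case True
      have "residue_mean P2 (\<lambda>s. ?ll r s) \<le> 1 / \<sigma>2 ^ (2 * L)" by (rule mean_lam_lam_trivial)
      also have "\<dots> \<le> ?c" using True e0 by simp
      also have "\<dots> \<le> 1 / \<sigma>2 * ?c"
        using mult_right_mono[OF \<sigma>2_bounds(3), of ?c] e0 \<sigma>2_bounds(1) by simp
      finally show ?thesis .
    next
      case False
      have "V q ?m \<inter> V q' ?m' \<inter> S1 r = {n}"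
      proof (intro equalityI subsetI)
        fix x assume "x \<in> V q ?m \<inter> V q' ?m' \<inter> S1 r"
        hence "x \<in> V q ?m" "x \<in> V q' ?m'" by auto
        then obtain i j where i: "i \<in> {1..L}" "j \<in> {1..L}" "x = ?m + int q * int i" "x = ?m' + int q' * int j"
          unfolding V_def by blast
        hence eq: "int q * (int i - int h) = int q' * (int j - int h')" by (simp add: algebra_simps)
        have "int q dvd int q * (int i - int h)" by (rule dvd_triv_left)
        hence "int q dvd int q' * (int j - int h')" by (simp only: eq)
        moreover have "coprime (int q) (int q')" using q False by (simp add: primes_coprime)
        ultimately have dvd: "int q dvd (int j - int h')" by (simp add: coprime_dvd_mult_right_iff)
        have "int j - int h' = 0"
        proof (rule ccontr)
          assume "int j - int h' \<noteq> 0"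
          with dvd have "int q \<le> \<bar>int j - int h'\<bar>" using dvd_imp_le_int[of "int j - int h'" "int q"] by simp
          thus False using q(3) i(1,2) h by auto
        qed
        thus "x \<in> {n}" using i by simp
      qed (use n mem_V h in auto)
      hence "residue_mean P2 (\<lambda>s. ?ll r s) \<le> (1 + cross_err q ?m q' ?m') / \<sigma>2 ^ 1"
        using mean_lam_lam_le[of r q ?m q' ?m'] by simp
      thus ?thesis using False by simp
    qed
  qed simp
  finally have "E (\<lambda>b. of_bool (n \<in> S1 b) * ?ll b b) \<le> \<sigma>1 * (1 / \<sigma>2 * ?c)" unfolding mean_S1 .
  moreover have "(\<lambda>b. of_bool (n \<in> S1 b) * of_bool (n \<in> S2 b) * ?ll b b) = (\<lambda>b. of_bool (n \<in> S1 b) * ?ll b b)"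
    by (simp only: mult.assoc[symmetric] S2_redundant[OF h(1)])
  ultimately show ?thesis by (simp only: times_divide_eq_right times_divide_eq_left mult_1 mult_1_right)
qed

lemma n_moments:
  fixes N N0 \<eta> :: real and Y :: nat
  assumes Q: "finite Q" "\<And>q. q \<in> Q \<Longrightarrow> prime q \<and> N0 < real q \<and> real q \<le> N" "\<And>q. q \<in> Q \<Longrightarrow> L < q"
    and N: "N0 > 1" "N > 0" "N \<le> w * N0" and \<eta>: "\<eta> \<ge> 0"
    and small: "(real L * B) ^ 2 * (24 / w) \<le> \<eta>" "err (2 * N / ln N0) 1 \<le> \<eta> * real (card Q)"
      "1 / \<sigma>2 ^ (2 * L) \<le> \<eta> * real (card Q)"
  shows "rel_close (2 * \<eta>)
      (E (\<lambda>b. \<Sum>n\<in>S1 b \<inter> S2 b \<inter> {1..int Y}. (\<Sum>q\<in>Q. \<Sum>h\<in>{1..L}. lam b b q (n - int q * int h)) ^ 1))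
      ((real (card Q) * real L / \<sigma>2) ^ 1 * (\<sigma>1 * \<sigma>2 * real Y))"
    and "rel_close (2 * \<eta>)
      (E (\<lambda>b. \<Sum>n\<in>S1 b \<inter> S2 b \<inter> {1..int Y}. (\<Sum>q\<in>Q. \<Sum>h\<in>{1..L}. lam b b q (n - int q * int h)) ^ 2))
      ((real (card Q) * real L / \<sigma>2) ^ 2 * (\<sigma>1 * \<sigma>2 * real Y))"
proof -
  define R where "R = {1..int Y}"
  have finR: "finite R" "card R = Y" by (simp_all add: R_def)
  let ?S = "{0..<P1 * P2} \<times> R"
  let ?o = "\<lambda>b n. of_bool (n \<in> S1 b) * of_bool (n \<in> S2 b) :: real"
  let ?l = "\<lambda>b n q h. lam b b q (n - int q * int h)"
  let ?c = "\<lambda>x. ?o (fst x) (snd x) / real_of_int (P1 * P2)"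
  let ?F = "\<lambda>b n. \<Sum>q\<in>Q. \<Sum>h\<in>{1..L}. ?l b n q h"
  let ?f = "\<lambda>x. ?F (fst x) (snd x)"
  let ?m = "real (card Q) * real L / \<sigma>2"
  have restrict: "(\<Sum>n\<in>S1 b \<inter> S2 b \<inter> R. g n) = (\<Sum>n\<in>R. ?o b n * g n)" for b and g :: "int \<Rightarrow> real"
    by (rule sum.mono_neutral_cong_left) (use finR in auto)
  have conv: "E (\<lambda>b. \<Sum>n\<in>R. ?o b n * g b n) = (\<Sum>x\<in>?S. ?c x * g (fst x) (snd x))" for g
    unfolding E_def residue_mean_def
    by (simp add: sum.cartesian_product split_beta sum_divide_distrib)
  have mass: "(\<Sum>x\<in>?S. ?c x) = \<sigma>1 * \<sigma>2 * real Y"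
  proof -
    have "(\<Sum>x\<in>?S. ?c x) = E (\<lambda>b. \<Sum>n\<in>R. ?o b n)" using conv[of "\<lambda>b n. 1"] by simp
    also have "\<dots> = (\<Sum>n\<in>R. E (\<lambda>b. ?o b n))" unfolding E_def by (rule residue_mean_sum)
    also have "\<dots> = \<sigma>1 * \<sigma>2 * real Y" unfolding E_S using finR by simp
    finally show ?thesis .
  qed
  have m1: "(\<Sum>x\<in>?S. ?c x * ?f x) \<ge> (1 - \<eta>) * ((\<Sum>x\<in>?S. ?c x) * ?m)"
  proof -
    have "(\<Sum>x\<in>?S. ?c x * ?f x) = E (\<lambda>b. \<Sum>n\<in>R. \<Sum>q\<in>Q. \<Sum>h\<in>{1..L}. ?o b n * ?l b n q h)"
      unfolding conv[of ?F, symmetric] by (simp only: sum_distrib_left)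
    also have "\<dots> = (\<Sum>n\<in>R. \<Sum>q\<in>Q. \<Sum>h\<in>{1..L}. E (\<lambda>b. ?o b n * ?l b n q h))"
      unfolding E_def by (simp only: residue_mean_sum)
    also have "\<dots> \<ge> (\<Sum>n\<in>R. \<Sum>q\<in>Q. \<Sum>h\<in>{1..L}. \<sigma>1 * (1 - \<eta>))"
    proof (intro sum_mono)
      fix n q h assume "h \<in> {1..L}"
      hence "\<sigma>1 * (1 - (real L * B) ^ 2 * (24 / w)) \<le> E (\<lambda>b. ?o b n * ?l b n q h)" by (rule E_S_lam_ge)
      moreover have "\<sigma>1 * (1 - \<eta>) \<le> \<sigma>1 * (1 - (real L * B) ^ 2 * (24 / w))"
        using small(1) \<sigma>1_pos by (intro mult_left_mono) auto
      ultimately show "\<sigma>1 * (1 - \<eta>) \<le> E (\<lambda>b. ?o b n * ?l b n q h)" by linarith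
    qed
    finally have "real Y * (real (card Q) * (real L * (\<sigma>1 * (1 - \<eta>)))) \<le> (\<Sum>x\<in>?S. ?c x * ?f x)" using finR by simp
    moreover have "(1 - \<eta>) * (\<sigma>1 * \<sigma>2 * real Y * ?m) = real Y * (real (card Q) * (real L * (\<sigma>1 * (1 - \<eta>))))"
      using \<sigma>2_bounds by simp
    ultimately show ?thesis unfolding mass by (simp only:)
  qed
  have m2: "(\<Sum>x\<in>?S. ?c x * ?f x ^ 2) \<le> (1 + 2 * \<eta>) * ((\<Sum>x\<in>?S. ?c x) * ?m ^ 2)"
  proof -
    let ?H = "{1..L}"
    let ?e = "\<lambda>n q h q' h'. cross_err q (n - int q * int h) q' (n - int q' * int h')"
    let ?g = "\<lambda>n h h' x. 1 + ?e n (fst x) h (snd x) h' + of_bool (fst x = snd x) / \<sigma>2 ^ (2 * L)"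
    have sq: "(\<Sum>q\<in>Q. \<Sum>h\<in>?H. g q h) ^ 2 = (\<Sum>q\<in>Q. \<Sum>q'\<in>Q. \<Sum>h\<in>?H. \<Sum>h'\<in>?H. g q h * g q' h')"
      for g :: "nat \<Rightarrow> nat \<Rightarrow> real"
      by (simp add: power2_eq_square sum_product)
    have pairs: "(\<Sum>q\<in>Q. \<Sum>q'\<in>Q. g q q') = (\<Sum>x\<in>Q \<times> Q. g (fst x) (snd x))" for g :: "nat \<Rightarrow> nat \<Rightarrow> real"
      by (simp add: sum.cartesian_product split_beta)
    have "(\<Sum>x\<in>?S. ?c x * ?f x ^ 2) = E (\<lambda>b. \<Sum>n\<in>R. \<Sum>q\<in>Q. \<Sum>q'\<in>Q. \<Sum>h\<in>?H. \<Sum>h'\<in>?H. ?o b n * (?l b n q h * ?l b n q' h'))"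
      unfolding conv[of "\<lambda>b n. ?F b n ^ 2", symmetric] by (simp only: sq sum_distrib_left)
    also have "\<dots> = (\<Sum>n\<in>R. \<Sum>q\<in>Q. \<Sum>q'\<in>Q. \<Sum>h\<in>?H. \<Sum>h'\<in>?H. E (\<lambda>b. ?o b n * (?l b n q h * ?l b n q' h')))"
      unfolding E_def by (simp only: residue_mean_sum)
    also have "\<dots> \<le> (\<Sum>n\<in>R. \<Sum>q\<in>Q. \<Sum>q'\<in>Q. \<Sum>h\<in>?H. \<Sum>h'\<in>?H. \<sigma>1 / \<sigma>2 * ?g n h h' (q, q'))"
      unfolding fst_conv snd_conv using Q by (intro sum_mono E_S_lam_lam_le) auto
    also have "\<dots> = (\<Sum>n\<in>R. \<Sum>h\<in>?H. \<Sum>h'\<in>?H. \<sigma>1 / \<sigma>2 * (\<Sum>x\<in>Q \<times> Q. ?g n h h' x))"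
    proof (rule sum.cong[OF refl])
      fix n
      have "(\<Sum>q\<in>Q. \<Sum>q'\<in>Q. \<Sum>h\<in>?H. \<Sum>h'\<in>?H. \<sigma>1 / \<sigma>2 * ?g n h h' (q, q'))
         = (\<Sum>x\<in>Q \<times> Q. \<Sum>h\<in>?H. \<Sum>h'\<in>?H. \<sigma>1 / \<sigma>2 * ?g n h h' x)"
        unfolding fst_conv snd_conv by (rule pairs[of "\<lambda>q q'. \<Sum>h\<in>?H. \<Sum>h'\<in>?H. \<sigma>1 / \<sigma>2 * ?g n h h' (q, q')", unfolded fst_conv snd_conv prod.collapse])
      also have "\<dots> = (\<Sum>h\<in>?H. \<Sum>x\<in>Q \<times> Q. \<Sum>h'\<in>?H. \<sigma>1 / \<sigma>2 * ?g n h h' x)" by (rule sum.swap)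
      also have "\<dots> = (\<Sum>h\<in>?H. \<Sum>h'\<in>?H. \<Sum>x\<in>Q \<times> Q. \<sigma>1 / \<sigma>2 * ?g n h h' x)"
        by (intro sum.cong refl) (rule sum.swap)
      finally show "(\<Sum>q\<in>Q. \<Sum>q'\<in>Q. \<Sum>h\<in>?H. \<Sum>h'\<in>?H. \<sigma>1 / \<sigma>2 * ?g n h h' (q, q'))
         = (\<Sum>h\<in>?H. \<Sum>h'\<in>?H. \<sigma>1 / \<sigma>2 * (\<Sum>x\<in>Q \<times> Q. ?g n h h' x))"
        by (simp only: sum_distrib_left)
    qed
    also have "\<dots> \<le> (\<Sum>n\<in>R. \<Sum>h\<in>?H. \<Sum>h'\<in>?H. \<sigma>1 / \<sigma>2 * ((1 + 2 * \<eta>) * real (card Q) ^ 2))"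
    proof (intro sum_mono mult_left_mono)
      fix n h h' assume h: "h \<in> ?H" "h' \<in> ?H"
      have "(\<Sum>x\<in>Q \<times> Q. ?g n h h' x) =
         real (card Q) ^ 2 + (\<Sum>x\<in>Q \<times> Q. ?e n (fst x) h (snd x) h') + (\<Sum>x\<in>Q \<times> Q. of_bool (fst x = snd x) / \<sigma>2 ^ (2 * L))"
        by (simp add: sum.distrib card_cartesian_product power2_eq_square)
      also have "(\<Sum>x\<in>Q \<times> Q. of_bool (fst x = snd x) / \<sigma>2 ^ (2 * L)) = real (card Q) / \<sigma>2 ^ (2 * L)"
      proof -
        have "(\<Sum>x\<in>Q \<times> Q. of_bool (fst x = snd x) / \<sigma>2 ^ (2 * L)) = (\<Sum>q\<in>Q. \<Sum>q'\<in>Q. if q = q' then 1 / \<sigma>2 ^ (2 * L) else 0)"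
          by (simp add: sum.cartesian_product split_beta of_bool_def if_distrib[of "\<lambda>t. t / _"] cong: if_cong)
        also have "\<dots> = (\<Sum>q\<in>Q. 1 / \<sigma>2 ^ (2 * L))" using Q(1) by (intro sum.cong) simp_all
        finally show ?thesis by simp
      qed
      \<comment> \<open>Only \<open>card Q\<close> of the \<open>card Q ^ 2\<close> pairs are
        diagonal, and \<open>card Q\<close> is large enough to pay for the pointwise bound
        there.\<close>
      also have "\<dots> \<le> real (card Q) * (\<eta> * real (card Q))"
        using mult_left_mono[OF small(3), of "real (card Q)"] by simp
      also have "(\<Sum>x\<in>Q \<times> Q. ?e n (fst x) h (snd x) h') \<le> real (card Q) * (\<eta> * real (card Q))"
      proof (rule cross_err_sum_le)
        fix i j assume ij: "i \<in> J" "j \<in> J"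
        let ?p = "\<lambda>q q'. pos_of q (n - int q * int h) q' (n - int q' * int h')"
        let ?pe = "\<lambda>q q'. pair_err A2 a (?p q q' i - ?p q q' j)"
        \<comment> \<open>Every position is \<open>n\<close> plus a multiple of \<open>q\<close> or
          \<open>q'\<close>, so \<open>n\<close> cancels and each difference is
          \<open>q * k + q' * k'\<close>. If \<open>k \<noteq> 0\<close> the sum over
          \<open>q\<close> saves, otherwise the sum over \<open>q'\<close>; if both coefficients
          vanish the points coincide and there is no error.\<close>
        define k where "k = (if fst i then 0 else int (snd i) - int h) - (if fst j then 0 else int (snd j) - int h)"
        define k' where "k' = (if fst i then int (snd i) - int h' else 0) - (if fst j then int (snd j) - int h' else 0)"
        have kL: "\<bar>k\<bar> \<le> int L" "\<bar>k'\<bar> \<le> int L" using ij h by (auto simp: J_def k_def k'_def)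
        have e: "?pe q q' = pair_err A2 a (int q' * k' + int q * k)" for q q'
          by (simp add: pos_of_def k_def k'_def algebra_simps)
        have "(\<Sum>q\<in>Q. \<Sum>q'\<in>Q. ?pe q q') \<le> real (card Q) * (\<eta> * real (card Q))"
        proof (cases "k = 0")
          case k0: False
          have "(\<Sum>q\<in>Q. ?pe q q') \<le> \<eta> * real (card Q)" for q'
            unfolding e by (rule order_trans[OF sum_pair_err_primes_le[OF Q(1,2) N k0 kL(1)] small(2)])
          hence "(\<Sum>q'\<in>Q. \<Sum>q\<in>Q. ?pe q q') \<le> (\<Sum>q'\<in>Q. \<eta> * real (card Q))" by (intro sum_mono)
          also have "(\<Sum>q'\<in>Q. \<Sum>q\<in>Q. ?pe q q') = (\<Sum>q\<in>Q. \<Sum>q'\<in>Q. ?pe q q')" by (rule sum.swap)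
          finally show ?thesis by simp
        next
          case k0: True
          have "(\<Sum>q'\<in>Q. ?pe q q') \<le> \<eta> * real (card Q)" for q
          proof (cases "k' = 0")
            case True
            thus ?thesis unfolding e using k0 \<eta> by simp
          next
            case False
            have e': "?pe q q' = pair_err A2 a (0 + int q' * k')" for q' unfolding e using k0 by simp
            show ?thesis unfolding e'
              by (rule order_trans[OF sum_pair_err_primes_le[OF Q(1,2) N False kL(2)] small(2)])
          qed
          hence "(\<Sum>q\<in>Q. \<Sum>q'\<in>Q. ?pe q q') \<le> (\<Sum>q\<in>Q. \<eta> * real (card Q))" by (intro sum_mono)
          thus ?thesis by simp
        qed
        thus "(\<Sum>x\<in>Q \<times> Q. ?pe (fst x) (snd x)) \<le> real (card Q) * (\<eta> * real (card Q))"
          by (simp add: sum.cartesian_product split_beta)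
      qed
      finally show "(\<Sum>x\<in>Q \<times> Q. ?g n h h' x)
         \<le> (1 + 2 * \<eta>) * real (card Q) ^ 2" by (simp add: algebra_simps power2_eq_square)
    qed (use \<sigma>1_pos \<sigma>2_bounds in simp)
    also have "\<dots> = (1 + 2 * \<eta>) * (\<sigma>1 * \<sigma>2 * real Y * ?m ^ 2)"
      using finR \<sigma>2_bounds by (simp add: power2_eq_square)
    finally show ?thesis unfolding mass .
  qed
  have c: "?c x \<ge> 0" for x using P_pos by simp
  have m0: "?m \<ge> 0" using \<sigma>2_bounds by simp
  show "rel_close (2 * \<eta>)
      (E (\<lambda>b. \<Sum>n\<in>S1 b \<inter> S2 b \<inter> {1..int Y}. ?F b n ^ 1)) (?m ^ 1 * (\<sigma>1 * \<sigma>2 * real Y))"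
    using moments_close(1)[of ?S ?c ?m \<eta> ?f, OF c m0 \<eta> m1 m2]
    unfolding R_def[symmetric] restrict conv mass power_one_right by (simp only: mult.commute)
  show "rel_close (2 * \<eta>)
      (E (\<lambda>b. \<Sum>n\<in>S1 b \<inter> S2 b \<inter> {1..int Y}. ?F b n ^ 2)) (?m ^ 2 * (\<sigma>1 * \<sigma>2 * real Y))"
    using moments_close(2)[of ?S ?c ?m \<eta> ?f, OF c m0 \<eta> m1 m2]
    unfolding R_def[symmetric] restrict conv mass by (simp only: mult.commute)
qed


section \<open>The second moment of the number of survivors\<close>

lemma S1_shift: "n \<in> S1 b \<longleftrightarrow> 0 \<in> S1 (b - n)"
  by (simp add: S1_def mem_translate_sifted)

text \<open>As \<open>d\<close> is coprime to \<open>P1\<close>, a full period of the progression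
  runs through all residues modulo \<open>P1\<close> and meets \<open>S1 r\<close> with its exact
  density.\<close>

lemma card_S1_progression:
  assumes "coprime d P1"
  shows "real (card {k \<in> {0..<P1}. c + d * k \<in> S1 r}) = \<sigma>1 * real_of_int P1"
proof -
  let ?h = "\<lambda>b. of_bool (0 \<in> S1 b) :: real"
  let ?f = "\<lambda>k. (r - c - d * k) mod P1"
  have inj: "inj_on ?f {0..<P1}"
  proof (rule inj_onI)
    fix i j assume ij: "i \<in> {0..<P1}" "j \<in> {0..<P1}" "?f i = ?f j"
    hence "[r - c - d * i = r - c - d * j] (mod P1)" by (simp only: cong_def)
    from cong_diff[OF cong_refl this, of "r - c"]
    have "[d * i = d * j] (mod P1)" by simp
    hence "[i = j] (mod P1)" using assms cong_mult_lcancel by blast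
    thus "i = j" using ij by (simp add: cong_def)
  qed
  have sub: "?f ` {0..<P1} \<subseteq> {0..<P1}" using P_pos by auto
  have img: "?f ` {0..<P1} = {0..<P1}"
    by (rule endo_inj_surj[OF _ sub inj]) simp
  have "real (card {k \<in> {0..<P1}. c + d * k \<in> S1 r}) = (\<Sum>k\<in>{0..<P1}. of_bool (c + d * k \<in> S1 r))"
    by (subst sum_of_bool_eq) (auto simp: Int_def intro!: arg_cong[of _ _ card])
  also have "\<dots> = (\<Sum>k\<in>{0..<P1}. ?h (?f k))"
  proof (rule sum.cong[OF refl])
    fix k
    have "c + d * k \<in> S1 r \<longleftrightarrow> 0 \<in> S1 (r - c - d * k)"
      using S1_shift[of "c + d * k" r] by (simp add: algebra_simps)
    thus "of_bool (c + d * k \<in> S1 r) = ?h (?f k)" by (simp only: S_periodic)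
  qed
  also have "\<dots> = (\<Sum>b\<in>?f ` {0..<P1}. ?h b)" by (rule sum.reindex[OF inj, symmetric, unfolded comp_def])
  also have "\<dots> = \<sigma>1 * real_of_int P1"
    unfolding img using mean_S1[of 0] P_pos by (simp add: residue_mean_def field_simps)
  finally show ?thesis .
qed

text \<open>The class is cut into blocks of \<open>P1\<close> consecutive terms; rounding up the
  number of blocks costs at most one period, hence \<open>P1\<close> beside \<open>Y / d\<close>.
  The factor \<open>\<sigma>1\<close> is essential: the second moment is compared with
  \<open>(\<sigma>1 * \<sigma>2 * Y) ^ 2\<close>, and a plain interval count would lose powers of
  \<open>1 / \<sigma>1\<close>.\<close>

lemma card_S1_class_le:
  assumes d: "d > (0::nat)" "coprime (int d) P1" and W: "W \<subseteq> S1 r \<inter> {l<..l + int Y}"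
    and cong: "\<And>n n'. n \<in> W \<Longrightarrow> n' \<in> W \<Longrightarrow> [n = n'] (mod int d)"
  shows "real (card W) \<le> \<sigma>1 * (real Y / real d + real_of_int P1)"
proof (cases "W = {}")
  case False
  have fin: "finite W" using W by (auto intro: finite_subset)
  \<comment> \<open>With the least element as origin all quotients \<open>?k n\<close> are
    nonnegative.\<close>
  define c where "c = Min W"
  have c: "c \<in> W" "\<And>n. n \<in> W \<Longrightarrow> c \<le> n" using fin False by (simp_all add: c_def)
  define G where "G = {k \<in> {0..<P1}. c + int d * k \<in> S1 r}"
  define m where "m = (int Y div int d) div P1 + 1"
  let ?k = "\<lambda>n. (n - c) div int d"
  let ?f = "\<lambda>n. (?k n div P1, ?k n mod P1)"
  have n_eq: "n = c + int d * ?k n" if "n \<in> W" for n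
  proof -
    have "int d dvd n - c" using cong[OF that c(1)] by (simp add: cong_iff_dvd_diff)
    thus ?thesis by simp
  qed
  have "card W \<le> card ({0..<m} \<times> G)"
  proof (rule card_inj_on_le[of ?f])
    show "inj_on ?f W"
    proof (rule inj_onI)
      fix n n' assume n: "n \<in> W" "n' \<in> W" "?f n = ?f n'"
      have "?k n = ?k n div P1 * P1 + ?k n mod P1" by (rule div_mult_mod_eq[symmetric])
      also have "\<dots> = ?k n' div P1 * P1 + ?k n' mod P1" using n(3) by simp
      also have "\<dots> = ?k n'" by (rule div_mult_mod_eq)
      finally have k: "?k n = ?k n'" .
      have "n = c + int d * ?k n" by (rule n_eq[OF n(1)])
      also have "\<dots> = c + int d * ?k n'" by (simp only: k)
      also have "\<dots> = n'" by (rule n_eq[OF n(2), symmetric])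
      finally show "n = n'" .
    qed
    show "?f ` W \<subseteq> {0..<m} \<times> G"
    proof
      fix t assume "t \<in> ?f ` W"
      then obtain n where n: "n \<in> W" "t = ?f n" by blast
      have nW: "n \<in> S1 r" "n \<le> l + int Y" "l < c" using n(1) c(1) W by auto
      have k0: "0 \<le> ?k n" using c(2)[OF n(1)] d by (simp add: pos_imp_zdiv_nonneg_iff)
      have "?k n \<le> int Y div int d" using nW d by (intro zdiv_mono1) auto
      hence "?k n div P1 \<le> (int Y div int d) div P1" by (rule zdiv_mono1) (rule P_pos)
      moreover have "0 \<le> ?k n div P1" using k0 P_pos by (simp add: pos_imp_zdiv_nonneg_iff)
      moreover have "?k n mod P1 \<in> G"
      proof -
        have "c + int d * (?k n mod P1) \<in> S1 r"
        proof -
          have "(r - (c + int d * (?k n mod P1))) mod P1 = (r - n) mod P1"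
          proof -
            have "[?k n mod P1 = ?k n] (mod P1)" by (simp add: cong_def)
            hence "[r - (c + int d * (?k n mod P1)) = r - (c + int d * ?k n)] (mod P1)"
              by (intro cong_diff cong_add cong_mult cong_refl)
            thus ?thesis using n_eq[OF n(1)] by (simp add: cong_def)
          qed
          hence "S1 (r - (c + int d * (?k n mod P1))) = S1 (r - n)" by (metis S_periodic(1))
          thus ?thesis using nW(1) S1_shift by blast
        qed
        thus ?thesis using P_pos by (simp add: G_def)
      qed
      ultimately show "t \<in> {0..<m} \<times> G" using n(2) by (auto simp: m_def)
    qed
    show "finite ({0..<m} \<times> G)" unfolding G_def by (intro finite_cartesian_product finite_Collect_conjI) simp_all
  qed
  also have "\<dots> = nat m * card G" by (simp add: card_cartesian_product)
  finally have "real (card W) \<le> real (nat m) * real (card G)" by (metis of_nat_le_iff of_nat_mult)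
  also have "real (card G) = \<sigma>1 * real_of_int P1" unfolding G_def by (rule card_S1_progression[OF d(2)])
  also have "real (nat m) \<le> real Y / real d / real_of_int P1 + 1"
  proof -
    have "real_of_int ((int Y div int d) div P1) \<le> real_of_int (int Y div int d) / real_of_int P1"
      by (rule real_of_int_div4)
    also have "\<dots> \<le> real Y / real d / real_of_int P1"
      using real_of_int_div4[of "int Y" "int d"] P_pos by (intro divide_right_mono) auto
    finally have "real_of_int m \<le> real Y / real d / real_of_int P1 + 1" by (simp add: m_def)
    moreover have "m \<ge> 0" using P_pos d by (simp add: m_def pos_imp_zdiv_nonneg_iff)
    ultimately show ?thesis by simp
  qed
  also have "(real Y / real d / real_of_int P1 + 1) * (\<sigma>1 * real_of_int P1) = \<sigma>1 * (real Y / real d + real_of_int P1)"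
    using P_pos by (simp add: field_simps)
  finally show ?thesis using \<sigma>1_pos P_pos by (simp add: mult_right_mono)
next
  case True
  have "0 \<le> real Y / real d + real_of_int P1" using P_pos by simp
  thus ?thesis using True \<sigma>1_pos by simp
qed

lemma sum_pair_err_S1_le:
  assumes W: "W \<subseteq> S1 r \<inter> {l<..l + int Y}" and k: "k \<noteq> 0" "\<bar>k\<bar> \<le> int L"
  shows "(\<Sum>n\<in>W. pair_err A2 a (c + n * k)) \<le> \<sigma>1 * err (real Y) (real_of_int P1)"
proof -
  have "(\<Sum>n\<in>W. pair_err A2 a (c + n * k)) \<le> \<sigma>1 * real Y * (exp (a * B ^ 2 * (24 / w)) - 1)
      + \<sigma>1 * real_of_int P1 * sieve_density I A2 powr (- (a * B))"
  proof (rule sum_pair_err_le)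
    show "finite W" using W by (auto intro: finite_subset)
    fix D :: "nat set" and c' :: "nat \<Rightarrow> int"
    assume D: "D \<subseteq> A2" "D \<noteq> {}"
    let ?S = "{n \<in> W. c + n * k \<noteq> 0 \<and> (\<forall>p\<in>D. [c + n * k = c' p] (mod int p))}"
    note finD = subset_A2(1)[OF D(1)] and pD = subset_A2(2,3)[OF D(1)] and d0 = subset_A2(4)[OF D(1)]
    have cop: "coprime (int (\<Prod>D)) P1"
      unfolding P1_def modulus_def of_nat_prod
    proof (rule prod_coprime_left, rule prod_coprime_right)
      fix p q assume "p \<in> D" "q \<in> {p \<in> A1. I p \<noteq> {}}"
      hence "prime p" "prime q" "p \<noteq> q" using pD primes1 disj D(1) by auto
      thus "coprime (int p) (int q)" by (simp add: primes_coprime)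
    qed
    have "real (card ?S) \<le> \<sigma>1 * (real Y / real (\<Prod>D) + real_of_int P1)"
    proof (rule card_S1_class_le[OF d0 cop])
      show "?S \<subseteq> S1 r \<inter> {l<..l + int Y}" using W by blast
      fix n n' assume n: "n \<in> ?S" "n' \<in> ?S"
      show "[n = n'] (mod int (\<Prod>D))"
      proof (rule cong_mod_prod_primes[OF finD pD(2)])
        fix p assume "p \<in> D"
        hence "p \<in> A2" "[c + n * k = c' p] (mod int p)" "[c + n' * k = c' p] (mod int p)"
          using n D(1) by auto
        thus "[n = n'] (mod int p)" using cong_cancel_linear[OF _ k] by blast
      qed
    qed
    also have "\<dots> = \<sigma>1 * real Y * (\<Prod>p\<in>D. 1 / real p) + \<sigma>1 * real_of_int P1"
      by (simp add: prod_dividef algebra_simps)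
    also have "\<dots> \<le> \<sigma>1 * real Y * (\<Prod>p\<in>D. (1 + ln (real p)) / real p) + \<sigma>1 * real_of_int P1"
    proof (intro add_right_mono mult_left_mono prod_mono conjI divide_right_mono)
      fix p assume "p \<in> D"
      hence "real p \<ge> 1" using pD(1) by fastforce
      thus "1 \<le> 1 + ln (real p)" by simp
    qed (use \<sigma>1_pos in auto)
    finally show "real (card ?S) \<le> \<sigma>1 * real Y * (\<Prod>p\<in>D. (1 + ln (real p)) / real p) + \<sigma>1 * real_of_int P1" .
  qed (use fin primes2 w1 a_nonneg \<sigma>1_pos P_pos in auto)
  also have "\<dots> = \<sigma>1 * err (real Y) (real_of_int P1)" by (simp add: err_def \<sigma>2_def algebra_simps)
  finally show ?thesis .
qed

text \<open>Of the \<open>T = (2 * L) ^ 2\<close> pairs of addresses, \<open>L ^ 2\<close> have the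
  difference \<open>n - n'\<close>, \<open>L ^ 2\<close> its negative, and the others 0, so the
  average is at most the sum of the two errors. For \<open>n = n'\<close> the trivial bound 1 is
  enough.\<close>

lemma survival_pair_le:
  "survival I A2 {n, n'} \<le> \<sigma>2 ^ 2 * (1 + pair_err A2 a (n - n') + pair_err A2 a (n' - n)) + of_bool (n = n')"
proof (cases "n = n'")
  case True
  have "survival I A2 {n, n'} = \<sigma>2" unfolding True \<sigma>2_def
    by (simp only: insert_absorb2) (rule survival_singleton, rule primes2D)
  also have "\<dots> \<le> 1" by (rule \<sigma>2_bounds)
  also have "\<dots> \<le> \<sigma>2 ^ 2 + 1" by simp
  finally show ?thesis using True by simp
next
  case False
  let ?e = "\<lambda>t::bool \<times> nat. if fst t then n else n'"
  let ?p = "pair_err A2 a (n - n')" and ?p' = "pair_err A2 a (n' - n)"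
  have sumJ: "(\<Sum>i\<in>J. f (fst i)) = real L * (f True + f False)" for f :: "bool \<Rightarrow> real"
  proof -
    have "(\<Sum>i\<in>J. f (fst i)) = (\<Sum>s\<in>UNIV. \<Sum>h\<in>{1..L}. f s)"
      unfolding J_def sum.cartesian_product by (rule sum.cong) auto
    thus ?thesis by (simp add: UNIV_bool algebra_simps)
  qed
  have "(\<Sum>i\<in>J. \<Sum>j\<in>J. pair_err A2 a (?e i - ?e j))
    = (\<Sum>i\<in>J. real L * (pair_err A2 a (?e i - n) + pair_err A2 a (?e i - n')))"
  proof (rule sum.cong[OF refl])
    fix i :: "bool \<times> nat"
    show "(\<Sum>j\<in>J. pair_err A2 a (?e i - ?e j)) = real L * (pair_err A2 a (?e i - n) + pair_err A2 a (?e i - n'))"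
      using sumJ[of "\<lambda>s. pair_err A2 a (?e i - (if s then n else n'))"] by simp
  qed
  also have "\<dots> = real L * (real L * (?p' + ?p))"
    using sumJ[of "\<lambda>s. pair_err A2 a ((if s then n else n') - n) + pair_err A2 a ((if s then n else n') - n')"]
    by (simp add: sum_distrib_left[symmetric] if_distrib[of "\<lambda>t. t - _"] if_distrib[of "pair_err A2 a"] cong: if_cong)
  also have "\<dots> \<le> T * (?p + ?p')"
  proof -
    have "real L * real L * (?p + ?p') \<le> T * (?p + ?p')"
      using pair_err_nonneg[OF a_nonneg] by (intro mult_right_mono) (auto simp: T_def power2_eq_square)
    thus ?thesis by (simp add: algebra_simps)
  qed
  finally have sum_le: "(\<Sum>i\<in>J. \<Sum>j\<in>J. pair_err A2 a (?e i - ?e j)) / T \<le> ?p + ?p'"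
    using T_pos by (simp add: pos_divide_le_eq mult.commute)
  have "2 * 2 * B \<le> 4 * real L * B" using L1 B_nonneg by (intro mult_right_mono) auto
  hence "2 * real (card {n, n'}) * B \<le> w" using LB False by simp
  moreover have "{n, n'} \<subseteq> ?e ` J"
  proof -
    have "(True, 1) \<in> J" "(False, 1) \<in> J" using L1 by (auto simp: J_def)
    thus ?thesis by force
  qed
  ultimately have "survival I A2 {n, n'} \<le> \<sigma>2 ^ card {n, n'} * (1 + (\<Sum>i\<in>J. \<Sum>j\<in>J. pair_err A2 a (?e i - ?e j)) / T)"
    unfolding \<sigma>2_def using fin primes2 w1 J_card by (intro survival_le) (auto simp: T_def a_def)
  also have "\<dots> \<le> \<sigma>2 ^ card {n, n'} * (1 + (?p + ?p'))"
    using sum_le \<sigma>2_bounds by (intro mult_left_mono add_left_mono) auto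
  finally show ?thesis using False by (simp add: add.assoc power2_eq_square)
qed

text \<open>With the large primes averaged out, the survivors of the small primes are counted for
  each fixed \<open>r\<close> by periodicity; \<open>V0\<close> is the interval length enlarged by
  one period. The last term is the diagonal.\<close>

lemma second_moment_le:
  fixes Y :: nat
  defines "V0 \<equiv> real Y + real_of_int P1"
  shows "E (\<lambda>b. (real (card (S1 b \<inter> S2 b \<inter> {1..int Y}))) ^ 2)
     \<le> (\<sigma>1 * \<sigma>2) ^ 2 * V0 * (V0 + 2 * err (real Y) (real_of_int P1)) + \<sigma>1 * V0"
proof -
  let ?R = "{0<..0 + int Y}"
  have R: "{1..int Y} = ?R" by auto
  let ?o = "\<lambda>r n. of_bool (n \<in> S1 r) :: real"
  let ?s = "\<lambda>n n'. survival I A2 {n, n'}"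
  define e where "e = err (real Y) (real_of_int P1)"
  have pw: "(real (card (S1 r \<inter> S2 s \<inter> ?R))) ^ 2 = (\<Sum>n\<in>?R \<inter> S1 r. \<Sum>n'\<in>?R \<inter> S1 r. of_bool ({n, n'} \<subseteq> S2 s))" for r s
  proof -
    have "real (card (S1 r \<inter> S2 s \<inter> ?R)) = (\<Sum>n\<in>?R \<inter> S1 r. of_bool (n \<in> S2 s))"
      by (subst sum_of_bool_eq) (auto intro!: arg_cong[of _ _ card])
    hence "(real (card (S1 r \<inter> S2 s \<inter> ?R))) ^ 2 = (\<Sum>n\<in>?R \<inter> S1 r. \<Sum>n'\<in>?R \<inter> S1 r. of_bool (n \<in> S2 s) * of_bool (n' \<in> S2 s))"
      by (simp only: power2_eq_square sum_product)
    moreover have "of_bool ({n, n'} \<subseteq> S2 s) = (of_bool (n \<in> S2 s) * of_bool (n' \<in> S2 s) :: real)" for n n'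
      by simp
    ultimately show ?thesis by (simp only:)
  qed
  have "E (\<lambda>b. (real (card (S1 b \<inter> S2 b \<inter> {1..int Y}))) ^ 2)
     = residue_mean P1 (\<lambda>r. residue_mean P2 (\<lambda>s. (real (card (S1 r \<inter> S2 s \<inter> ?R))) ^ 2))"
    unfolding E_def R by (rule mean_split) (simp only: S_periodic)
  also have "\<dots> = residue_mean P1 (\<lambda>r. \<Sum>n\<in>?R \<inter> S1 r. \<Sum>n'\<in>?R \<inter> S1 r. ?s n n')"
    by (simp only: pw residue_mean_sum mean_S2)
  also have "\<dots> \<le> residue_mean P1 (\<lambda>r. (\<sigma>1 * \<sigma>2) ^ 2 * V0 * (V0 + 2 * e) + \<sigma>1 * V0)"
  proof (rule residue_mean_mono[OF P_pos(1)])
    fix r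
    let ?W = "?R \<inter> S1 r"
    have finW: "finite ?W" by simp
    have W: "?W \<subseteq> S1 r \<inter> {0<..0 + int Y}" by auto
    \<comment> \<open>The class bound with modulus 1.\<close>
    have cW: "real (card ?W) \<le> \<sigma>1 * V0"
      using card_S1_class_le[of 1 ?W r 0 Y] W by (simp add: V0_def)
    have e1: "(\<Sum>n'\<in>?W. pair_err A2 a (n - n')) \<le> \<sigma>1 * e" for n
      using sum_pair_err_S1_le[OF W, of "- 1" n] L1 by (simp add: e_def)
    have e2: "(\<Sum>n'\<in>?W. pair_err A2 a (n' - n)) \<le> \<sigma>1 * e" for n
      using sum_pair_err_S1_le[OF W, of 1 "- n"] L1 by (simp add: e_def)
    have nn: "\<sigma>1 * e \<ge> 0" using e1[of 0] sum_nonneg[of ?W "\<lambda>n'. pair_err A2 a (0 - n')"] pair_err_nonneg[OF a_nonneg]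
      by (meson order_trans)
    have "(\<Sum>n\<in>?W. \<Sum>n'\<in>?W. ?s n n') \<le> (\<Sum>n\<in>?W. \<sigma>2 ^ 2 * (real (card ?W) + \<sigma>1 * e + \<sigma>1 * e) + 1)"
    proof (rule sum_mono)
      fix n assume n: "n \<in> ?W"
      have "(\<Sum>n'\<in>?W. ?s n n') \<le> (\<Sum>n'\<in>?W. \<sigma>2 ^ 2 * (1 + pair_err A2 a (n - n') + pair_err A2 a (n' - n)) + of_bool (n = n'))"
        by (intro sum_mono survival_pair_le)
      also have "\<dots> = \<sigma>2 ^ 2 * (real (card ?W) + (\<Sum>n'\<in>?W. pair_err A2 a (n - n')) + (\<Sum>n'\<in>?W. pair_err A2 a (n' - n)))
          + (\<Sum>n'\<in>?W. of_bool (n = n'))"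
        by (simp add: sum.distrib sum_distrib_left[symmetric] del: of_bool_eq_1_iff)
      also have "(\<Sum>n'\<in>?W. of_bool (n = n')) = (1::real)"
        using n by (subst sum_of_bool_eq) auto
      also have "\<sigma>2 ^ 2 * (real (card ?W) + (\<Sum>n'\<in>?W. pair_err A2 a (n - n')) + (\<Sum>n'\<in>?W. pair_err A2 a (n' - n))) + 1
          \<le> \<sigma>2 ^ 2 * (real (card ?W) + \<sigma>1 * e + \<sigma>1 * e) + 1"
        by (intro add_mono mult_left_mono e1 e2 order_refl zero_le_power2)
      finally show "(\<Sum>n'\<in>?W. ?s n n') \<le> \<sigma>2 ^ 2 * (real (card ?W) + \<sigma>1 * e + \<sigma>1 * e) + 1" .
    qed
    also have "\<dots> = real (card ?W) * (\<sigma>2 ^ 2 * (real (card ?W) + \<sigma>1 * e + \<sigma>1 * e) + 1)" by simp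
    also have "\<dots> \<le> (\<sigma>1 * V0) * (\<sigma>2 ^ 2 * (\<sigma>1 * V0 + \<sigma>1 * e + \<sigma>1 * e) + 1)"
    proof (rule mult_mono[OF cW])
      show "0 \<le> \<sigma>1 * V0" using cW by (rule order_trans[rotated]) simp
      show "0 \<le> \<sigma>2 ^ 2 * (real (card ?W) + \<sigma>1 * e + \<sigma>1 * e) + 1"
        by (intro add_nonneg_nonneg mult_nonneg_nonneg[OF zero_le_power2] nn) auto
      show "\<sigma>2 ^ 2 * (real (card ?W) + \<sigma>1 * e + \<sigma>1 * e) + 1 \<le> \<sigma>2 ^ 2 * (\<sigma>1 * V0 + \<sigma>1 * e + \<sigma>1 * e) + 1"
        by (intro add_right_mono mult_left_mono[OF _ zero_le_power2] cW)
    qed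
    also have "\<dots> = (\<sigma>1 * \<sigma>2) ^ 2 * V0 * (V0 + 2 * e) + \<sigma>1 * V0"
      by (simp add: power2_eq_square algebra_simps)
    finally show "(\<Sum>n\<in>?W. \<Sum>n'\<in>?W. ?s n n') \<le> (\<sigma>1 * \<sigma>2) ^ 2 * V0 * (V0 + 2 * e) + \<sigma>1 * V0" .
  qed
  also have "\<dots> = (\<sigma>1 * \<sigma>2) ^ 2 * V0 * (V0 + 2 * e) + \<sigma>1 * V0" by (rule residue_mean_const[OF P_pos(1)])
  finally show ?thesis by (simp only: e_def)
qed

lemma first_moment: "E (\<lambda>b. real (card (S1 b \<inter> S2 b \<inter> {1..int Y}))) = \<sigma>1 * \<sigma>2 * real Y"
proof -
  have "real (card (S1 b \<inter> S2 b \<inter> {1..int Y})) = (\<Sum>n\<in>{1..int Y}. of_bool (n \<in> S1 b) * of_bool (n \<in> S2 b))" for b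
    by (simp flip: of_bool_conj) (auto simp: Int_def intro!: arg_cong[of _ _ card])
  hence "E (\<lambda>b. real (card (S1 b \<inter> S2 b \<inter> {1..int Y}))) = (\<Sum>n\<in>{1..int Y}. E (\<lambda>b. of_bool (n \<in> S1 b) * of_bool (n \<in> S2 b)))"
    unfolding E_def by (simp only: residue_mean_sum)
  thus ?thesis by (simp add: E_S)
qed

text \<open>An instance of \<open>moments_close\<close> indexed by the shifts alone, so the mass is
  1; the lower hypothesis holds because the first moment is exact.\<close>

lemma count_moments:
  fixes Y :: nat
  assumes "\<eta> \<ge> 0" and "(\<sigma>1 * \<sigma>2) ^ 2 * (real Y + real_of_int P1) * (real Y + real_of_int P1 + 2 * err (real Y) (real_of_int P1))
      + \<sigma>1 * (real Y + real_of_int P1) \<le> (1 + 2 * \<eta>) * (\<sigma>1 * \<sigma>2 * real Y) ^ 2"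
  shows "rel_close (2 * \<eta>) (E (\<lambda>b. (real (card (S1 b \<inter> S2 b \<inter> {1..int Y}))) ^ 2)) ((\<sigma>1 * \<sigma>2 * real Y) ^ 2)"
proof -
  let ?S = "{0..<P1 * P2}"
  let ?c = "\<lambda>b::int. 1 / real_of_int (P1 * P2)"
  let ?f = "\<lambda>b. real (card (S1 b \<inter> S2 b \<inter> {1..int Y}))"
  let ?m = "\<sigma>1 * \<sigma>2 * real Y"
  have conv: "E (\<lambda>b. g (?f b)) = (\<Sum>b\<in>?S. ?c b * g (?f b))" for g
    unfolding E_def residue_mean_def by (simp add: sum_divide_distrib)
  have mass: "(\<Sum>b\<in>?S. ?c b) = 1" using P_pos by simp
  have c: "?c b \<ge> 0" for b using P_pos by simp
  have m: "?m \<ge> 0" using \<sigma>1_pos \<sigma>2_bounds by simp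
  have lower: "(1 - \<eta>) * ((\<Sum>b\<in>?S. ?c b) * ?m) \<le> (\<Sum>b\<in>?S. ?c b * ?f b)"
    unfolding mass conv[of "\<lambda>t. t", symmetric] first_moment mult_1
    using mult_right_mono[OF _ m, of "1 - \<eta>" 1] assms(1) by simp
  have upper: "(\<Sum>b\<in>?S. ?c b * ?f b ^ 2) \<le> (1 + 2 * \<eta>) * ((\<Sum>b\<in>?S. ?c b) * ?m ^ 2)"
    unfolding mass conv[of "\<lambda>t. t ^ 2", symmetric] mult_1
    by (rule order_trans[OF second_moment_le assms(2)])
  from moments_close(2)[of ?S ?c ?m \<eta> ?f, OF c m assms(1) lower upper]
  show ?thesis unfolding mass conv[of "\<lambda>t. t ^ 2", symmetric] mult_1 .
qed

end

section \<open>The estimates at a single scale\<close>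

lemma finite_primes_upto [simp]: "finite (primes_upto w)"
proof (rule finite_subset)
  show "primes_upto w \<subseteq> {..nat \<lfloor>w\<rfloor>}" by (auto simp: primes_upto_def le_nat_floor)
qed simp

lemma finite_primes_between [simp]: "finite (primes_between u w)"
proof (rule finite_subset)
  show "primes_between u w \<subseteq> primes_upto w" by (auto simp: primes_between_def primes_upto_def)
qed simp

lemma of_nat_le_iff_le_nat_floor: "1 \<le> h \<Longrightarrow> real h \<le> x \<longleftrightarrow> h \<le> nat \<lfloor>x\<rfloor>"
  by (rule iffI[OF le_nat_floor]) linarith+

lemma primes_upto_split: "u \<le> w \<Longrightarrow> primes_upto u \<union> primes_between u w = primes_upto w"
  by (auto simp: primes_upto_def primes_between_def)

lemma (in sieve) sieve_scale_primes:
  assumes "w \<ge> 1" "L \<ge> 1" "real L < w" "4 * real L * B \<le> w"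
  shows "sieve_scale I B (primes_upto w) (primes_between w z) w L"
proof unfold_locales
  show "finite (primes_upto w)" "finite (primes_between w z)" by simp_all
qed (use assms in \<open>auto simp: primes_upto_def primes_between_def\<close>)

context sieve_scale
begin

lemma expect_shift_eq:
  assumes "A1 \<union> A2 = primes_upto z"
  shows "expect_shift I z f = E f"
proof -
  have P: "modulus I (primes_upto z) = P1 * P2" using modulus_Un assms by simp
  have "expect_shift I z f = (\<Sum>b\<in>{0..<P1 * P2}. f b) / real (card {0..<P1 * P2})"
    unfolding expect_shift_def P using P_pos by (intro integral_pmf_of_set) auto
  also have "real (card {0..<P1 * P2}) = real_of_int (P1 * P2)" using P_pos by simp
  finally show ?thesis by (simp only: E_def residue_mean_def)
qed

lemma random_S_eq:
  assumes "A1 \<union> A2 = primes_upto z"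
  shows "random_S I z b = S1 b \<inter> S2 b"
  unfolding random_S_def assms[symmetric] S1_def S2_def by (auto simp: mem_translate_sifted)

lemma lambda_weight_eq:
  assumes A: "A1 = primes_upto (H powr M)" "A2 = primes_between (H powr M) z" and L: "L = nat \<lfloor>real K * H\<rfloor>"
  shows "lambda_weight I M K z b H q n = lam b b q n"
proof -
  have S1: "random_S1 I M H b = S1 b"
    unfolding random_S1_def Let_def A(1)[symmetric] P1_def[symmetric] S1_def[symmetric] by (rule S_periodic)
  have S2: "random_S2 I M z H b = S2 b"
    unfolding random_S2_def Let_def A(2)[symmetric] P2_def[symmetric] S2_def[symmetric] by (rule S_periodic)
  have h: "(1 \<le> h \<and> real h \<le> real K * H) = (h \<in> {1..L})" for h
    using L of_nat_le_iff_le_nat_floor[of h] by auto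
  have "AP I M H b (real K * H) q n = V q n \<inter> S1 b"
    unfolding AP_def S1 V_def h by auto
  thus ?thesis by (simp add: lambda_weight_def Let_def S2 sigma2_def A(2)[symmetric] \<sigma>2_def[symmetric] lam_def)
qed

lemma q_moment_close:
  fixes N N0 \<eta> :: real and y K :: nat
  assumes A: "A1 = primes_upto (H powr M)" "A2 = primes_between (H powr M) z" "H powr M \<le> z"
    and L: "L = nat \<lfloor>real K * H\<rfloor>"
    and Q: "finite Q" "\<And>q. q \<in> Q \<Longrightarrow> prime q \<and> N0 < real q \<and> real q \<le> N"
    and N: "N0 > 1" "N > 0" "N \<le> w * N0" and \<eta>: "\<eta> \<ge> 0"
    and small: "(real L * B) ^ 2 * (24 / w) \<le> \<eta>" "err (2 * N / ln N0) 1 \<le> \<eta> * real (card Q)"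
      "err (real ((K + 1) * y)) 1 \<le> \<eta> * real ((K + 1) * y)"
      "2 * real L / \<sigma>2 ^ (2 * L) \<le> \<eta> * real ((K + 1) * y)"
    and j: "j \<in> {0, 1, 2}"
  shows "rel_close (2 * \<eta>) (q_moment I M K y z H Q j) (((real K + 1) * real y) ^ j * real (card Q))"
proof -
  let ?R = "{- (int K * int y)<..int y}"
  have R: "?R = {- (int K * int y)<..- (int K * int y) + int ((K + 1) * y)}" by (simp add: algebra_simps)
  have un: "A1 \<union> A2 = primes_upto z" using primes_upto_split[OF A(3)] A by simp
  have eq: "q_moment I M K y z H Q j = E (\<lambda>b. \<Sum>q\<in>Q. (\<Sum>n\<in>?R. lam b b q n) ^ j)" for j
    unfolding q_moment_def expect_shift_eq[OF un] lambda_weight_eq[OF A(1,2) L] ..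
  have Y: "(real K + 1) * real y = real ((K + 1) * y)" by (simp add: algebra_simps)
  note m = q_moments[OF Q N \<eta> small R]
  consider "j = 0" | "j = 1" | "j = 2" using j by blast
  thus ?thesis
  proof cases
    case 1
    have "E (\<lambda>b. \<Sum>q\<in>Q. (\<Sum>n\<in>?R. lam b b q n) ^ 0) = real (card Q)"
      unfolding E_def using PP_pos by (simp add: residue_mean_const)
    thus ?thesis unfolding eq 1 rel_close_def using \<eta> by simp
  next
    case 2
    show ?thesis unfolding eq 2 Y by (rule m(1))
  next
    case 3
    show ?thesis unfolding eq 3 Y by (rule m(2))
  qed
qed

lemma n_moment_close:
  fixes N N0 \<eta> :: real and y K :: nat
  assumes A: "A1 = primes_upto (H powr M)" "A2 = primes_between (H powr M) z" "H powr M \<le> z"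
    and L: "L = nat \<lfloor>real K * H\<rfloor>"
    and Q: "finite Q" "\<And>q. q \<in> Q \<Longrightarrow> prime q \<and> N0 < real q \<and> real q \<le> N" "\<And>q. q \<in> Q \<Longrightarrow> L < q"
    and N: "N0 > 1" "N > 0" "N \<le> w * N0" and \<eta>: "\<eta> \<ge> 0"
    and small: "(real L * B) ^ 2 * (24 / w) \<le> \<eta>" "err (2 * N / ln N0) 1 \<le> \<eta> * real (card Q)"
      "1 / \<sigma>2 ^ (2 * L) \<le> \<eta> * real (card Q)"
    and j: "j \<in> {0, 1, 2}"
  shows "rel_close (2 * \<eta>) (n_moment I M K y z H Q j)
     ((real (card Q) * real L / sigma2 I M z H) ^ j * (sieve_density I (primes_upto z) * real y))"
proof -
  have un: "A1 \<union> A2 = primes_upto z" using primes_upto_split[OF A(3)] A by simp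
  have h: "{h. 1 \<le> h \<and> real h \<le> real K * H} = {1..L}"
    using L of_nat_le_iff_le_nat_floor by auto
  have s: "sigma2 I M z H = \<sigma>2" "sieve_density I (primes_upto z) = \<sigma>1 * \<sigma>2"
    unfolding sigma2_def A(2)[symmetric] \<sigma>2_def[symmetric] un[symmetric] by (rule refl, rule density_Un)
  have eq: "n_moment I M K y z H Q j =
     E (\<lambda>b. \<Sum>n\<in>S1 b \<inter> S2 b \<inter> {1..int y}. (\<Sum>q\<in>Q. \<Sum>h\<in>{1..L}. lam b b q (n - int q * int h)) ^ j)" for j
    unfolding n_moment_def expect_shift_eq[OF un] lambda_weight_eq[OF A(1,2) L] random_S_eq[OF un] h ..
  note m = n_moments[OF Q N \<eta> small]
  consider "j = 0" | "j = 1" | "j = 2" using j by blast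
  thus ?thesis
  proof cases
    case 1
    have pos: "0 \<le> 2 * \<eta> * (\<sigma>1 * \<sigma>2 * real y)" using \<eta> \<sigma>1_pos \<sigma>2_bounds by simp
    \<comment> \<open>For \<open>j = 0\<close> the moment is the mean number of survivors, which is
      known exactly.\<close>
    have "n_moment I M K y z H Q j = \<sigma>1 * \<sigma>2 * real y" unfolding eq 1 using first_moment[of y] by simp
    thus ?thesis unfolding s rel_close_def 1 using pos by simp
  next
    case 2
    show ?thesis unfolding eq 2 s by (rule m(1))
  next
    case 3
    show ?thesis unfolding eq 3 s by (rule m(2))
  qed
qed

end

lemma rel_close_mono: "rel_close e a m \<Longrightarrow> e \<le> e' \<Longrightarrow> m \<ge> 0 \<Longrightarrow> rel_close e' a m"
  unfolding rel_close_def by (meson mult_right_mono order_trans)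

context sieve
begin

text \<open>Here \<open>l\<close> stands for \<open>ln x\<close>, and
  \<open>H ^ 2 / w = H powr (- (M - 2))\<close> is the unit of error. \<open>a1 * H ^ 2\<close>
  bounds the coefficient \<open>a\<close>, and \<open>s1\<close> bounds the exponent in
  \<open>err\<close> measured in that unit. In \<open>C0\<close> the first summand is the loss of
  the lower bound; in \<open>4 / c0 + 1\<close> the first term belongs to the prime count, measured
  against \<open>card Q\<close>, and the second to the interval count; the final 1 covers each
  remainder. The growth hypotheses \<open>E5\<close> and \<open>E6\<close> are for the remainders
  \<open>\<sigma>2 powr (- (a * B))\<close> and \<open>2 * L / \<sigma>2 ^ (2 * L)\<close>.\<close>

lemma moments_at_scale:
  fixes H M z \<xi> l c0 :: real and K y :: nat and Q :: "nat set"
  defines "a1 \<equiv> 8 * real K ^ 2 * exp (8 * real K ^ 2 * B)"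
  defines "s1 \<equiv> 24 * a1 * B ^ 2"
  defines "C0 \<equiv> 24 * real K ^ 2 * B ^ 2 + (4 / c0 + 1) * s1 * exp s1 + 1"
  assumes K: "K \<ge> 1" and M: "M \<ge> 2" and \<xi>: "\<xi> > 1" and c0: "c0 > 0"
    and H: "H \<ge> \<xi>" "H > real K" "4 * real K * B \<le> H" "H * ln l \<le> sqrt l" "H \<le> l"
    and l: "ln l \<ge> 1" "l \<ge> 4"
    and z: "exp (l / 2) \<le> z" "z \<le> real y / (\<xi> * H)" "l powr M \<le> exp (l / 2)"
    and \<sigma>: "sieve_density I (primes_upto z) \<ge> 1 / l ^ 2"
    and Q: "finite Q" "Q \<subseteq> primes_between (real y / (\<xi> * H)) (real y / H)"
    and cQ: "real (card Q) \<ge> c0 * (real y / H) / l"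
    and E5: "exp (2 * a1 * B * (l / ln l)) \<le> min 1 c0 / (l * l powr M) * exp (l / 2)"
    and E6: "2 * real K * l * exp (4 * real K * sqrt l) \<le> min 1 c0 / (l * l powr M) * exp (l / 2)"
    and j: "j \<in> {0, 1, 2}"
  shows "rel_close (2 * C0 * H powr (- (M - 2))) (q_moment I M K y z H Q j) (((real K + 1) * real y) ^ j * real (card Q))"
    and "rel_close (2 * C0 * H powr (- (M - 2))) (n_moment I M K y z H Q j)
     ((real (card Q) * real (nat \<lfloor>real K * H\<rfloor>) / sigma2 I M z H) ^ j * (sieve_density I (primes_upto z) * real y))"
proof -
  let ?m = "min 1 c0 * exp (l / 2) / l"
  define L where "L = nat \<lfloor>real K * H\<rfloor>"
  define w where "w = H powr M"
  define h2 where "h2 = H powr (- (M - 2))"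
  define N where "N = real y / H"
  define N0 where "N0 = real y / (\<xi> * H)"
  have H1: "H > 1" "H > 0" using H(1) \<xi> by auto
  have KR: "real K \<ge> 1" using K by simp
  have KH: "real K * H \<ge> 1" using KR H1 by (metis less_imp_le mult_mono mult_1 zero_le_one order_trans)
  have LKH: "real L \<le> real K * H" unfolding L_def using KH by simp
  have L1: "L \<ge> 1" unfolding L_def using KH by (simp add: le_nat_iff)
  have w_eq: "w * h2 = H ^ 2"
    unfolding w_def h2_def using H1 by (simp flip: powr_add)
  have h2_pos: "h2 > 0" unfolding h2_def using H1 by simp
  have h2_le: "h2 \<le> 1" unfolding h2_def using powr_mono[of "- (M - 2)" 0 H] H1 M by simp
  have H2w: "H ^ 2 \<le> w"
  proof -
    have "w * h2 \<le> w * 1" using h2_le by (intro mult_left_mono) (auto simp: w_def)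
    thus ?thesis using w_eq by simp
  qed
  have w_pos: "w > 0" unfolding w_def using H1 by simp
  have h2w: "H ^ 2 / w = h2" using w_eq w_pos by (simp add: field_simps)
  have HH: "H \<le> H ^ 2" using H1 by (simp add: power2_eq_square)
  have Lw: "real L < w"
  proof -
    have "real K * H < H * H" using H(2) H1 by (intro mult_strict_right_mono) auto
    thus ?thesis using LKH H2w by (simp add: power2_eq_square)
  qed
  have LB: "4 * real L * B \<le> w"
  proof -
    have "4 * real L * B \<le> 4 * (real K * H) * B" using LKH B_nonneg by (intro mult_right_mono) auto
    also have "\<dots> = (4 * real K * B) * H" by simp
    also have "\<dots> \<le> H * H" using H(3) H1 by (intro mult_right_mono) auto
    finally show ?thesis using H2w by (simp add: power2_eq_square)
  qed
  have w1: "w \<ge> 1" using H2w HH H1 by linarith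
  interpret sc: sieve_scale I B "primes_upto w" "primes_between w z" w L
    by (rule sieve_scale_primes[OF w1 L1 Lw LB])
  have wz: "w \<le> z"
  proof -
    have "w \<le> l powr M" unfolding w_def using H1 H(5) M by (intro powr_mono2) auto
    thus ?thesis using z by linarith
  qed
  have \<sigma>2: "sc.\<sigma>2 \<ge> 1 / l ^ 2"
  proof -
    have "sc.\<sigma>1 * sc.\<sigma>2 = sieve_density I (primes_upto z)"
      using sc.density_Un primes_upto_split[OF wz] by simp
    moreover have "sc.\<sigma>1 * sc.\<sigma>2 \<le> 1 * sc.\<sigma>2"
      using sieve_density_le_1[of "primes_upto w"] sc.\<sigma>2_bounds sc.primes1
      by (intro mult_right_mono) (auto simp: sc.\<sigma>1_def)
    ultimately show ?thesis using \<sigma> by linarith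
  qed
  have inv\<sigma>2: "1 / sc.\<sigma>2 \<le> l ^ 2" using \<sigma>2 sc.\<sigma>2_bounds l by (simp add: field_simps)
  have ln\<sigma>2: "- ln sc.\<sigma>2 \<le> 2 * ln l"
  proof -
    have "ln (1 / sc.\<sigma>2) \<le> ln (l ^ 2)" using inv\<sigma>2 sc.\<sigma>2_bounds l by (subst ln_le_cancel_iff) auto
    thus ?thesis using sc.\<sigma>2_bounds l by (simp add: ln_div ln_realpow)
  qed
  have h2_ge: "1 / l powr M \<le> h2"
  proof -
    have "1 / l powr M = l powr (- M)" by (simp add: powr_minus_divide)
    also have "\<dots> \<le> H powr (- M)" using H1 H(5) M by (intro powr_mono2') auto
    also have "\<dots> \<le> h2" unfolding h2_def using H1 by (intro powr_mono) auto
    finally show ?thesis .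
  qed
  \<comment> \<open>\<open>?m\<close> will be a common lower bound for \<open>card Q\<close> and
    \<open>(K + 1) * y\<close>, and \<open>H \<le> l\<close> gives
    \<open>h2 \<ge> 1 / l powr M\<close>; so the growth hypotheses bound the remainders by
    \<open>h2 * ?m\<close>.\<close>
  have E: "min 1 c0 / (l * l powr M) * exp (l / 2) \<le> h2 * ?m"
  proof -
    have "1 / l powr M * (?m) \<le> h2 * ?m"
      using h2_ge l c0 by (intro mult_right_mono) auto
    thus ?thesis by (simp add: mult_ac)
  qed
  have zN0: "z \<le> N0" unfolding N0_def by (rule z(2))
  have N0_large: "exp (l / 2) \<le> N0" using z(1) zN0 by linarith
  have expl: "exp (l / 2) > 1" using l by simp
  have N01: "N0 > 1" using N0_large expl by linarith
  have NN0: "N = \<xi> * N0" unfolding N_def N0_def using \<xi> by simp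
  have N_ge: "N0 \<le> N" unfolding NN0 using \<xi> N01 by simp
  have Npos: "N > 0" using N_ge N01 by linarith
  have NwN0: "N \<le> w * N0" unfolding NN0 using H(1) HH H2w N01 by (intro mult_right_mono) auto
  have yN: "N \<le> real y"
  proof -
    have "N * 1 \<le> N * H" using Npos H1 by (intro mult_left_mono) auto
    thus ?thesis unfolding N_def using H1 by simp
  qed
  have small1: "h2 * ?m \<le> h2 * real (card Q)"
  proof (rule mult_left_mono)
    have "min 1 c0 * exp (l / 2) \<le> c0 * N" using c0 N0_large N_ge by (intro mult_mono) auto
    hence "?m \<le> c0 * N / l" using l by (intro divide_right_mono) auto
    thus "?m \<le> real (card Q)" using cQ unfolding N_def by simp
  qed (use h2_pos in simp)
  have small2: "h2 * ?m \<le> h2 * real ((K + 1) * y)"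
  proof (rule mult_left_mono)
    have "?m \<le> 1 * exp (l / 2) / 1" using l c0 by (intro frac_le mult_right_mono) auto
    also have "\<dots> \<le> real y" using N0_large N_ge yN by simp
    also have "\<dots> \<le> real ((K + 1) * y)" by simp
    finally show "?m \<le> real ((K + 1) * y)" .
  qed (use h2_pos in simp)
  have lp: "l > 0" "ln l > 0" "sqrt l > 0" using l by auto
  have a_le: "sc.a \<le> a1 * H ^ 2"
  proof -
    have T: "sc.T \<le> 4 * real K ^ 2 * H ^ 2"
    proof -
      have "sc.T \<le> (2 * (real K * H)) ^ 2" unfolding sc.T_def using LKH by (intro power_mono) auto
      thus ?thesis by (simp add: power_mult_distrib)
    qed
    have "2 * sc.T * B / w \<le> 2 * (4 * real K ^ 2 * H ^ 2) * B / w"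
      using T B_nonneg w_pos by (intro divide_right_mono mult_right_mono mult_left_mono[OF T]) auto
    also have "\<dots> = 8 * real K ^ 2 * B * h2" unfolding h2w[symmetric] by simp
    also have "\<dots> \<le> 8 * real K ^ 2 * B" using h2_le B_nonneg by (simp add: mult_left_le)
    finally have "exp (2 * sc.T * B / w) \<le> exp (8 * real K ^ 2 * B)" by simp
    hence "sc.a \<le> 2 * (4 * real K ^ 2 * H ^ 2) * exp (8 * real K ^ 2 * B)"
      unfolding sc.a_def by (intro mult_mono mult_left_mono[OF T]) auto
    thus ?thesis by (simp add: a1_def mult_ac)
  qed
  have a1: "a1 \<ge> 0" by (simp add: a1_def)
  have s1: "s1 \<ge> 0" using a1 by (simp add: s1_def)
  have exps: "exp (sc.a * B ^ 2 * (24 / w)) - 1 \<le> s1 * exp s1 * h2"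
  proof -
    have "sc.a * B ^ 2 * (24 / w) \<le> a1 * H ^ 2 * B ^ 2 * (24 / w)"
      using a_le w_pos by (intro mult_right_mono) auto
    also have "\<dots> = s1 * h2" unfolding s1_def h2w[symmetric] by simp
    finally have 1: "sc.a * B ^ 2 * (24 / w) \<le> s1 * h2" .
    have "s1 * h2 \<le> s1" using h2_le s1 by (simp add: mult_left_le)
    hence "exp (s1 * h2) \<le> 1 + s1 * h2 * exp s1"
      using s1 h2_pos by (intro exp_le_one_plus_mult_exp) auto
    moreover have "exp (sc.a * B ^ 2 * (24 / w)) \<le> exp (s1 * h2)" using 1 by (simp only: exp_le_cancel_iff)
    moreover have "s1 * h2 * exp s1 = s1 * exp s1 * h2" by simp
    ultimately show ?thesis by linarith
  qed
  \<comment> \<open>\<open>H * ln l \<le> sqrt l\<close> gives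
    \<open>H ^ 2 * ln l \<le> l / ln l\<close>: here the upper end of the scales keeps the remainder
    below every fixed power of \<open>exp l\<close>.\<close>
  have Z: "sc.\<sigma>2 powr (- (sc.a * B)) \<le> h2 * ?m"
  proof -
    have "sc.\<sigma>2 powr (- (sc.a * B)) = exp (sc.a * B * (- ln sc.\<sigma>2))"
      using sc.\<sigma>2_bounds by (simp add: powr_def)
    also have "\<dots> \<le> exp (2 * a1 * B * (l / ln l))"
    proof -
      have "sc.a * B * (- ln sc.\<sigma>2) \<le> sc.a * B * (2 * ln l)"
        using ln\<sigma>2 sc.a_nonneg B_nonneg by (intro mult_left_mono) auto
      also have "\<dots> \<le> a1 * H ^ 2 * B * (2 * ln l)"
        using a_le B_nonneg lp by (intro mult_right_mono) auto
      also have "\<dots> = 2 * a1 * B * (H ^ 2 * ln l)" by simp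
      also have "\<dots> \<le> 2 * a1 * B * (l / ln l)"
      proof (rule mult_left_mono)
        have "(H * ln l) ^ 2 \<le> (sqrt l) ^ 2" using H(4) H1 lp by (intro power_mono) auto
        hence "H ^ 2 * ln l * ln l \<le> l" using lp by (simp add: power_mult_distrib power2_eq_square mult_ac)
        thus "H ^ 2 * ln l \<le> l / ln l" using lp by (simp add: pos_le_divide_eq)
      qed (use a1 B_nonneg in simp)
      finally show ?thesis by simp
    qed
    also note E5
    also note E
    finally show ?thesis .
  qed
  \<comment> \<open>The exponent is \<open>2 * L\<close>, of order \<open>H\<close> and not
    \<open>H ^ 2\<close>, so \<open>exp (O (sqrt l))\<close> results.\<close>
  have pow: "2 * real L / sc.\<sigma>2 ^ (2 * L) \<le> h2 * ?m"
  proof -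
    have Ll: "2 * real L \<le> 2 * real K * l"
    proof -
      have "real K * H \<le> real K * l" using H(5) by (intro mult_left_mono) auto
      thus ?thesis using LKH by simp
    qed
    have "1 / sc.\<sigma>2 ^ (2 * L) = exp (real (2 * L) * (- ln sc.\<sigma>2))"
    proof -
      have "exp (real (2 * L) * (- ln sc.\<sigma>2)) = exp (- ln sc.\<sigma>2) ^ (2 * L)" by (rule exp_of_nat_mult)
      also have "exp (- ln sc.\<sigma>2) = 1 / sc.\<sigma>2" using sc.\<sigma>2_bounds by (simp add: exp_minus inverse_eq_divide)
      finally show ?thesis by (simp add: power_one_over)
    qed
    also have "\<dots> \<le> exp (4 * real K * sqrt l)"
    proof -
      have "real (2 * L) * (- ln sc.\<sigma>2) \<le> real (2 * L) * (2 * ln l)" using ln\<sigma>2 by (intro mult_left_mono) auto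
      also have "\<dots> \<le> (2 * (real K * H)) * (2 * ln l)" using LKH lp by (intro mult_right_mono) auto
      also have "\<dots> = 4 * real K * (H * ln l)" by simp
      also have "\<dots> \<le> 4 * real K * sqrt l" using H(4) by (intro mult_left_mono) auto
      finally show ?thesis by simp
    qed
    finally have "2 * real L * (1 / sc.\<sigma>2 ^ (2 * L)) \<le> 2 * real K * l * exp (4 * real K * sqrt l)"
      by (rule mult_mono[OF Ll]) (use lp sc.\<sigma>2_bounds in auto)
    also note E6
    also note E
    finally show ?thesis by simp
  qed
  have pow': "1 / sc.\<sigma>2 ^ (2 * L) \<le> 2 * real L / sc.\<sigma>2 ^ (2 * L)"
    using sc.\<sigma>2_bounds L1 by (intro divide_right_mono) auto
  define \<eta> where "\<eta> = C0 * h2"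
  have \<eta>_parts: "24 * real K ^ 2 * B ^ 2 * h2 \<le> \<eta>" "((4 / c0) * s1 * exp s1 + 1) * h2 \<le> \<eta>"
     "(s1 * exp s1 + 1) * h2 \<le> \<eta>" "1 * h2 \<le> \<eta>"
  proof -
    have p: "0 \<le> 24 * real K ^ 2 * B ^ 2" "0 \<le> 4 / c0 * (s1 * exp s1)" "0 \<le> s1 * exp s1" using s1 c0 by simp_all
    have C0: "C0 = 24 * real K ^ 2 * B ^ 2 + 4 / c0 * (s1 * exp s1) + s1 * exp s1 + 1"
      unfolding C0_def by (simp only: distrib_right mult_1 mult.assoc add.assoc)
    show "24 * real K ^ 2 * B ^ 2 * h2 \<le> \<eta>" unfolding \<eta>_def C0 using p h2_pos by (intro mult_right_mono) linarith+
    show "((4 / c0) * s1 * exp s1 + 1) * h2 \<le> \<eta>" unfolding \<eta>_def C0 mult.assoc[of "4 / c0" s1] using p h2_pos by (intro mult_right_mono) linarith+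
    show "(s1 * exp s1 + 1) * h2 \<le> \<eta>" unfolding \<eta>_def C0 using p h2_pos by (intro mult_right_mono) linarith+
    show "1 * h2 \<le> \<eta>" unfolding \<eta>_def C0 using p h2_pos by (intro mult_right_mono) linarith+
  qed
  have \<eta>0: "\<eta> \<ge> 0" using \<eta>_parts(4) h2_pos by linarith
  have c1: "(real L * B) ^ 2 * (24 / w) \<le> \<eta>"
  proof -
    have "(real L * B) ^ 2 * (24 / w) \<le> (real K * H * B) ^ 2 * (24 / w)"
      using LKH B_nonneg w_pos by (intro mult_right_mono power_mono) auto
    also have "\<dots> = 24 * real K ^ 2 * B ^ 2 * h2" unfolding h2w[symmetric] by (simp add: power_mult_distrib)
    finally show ?thesis using \<eta>_parts(1) by linarith
  qed
  have c2: "sc.err (2 * N / ln N0) 1 \<le> \<eta> * real (card Q)"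
  proof -
    have lnN0: "ln N0 \<ge> l / 2"
    proof -
      have "ln (exp (l / 2)) \<le> ln N0" using N0_large by (subst ln_le_cancel_iff) (use N01 in auto)
      thus ?thesis by simp
    qed
    \<comment> \<open>The 4 in \<open>4 / c0\<close>: as \<open>N0 \<ge> exp (l / 2)\<close>, the
      prime count has the coefficient \<open>2 * N / ln N0 \<le> 4 * N / l\<close>.\<close>
    have "2 * N / ln N0 \<le> 2 * N / (l / 2)" using lnN0 Npos lp by (intro divide_left_mono) auto
    also have "\<dots> = (4 / c0) * (c0 * N / l)" using c0 lp by simp
    also have "\<dots> \<le> (4 / c0) * real (card Q)" using cQ c0 unfolding N_def by (intro mult_left_mono) auto
    finally have X: "2 * N / ln N0 \<le> (4 / c0) * real (card Q)" .
    have "sc.err (2 * N / ln N0) 1 \<le> (4 / c0) * real (card Q) * (s1 * exp s1 * h2) + h2 * real (card Q)"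
      unfolding sc.err_def
    proof (rule add_mono)
      have "0 \<le> s1 * exp s1 * h2" using s1 h2_pos by simp
      hence "2 * N / ln N0 * (exp (sc.a * B ^ 2 * (24 / w)) - 1) \<le> 2 * N / ln N0 * (s1 * exp s1 * h2)"
        using exps Npos N01 by (intro mult_left_mono) auto
      also have "\<dots> \<le> (4 / c0) * real (card Q) * (s1 * exp s1 * h2)"
        using X \<open>0 \<le> s1 * exp s1 * h2\<close> by (rule mult_right_mono)
      finally show "2 * N / ln N0 * (exp (sc.a * B ^ 2 * (24 / w)) - 1) \<le> (4 / c0) * real (card Q) * (s1 * exp s1 * h2)" .
      show "1 * sc.\<sigma>2 powr (- (sc.a * B)) \<le> h2 * real (card Q)" using Z small1 by linarith
    qed
    also have "\<dots> = ((4 / c0) * s1 * exp s1 + 1) * h2 * real (card Q)" by (simp add: algebra_simps)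
    also have "\<dots> \<le> \<eta> * real (card Q)" using \<eta>_parts(2) by (intro mult_right_mono) auto
    finally show ?thesis .
  qed
  have c3: "sc.err (real ((K + 1) * y)) 1 \<le> \<eta> * real ((K + 1) * y)"
  proof -
    let ?Y = "real ((K + 1) * y)"
    have "sc.err ?Y 1 \<le> ?Y * (s1 * exp s1 * h2) + h2 * ?Y"
      unfolding sc.err_def
    proof (rule add_mono)
      show "?Y * (exp (sc.a * B ^ 2 * (24 / w)) - 1) \<le> ?Y * (s1 * exp s1 * h2)"
        by (rule mult_left_mono[OF exps]) simp
      show "1 * sc.\<sigma>2 powr (- (sc.a * B)) \<le> h2 * ?Y" using Z small2 by linarith
    qed
    also have "\<dots> = (s1 * exp s1 + 1) * h2 * ?Y" by (simp only: distrib_left distrib_right mult_1 mult_ac)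
    also have "\<dots> \<le> \<eta> * ?Y" using \<eta>_parts(3) by (rule mult_right_mono) simp
    finally show ?thesis .
  qed
  have c4: "2 * real L / sc.\<sigma>2 ^ (2 * L) \<le> \<eta> * real ((K + 1) * y)"
  proof -
    have "h2 * real ((K + 1) * y) \<le> \<eta> * real ((K + 1) * y)" using \<eta>_parts(4) by (intro mult_right_mono) auto
    thus ?thesis using pow small2 by linarith
  qed
  have c5: "1 / sc.\<sigma>2 ^ (2 * L) \<le> \<eta> * real (card Q)"
  proof -
    have "h2 * real (card Q) \<le> \<eta> * real (card Q)" using \<eta>_parts(4) by (intro mult_right_mono) auto
    thus ?thesis using pow pow' small1 by linarith
  qed
  have Q': "prime q \<and> N0 < real q \<and> real q \<le> N" if "q \<in> Q" for q
    using that Q(2) by (auto simp: primes_between_def N_def N0_def)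
  have Lq: "L < q" if "q \<in> Q" for q
  proof -
    have "real L < real q" using Lw wz zN0 Q'[OF that] by linarith
    thus ?thesis by simp
  qed
  have \<eta>2: "2 * C0 * H powr (- (M - 2)) = 2 * \<eta>" by (simp add: \<eta>_def h2_def)
  have As: "primes_upto w = primes_upto (H powr M)" "primes_between w z = primes_between (H powr M) z" "H powr M \<le> z"
    using wz by (simp_all add: w_def)
  show "rel_close (2 * C0 * H powr (- (M - 2))) (q_moment I M K y z H Q j) (((real K + 1) * real y) ^ j * real (card Q))"
    unfolding \<eta>2 by (rule sc.q_moment_close[OF As L_def Q(1) Q' N01 Npos NwN0 \<eta>0 c1 c2 c3 c4 j])
  show "rel_close (2 * C0 * H powr (- (M - 2))) (n_moment I M K y z H Q j)
     ((real (card Q) * real (nat \<lfloor>real K * H\<rfloor>) / sigma2 I M z H) ^ j * (sieve_density I (primes_upto z) * real y))"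
    unfolding \<eta>2 L_def[symmetric] by (rule sc.n_moment_close[OF As L_def Q(1) Q' Lq N01 Npos NwN0 \<eta>0 c1 c2 c5 j])
qed

end

section \<open>Passage to the limit\<close>

context sieve
begin

text \<open>The primorial bound with \<open>16 \<le> exp 3\<close>; for the cut
  \<open>w = ln y / 8\<close> used below, the period is then at most
  \<open>y powr (3/8)\<close>.\<close>

lemma modulus_primes_upto_le:
  assumes "w \<ge> 0"
  shows "real_of_int (modulus I (primes_upto w)) \<le> exp (3 * w)"
proof -
  have eq: "primes_upto w = {p. prime p \<and> p \<le> nat \<lfloor>w\<rfloor>}"
    unfolding primes_upto_def using of_nat_le_iff_le_nat_floor prime_ge_1_nat by blast
  have "modulus I (primes_upto w) \<le> (\<Prod>p\<in>primes_upto w. int p)"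
    unfolding modulus_def
    by (intro zdvd_imp_le prod_dvd_prod_subset prod_pos) (auto simp: primes_upto_def prime_gt_0_nat finite_primes_upto[unfolded primes_upto_def])
  also have "\<dots> = int (\<Prod>{p. prime p \<and> p \<le> nat \<lfloor>w\<rfloor>})" by (simp add: eq)
  also have "\<dots> \<le> int (16 ^ nat \<lfloor>w\<rfloor>)" using primorial_le by (simp only: of_nat_le_iff)
  finally have "real_of_int (modulus I (primes_upto w)) \<le> real_of_int (int (16 ^ nat \<lfloor>w\<rfloor>))"
    by (simp only: of_int_le_iff)
  also have "\<dots> = 16 ^ nat \<lfloor>w\<rfloor>" by simp
  also have "\<dots> \<le> exp 3 ^ nat \<lfloor>w\<rfloor>"
  proof (rule power_mono)
    have "ln (16::real) = 4 * ln 2" using ln_realpow[of 2 4] by simp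
    hence "ln (16::real) \<le> 3" using ln2_le_25_over_36 by linarith
    hence "exp (ln (16::real)) \<le> exp 3" by (simp only: exp_le_cancel_iff)
    thus "(16::real) \<le> exp 3" by simp
  qed simp
  also have "\<dots> = exp (real (nat \<lfloor>w\<rfloor>) * 3)" by (rule exp_of_nat_mult[symmetric])
  also have "\<dots> \<le> exp (3 * w)" using assms by simp
  finally show ?thesis .
qed

text \<open>The cut \<open>w = t / 8\<close> balances two demands: the large primes cause an error
  \<open>O(1 / w)\<close>, and the period of the small ones must be a small power of
  \<open>y\<close>. With \<open>L = 1\<close> one has \<open>T = 4\<close>, and
  \<open>8 * B / w \<le> 1\<close> with \<open>exp 1 \<le> 3\<close> gives
  \<open>a \<le> 24\<close>; hence \<open>55296 = 4 * 3 * (24 * 24 * 8)\<close>, the 3 again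
  bounding \<open>exp 1\<close>. The 9 collects 3 from \<open>p\<close>, 4 from \<open>p * Z\<close>
  and 2 from the diagonal.\<close>

lemma count_moments_at_scale:
  fixes y :: nat and z l :: real
  defines "t \<equiv> ln (real y)"
  assumes t: "t \<ge> 16" "64 * B \<le> t" "4608 * B ^ 2 \<le> t" "t / 8 \<le> z" and l: "l \<ge> 1" "l \<le> t"
    and \<sigma>: "sieve_density I (primes_upto z) \<ge> 1 / l ^ 2"
    and X1: "exp (3 * t / 8) * t powr (48 * B) * t \<le> exp t" and X2: "t ^ 5 \<le> exp t"
  shows "expect_shift I z (\<lambda>b. real (card (random_S I z b \<inter> {1..int y}))) = sieve_density I (primes_upto z) * real y"
    and "rel_close ((9 + 55296 * B ^ 2) / t) (expect_shift I z (\<lambda>b. (real (card (random_S I z b \<inter> {1..int y})))\<^sup>2))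
           ((sieve_density I (primes_upto z) * real y)\<^sup>2)"
proof -
  define w where "w = t / 8"
  have w: "w \<ge> 2" "w \<le> z" "8 * B \<le> w" using t by (simp_all add: w_def)
  interpret sc: sieve_scale I B "primes_upto w" "primes_between w z" w 1
    by (rule sieve_scale_primes) (use w B_nonneg in auto)
  have un: "primes_upto w \<union> primes_between w z = primes_upto z" by (rule primes_upto_split[OF w(2)])
  have s: "sieve_density I (primes_upto z) = sc.\<sigma>1 * sc.\<sigma>2" using sc.density_Un un by simp
  show "expect_shift I z (\<lambda>b. real (card (random_S I z b \<inter> {1..int y}))) = sieve_density I (primes_upto z) * real y"
    unfolding sc.expect_shift_eq[OF un] sc.random_S_eq[OF un] s by (rule sc.first_moment)
  have y: "real y = exp t" "real y > 0"
  proof -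
    have "y \<noteq> 0"
    proof
      assume "y = 0"
      thus False using t by (simp add: t_def)
    qed
    thus "real y = exp t" "real y > 0" by (simp_all add: t_def)
  qed
  let ?s = "sc.\<sigma>1 * sc.\<sigma>2"
  have s1: "sc.\<sigma>1 \<le> 1" unfolding sc.\<sigma>1_def by (rule sieve_density_le_1) (rule sc.primes1)
  have s_le: "?s \<le> sc.\<sigma>2" using mult_right_mono[OF s1, of sc.\<sigma>2] sc.\<sigma>2_bounds by simp
  have s_ge: "?s \<ge> 1 / l ^ 2" using \<sigma> s by simp
  have s_pos: "?s > 0" using sc.\<sigma>1_pos sc.\<sigma>2_bounds by simp
  define p where "p = real_of_int sc.P1 / real y"
  have p0: "p \<ge> 0" using sc.P_pos y by (simp add: p_def)
  have a: "0 \<le> sc.a" "sc.a \<le> 24"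
  proof -
    show "0 \<le> sc.a" by (rule sc.a_nonneg)
    have T: "sc.T = 4" unfolding sc.T_def by simp
    have "2 * sc.T * B / w \<le> 1" unfolding T using w by simp
    hence "exp (2 * sc.T * B / w) \<le> exp 1" by (simp only: exp_le_cancel_iff)
    also have "\<dots> \<le> 3" by (rule exp_le)
    finally show "sc.a \<le> 24" unfolding sc.a_def T by simp
  qed
  define v where "v = exp (sc.a * B ^ 2 * (24 / w)) - 1"
  define Z where "Z = sc.\<sigma>2 powr (- (sc.a * B))"
  have v: "v \<le> 13824 * B ^ 2 / t"
  proof -
    have "sc.a * B ^ 2 * (24 / w) \<le> 24 * B ^ 2 * (24 / w)" using a w by (intro mult_right_mono) auto
    also have "\<dots> = 4608 * B ^ 2 / t" by (simp add: w_def)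
    finally have 1: "sc.a * B ^ 2 * (24 / w) \<le> 4608 * B ^ 2 / t" .
    have 2: "4608 * B ^ 2 / t \<le> 1" using t by simp
    have "exp (4608 * B ^ 2 / t) \<le> 1 + (4608 * B ^ 2 / t) * exp 1"
      by (rule exp_le_one_plus_mult_exp) (use 2 t in auto)
    also have "\<dots> \<le> 1 + (4608 * B ^ 2 / t) * 3" using t exp_le by (intro add_left_mono mult_left_mono) auto
    finally have "exp (4608 * B ^ 2 / t) \<le> 1 + 13824 * B ^ 2 / t" by simp
    moreover have "exp (sc.a * B ^ 2 * (24 / w)) \<le> exp (4608 * B ^ 2 / t)" using 1 by (simp only: exp_le_cancel_iff)
    ultimately show ?thesis unfolding v_def by linarith
  qed
  have v0: "v \<ge> 0" using a w by (simp add: v_def)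
  have Z1: "Z \<ge> 1"
  proof -
    have "sc.a * B * (- ln sc.\<sigma>2) \<ge> 0" using a B_nonneg sc.\<sigma>2_bounds by (intro mult_nonneg_nonneg) auto
    thus ?thesis using sc.\<sigma>2_bounds by (simp add: Z_def powr_def)
  qed
  \<comment> \<open>The exponent is \<open>2 * 24 * B\<close>, from
    \<open>\<sigma>2 \<ge> 1 / t ^ 2\<close> and \<open>a \<le> 24\<close>.\<close>
  have Zle: "Z \<le> t powr (48 * B)"
  proof -
    have "1 / t ^ 2 \<le> 1 / l ^ 2" using l by (intro divide_left_mono power_mono) auto
    hence \<sigma>2: "sc.\<sigma>2 \<ge> 1 / t ^ 2" using s_ge s_le by linarith
    hence "ln (1 / t ^ 2) \<le> ln sc.\<sigma>2" using t sc.\<sigma>2_bounds by (subst ln_le_cancel_iff) auto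
    hence "- ln sc.\<sigma>2 \<le> 2 * ln t" using t by (simp add: ln_div ln_realpow)
    hence "sc.a * B * (- ln sc.\<sigma>2) \<le> 24 * B * (2 * ln t)"
      using a B_nonneg sc.\<sigma>2_bounds by (intro mult_mono mult_right_mono) auto
    hence "exp (sc.a * B * (- ln sc.\<sigma>2)) \<le> exp (24 * B * (2 * ln t))" by (simp only: exp_le_cancel_iff)
    thus ?thesis using sc.\<sigma>2_bounds t by (simp add: Z_def powr_def)
  qed
  have pZ: "p * Z \<le> 1 / t"
  proof -
    have "real_of_int sc.P1 \<le> exp (3 * t / 8)"
    proof -
      have "3 * w = 3 * t / 8" by (simp add: w_def)
      moreover have "0 \<le> w" using w by simp
      ultimately show ?thesis using modulus_primes_upto_le[of w] unfolding sc.P1_def by (simp only:)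
    qed
    hence "real_of_int sc.P1 * Z * t \<le> exp (3 * t / 8) * t powr (48 * B) * t"
      using Zle Z1 t by (intro mult_right_mono mult_mono) auto
    also note X1
    finally have "real_of_int sc.P1 * Z * t \<le> real y" by (simp only: y)
    thus ?thesis using t y by (simp add: p_def field_simps)
  qed
  have p: "p \<le> 1 / t" using pZ mult_left_mono[OF Z1 p0] by simp
  have p1: "p \<le> 1" using p t by (simp add: order_trans)
  have P1: "real_of_int sc.P1 = real y * p" using y by (simp add: p_def)
  have err: "sc.err (real y) (real_of_int sc.P1) = real y * (v + p * Z)"
    unfolding sc.err_def v_def[symmetric] Z_def[symmetric] P1 by (simp add: distrib_left)
  define \<eta> where "\<eta> = (9 + 55296 * B ^ 2) / t / 2"
  have "?s ^ 2 * (real y + real_of_int sc.P1) * (real y + real_of_int sc.P1 + 2 * sc.err (real y) (real_of_int sc.P1))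
      + sc.\<sigma>1 * (real y + real_of_int sc.P1) \<le> (1 + 2 * \<eta>) * (?s * real y) ^ 2"
  proof -
    have "sc.\<sigma>1 * (real y + real_of_int sc.P1) \<le> 1 * (real y * 2)"
      unfolding P1 using s1 sc.\<sigma>1_pos p1 y p0 by (intro mult_mono) (auto simp: mult_left_le)
    also have "\<dots> \<le> (2 / t) * (?s * real y) ^ 2"
    proof -
      have "1 / t ^ 2 \<le> 1 / l ^ 2" using l by (intro divide_left_mono power_mono) auto
      hence "(1 / t ^ 2) ^ 2 \<le> ?s ^ 2" using s_ge by (intro power_mono) auto
      hence "1 / t ^ 4 \<le> ?s ^ 2" by (simp add: power_divide flip: power_mult)
      hence "(1 / t ^ 4) * real y \<le> ?s ^ 2 * real y" by (rule mult_right_mono) simp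
      moreover have "t \<le> (1 / t ^ 4) * real y"
      proof -
        have "t * t ^ 4 \<le> real y" using X2 y by (simp add: eval_nat_numeral)
        thus ?thesis using t by (simp add: field_simps)
      qed
      ultimately have "t \<le> ?s ^ 2 * real y" by linarith
      hence "t * real y \<le> ?s ^ 2 * real y * real y" using y by (intro mult_right_mono) auto
      hence "t * real y \<le> (?s * real y) ^ 2" by (simp only: power2_eq_square mult_ac)
      hence "(2 / t) * (t * real y) \<le> (2 / t) * (?s * real y) ^ 2" using t by (intro mult_left_mono) auto
      moreover have "(2 / t) * (t * real y) = 1 * (real y * 2)" using t by simp
      ultimately show ?thesis by (simp only:)
    qed
    finally have A: "sc.\<sigma>1 * (real y + real_of_int sc.P1) \<le> (2 / t) * (?s * real y) ^ 2" .
    have "(1 + p) * (1 + p + 2 * (v + p * Z)) \<le> 1 + 3 * p + 4 * (v + p * Z)"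
    proof -
      have "p * p \<le> p" "p * (v + p * Z) \<le> 1 * (v + p * Z)"
        using p0 p1 v0 Z1 by (simp_all add: mult_left_le mult_left_le_one_le)
      thus ?thesis by (simp add: algebra_simps)
    qed
    also have "\<dots> \<le> 1 + 3 * (1 / t) + 4 * (13824 * B ^ 2 / t + 1 / t)"
      using p v pZ by (intro add_mono mult_left_mono) auto
    also have "\<dots> = 1 + 2 * \<eta> - 2 / t" by (simp add: \<eta>_def add_divide_distrib)
    finally have B: "(1 + p) * (1 + p + 2 * (v + p * Z)) \<le> 1 + 2 * \<eta> - 2 / t" .
    have "?s ^ 2 * (real y + real_of_int sc.P1) * (real y + real_of_int sc.P1 + 2 * sc.err (real y) (real_of_int sc.P1))
      = (1 + p) * (1 + p + 2 * (v + p * Z)) * (?s * real y) ^ 2"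
      unfolding err unfolding P1 by (simp add: power2_eq_square algebra_simps)
    also have "\<dots> \<le> (1 + 2 * \<eta> - 2 / t) * (?s * real y) ^ 2" by (rule mult_right_mono[OF B]) simp
    finally have "?s ^ 2 * (real y + real_of_int sc.P1) * (real y + real_of_int sc.P1 + 2 * sc.err (real y) (real_of_int sc.P1))
      + sc.\<sigma>1 * (real y + real_of_int sc.P1) \<le> (1 + 2 * \<eta> - 2 / t) * (?s * real y) ^ 2 + (2 / t) * (?s * real y) ^ 2"
      using A by (rule add_mono)
    thus ?thesis by (simp only: distrib_right[symmetric] diff_add_cancel)
  qed
  moreover have "\<eta> \<ge> 0" using t by (simp add: \<eta>_def)
  ultimately have "rel_close (2 * \<eta>) (sc.E (\<lambda>b. (real (card (sc.S1 b \<inter> sc.S2 b \<inter> {1..int y}))) ^ 2)) ((?s * real y) ^ 2)"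
    by (intro sc.count_moments)
  moreover have "2 * \<eta> = (9 + 55296 * B ^ 2) / t" unfolding \<eta>_def mult_2 by (rule field_sum_of_halves)
  ultimately show "rel_close ((9 + 55296 * B ^ 2) / t) (expect_shift I z (\<lambda>b. (real (card (random_S I z b \<inter> {1..int y})))\<^sup>2))
           ((sieve_density I (primes_upto z) * real y)\<^sup>2)"
    unfolding sc.expect_shift_eq[OF un] sc.random_S_eq[OF un] s by (simp only:)
qed

end

text \<open>Passing from \<open>n\<close> to \<open>t\<close> changes the \<open>j\<close>-th power
  by a relative error of at most \<open>j / t\<close>, hence at most \<open>2 / t\<close>.\<close>

lemma rel_close_floor:
  fixes a c s t e h :: real and n j :: nat
  assumes "rel_close e a ((c * real n / d) ^ j * s)" and j: "j \<in> {0, 1, 2}"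
    and n: "real n \<le> t" "t \<le> real n + 1" and pos: "c \<ge> 0" "d > 0" "s \<ge> 0" "e \<ge> 0" "t > 0" and h: "2 / t \<le> h"
  shows "rel_close (e + h) a ((c * t / d) ^ j * s)"
proof -
  let ?m = "(c * real n / d) ^ j * s" and ?m' = "(c * t / d) ^ j * s"
  have h0: "h \<ge> 0" using h pos by (meson divide_nonneg_pos order_trans zero_le_numeral)
  have le: "?m \<le> ?m'" using n pos by (intro mult_right_mono power_mono divide_right_mono mult_left_mono) auto
  have m'0: "?m' \<ge> 0" using pos by simp
  have "t ^ j - real n ^ j \<le> h * t ^ j"
  proof -
    have "2 \<le> h * t" using h pos by (simp add: pos_divide_le_eq)
    moreover have "t ^ 2 - real n ^ 2 \<le> 2 * t"
    proof -
      have "(t - real n) * (t + real n) \<le> 1 * (2 * t)" using n by (intro mult_mono) auto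
      thus ?thesis by (simp add: power2_eq_square algebra_simps)
    qed
    moreover have "2 * t \<le> (h * t) * t" using \<open>2 \<le> h * t\<close> pos by (intro mult_right_mono) auto
    ultimately show ?thesis using j n h0 by (auto simp: power2_eq_square mult.assoc)
  qed
  hence "(c / d) ^ j * s * (t ^ j - real n ^ j) \<le> (c / d) ^ j * s * (h * t ^ j)" using pos by (intro mult_left_mono) auto
  hence "?m' - ?m \<le> h * ?m'" by (simp add: power_mult_distrib power_divide algebra_simps diff_divide_distrib)
  moreover have "\<bar>a - ?m\<bar> \<le> e * ?m'"
    using assms(1) mult_left_mono[OF le pos(4)] unfolding rel_close_def by linarith
  ultimately have "\<bar>a - ?m'\<bar> \<le> e * ?m' + h * ?m'" using le by linarith
  thus ?thesis unfolding rel_close_def by (simp only: distrib_right)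
qed

text \<open>Raising \<open>c\<close> to \<open>c + 1\<close> makes the coefficient strictly
  positive, so that the growth of the left side has one form even if \<open>c = 0\<close>. The same
  device serves \<open>eventually_exp_powr\<close>.\<close>

lemma eventually_exp_l_over_ln:
  assumes "c \<ge> 0" "d > 0" "M > 0"
  shows "\<forall>\<^sub>F l::real in at_top. exp (c * (l / ln l)) \<le> d / (l * l powr M) * exp (l / 2)"
proof -
  have "\<forall>\<^sub>F l::real in at_top. exp ((c + 1) * (l / ln l)) \<le> d / (l * l powr M) * exp (l / 2)"
    using assms by real_asymp
  moreover have "\<forall>\<^sub>F l::real in at_top. 0 \<le> l / ln l" by real_asymp
  ultimately show ?thesis
  proof eventually_elim
    case (elim l)
    have "c * (l / ln l) \<le> (c + 1) * (l / ln l)" using elim(2) by (intro mult_right_mono) auto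
    hence "exp (c * (l / ln l)) \<le> exp ((c + 1) * (l / ln l))" by (simp only: exp_le_cancel_iff)
    thus ?case using elim(1) by linarith
  qed
qed

lemma eventually_exp_sqrt:
  assumes "k > 0" "d > 0" "M > 0"
  shows "\<forall>\<^sub>F l::real in at_top. 2 * k * l * exp (4 * k * sqrt l) \<le> d / (l * l powr M) * exp (l / 2)"
  using assms by real_asymp

lemma eventually_exp_powr:
  assumes "c \<ge> 0"
  shows "\<forall>\<^sub>F t::real in at_top. exp (3 * t / 8) * t powr c * t \<le> exp t"
proof -
  have "\<forall>\<^sub>F t::real in at_top. exp (3 * t / 8) * t powr (c + 1) * t \<le> exp t" using assms by real_asymp
  moreover have "\<forall>\<^sub>F t::real in at_top. 1 \<le> t" by (rule eventually_ge_at_top)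
  ultimately show ?thesis
  proof eventually_elim
    case (elim t)
    have "exp (3 * t / 8) * t powr c * t \<le> exp (3 * t / 8) * t powr (c + 1) * t"
      using elim(2) by (intro mult_right_mono mult_left_mono powr_mono) auto
    thus ?case using elim(1) by linarith
  qed
qed

text \<open>The crude bound \<open>x ^ 2\<close> suffices for
  \<open>ln y \<le> 2 * ln x\<close>.\<close>

lemma y_of_bounds:
  assumes "\<delta> > 0" "\<delta> < 1"
  shows "\<forall>\<^sub>F x in at_top. x * ln x powr \<delta> \<le> real (y_of \<delta> x) \<and> x \<le> real (y_of \<delta> x) \<and> real (y_of \<delta> x) \<le> x ^ 2"
proof -
  have "\<forall>\<^sub>F x::real in at_top. x \<le> x * ln x powr \<delta>" using assms by real_asymp
  moreover have "\<forall>\<^sub>F x::real in at_top. x * ln x powr \<delta> + 1 \<le> x ^ 2" using assms by real_asymp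
  moreover have "\<forall>\<^sub>F x::real in at_top. 0 \<le> x" by (rule eventually_ge_at_top)
  ultimately show ?thesis
  proof eventually_elim
    case (elim x)
    have "real (y_of \<delta> x) = of_int \<lceil>x * ln x powr \<delta>\<rceil>" using elim by (simp add: y_of_def)
    moreover have "of_int \<lceil>x * ln x powr \<delta>\<rceil> \<ge> x * ln x powr \<delta>" "of_int \<lceil>x * ln x powr \<delta>\<rceil> \<le> x * ln x powr \<delta> + 1"
      by linarith+
    ultimately show ?case using elim by linarith
  qed
qed

lemma asymp_equiv_eventually_half_le:
  fixes f g :: "real \<Rightarrow> real"
  assumes "f \<sim>[F] g"
  shows "\<forall>\<^sub>F x in F. \<bar>g x\<bar> \<le> 2 * \<bar>f x\<bar>"
  using asymp_equiv_imp_eventually_le[OF asymp_equiv_symI[OF assms], of 2] by simp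

lemma eventually_at_ln:
  "(\<forall>\<^sub>F l in at_top. P l) \<Longrightarrow> (\<forall>\<^sub>F x::real in at_top. P (ln x))"
  by (erule eventually_compose_filterlim) (rule ln_at_top)

text \<open>The two ends of the range of scales in terms of \<open>l = ln x\<close>. The lower end
  grows with \<open>l\<close>; the upper end becomes \<open>H * ln l \<le> sqrt l\<close> because
  \<open>z / y = ln l / sqrt l\<close>, a factor \<open>\<xi>\<close> being given away.\<close>

lemma scales_bounds:
  fixes \<delta> \<xi> x H :: real
  defines "l \<equiv> ln x"
  assumes H: "H \<in> scales \<delta> \<xi> x" and x: "x > 0" and \<xi>: "\<xi> > 1" and l: "l > 0" "ln l > 0"
    and y: "x * l powr \<delta> \<le> real (y_of \<delta> x)" "0 < real (y_of \<delta> x)"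
  shows "2 * l powr \<delta> \<le> H" and "H * ln l \<le> sqrt l" and "z_of \<delta> x \<le> real (y_of \<delta> x) / (\<xi> * H)"
proof -
  let ?y = "real (y_of \<delta> x)" and ?z = "z_of \<delta> x"
  have z: "?z = ?y * ln l / sqrt l" using l by (simp add: z_of_def l_def powr_half_sqrt)
  have zp: "?z > 0" unfolding z using y l by simp
  have H: "2 * ?y / x \<le> H" "H \<le> ?y / (\<xi> * ?z)" using H by (auto simp: scales_def)
  have "2 * (x * l powr \<delta>) / x \<le> 2 * ?y / x" using y x by (intro divide_right_mono mult_left_mono) auto
  thus lo: "2 * l powr \<delta> \<le> H" using H(1) x by simp
  have Hp: "H > 0" using lo l by (smt (verit) powr_gt_zero)
  have le: "H * (\<xi> * ?z) \<le> ?y" using H(2) zp \<xi> by (subst (asm) pos_le_divide_eq) auto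
  thus "?z \<le> ?y / (\<xi> * H)" using Hp \<xi> by (subst pos_le_divide_eq) (auto simp: mult_ac)
  have "H * ?z \<le> ?y"
  proof -
    have "H * (1 * ?z) \<le> H * (\<xi> * ?z)" using Hp zp \<xi> by (intro mult_left_mono mult_right_mono) auto
    thus ?thesis using le by simp
  qed
  hence "?y * (H * ln l) \<le> ?y * sqrt l" unfolding z using l by (simp add: field_simps)
  thus "H * ln l \<le> sqrt l" using y(2) by simp
qed

text \<open>The constant is chosen before the system and the sets \<open>Q x H\<close>, so it is
  uniform in both; only the threshold for \<open>x\<close> depends on them. In (iii) the inner sum
  has exactly \<open>\<lfloor>K * H\<rfloor>\<close> terms \<open>h\<close>. Writing
  \<open>K * H\<close> instead costs a relative error of order \<open>1 / H\<close>, which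
  \<open>H powr (- (M - 2))\<close> absorbs when \<open>M \<le> 3\<close>, and no error when
  \<open>K * H\<close> is an integer. The main term is therefore given with the floor in general and
  with \<open>K * H\<close> itself in these two cases.\<close>

theorem theorem4p1:
  fixes B C\<^sub>1 \<rho> \<delta> \<xi> M :: real and K :: nat
  assumes "0 < \<delta>" and "\<delta> < 1/2"
    and "(4 + \<delta>) * 10 powr (2 * \<delta>) / ln (1 / (2 * \<delta>)) < \<rho>"
    and "K \<ge> 2" and "\<xi> > 1" and "M \<ge> 2"
  shows "\<exists>C>0. \<forall>I Q.
    sieving_system I \<and> non_degenerate I \<and> bounded_by B I \<and>
    one_dimensional C\<^sub>1 I \<and> supported \<rho> I \<and> admissible_choice \<rho> \<delta> \<xi> I Q \<longrightarrow>
    (\<forall>\<^sub>F x in at_top.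
      let y = y_of \<delta> x; z = z_of \<delta> x; \<sigma> = sieve_density I (primes_upto z) in
      expect_shift I z (\<lambda>b. real (card (random_S I z b \<inter> {1..int y}))) = \<sigma> * real y \<and>
      rel_close (C / ln (real y))
        (expect_shift I z (\<lambda>b. (real (card (random_S I z b \<inter> {1..int y})))\<^sup>2))
        ((\<sigma> * real y)\<^sup>2) \<and>
      (\<forall>H \<in> scales \<delta> \<xi> x. \<forall>j \<in> {0, 1, 2}.
        rel_close (C * H powr (- (M - 2)))
          (q_moment I M K y z H (Q x H) j)
          (((real K + 1) * real y) ^ j * real (card (Q x H)))) \<and>
      (\<forall>H \<in> scales \<delta> \<xi> x. \<forall>j \<in> {0, 1, 2}.
        rel_close (C * H powr (- (M - 2)))
          (n_moment I M K y z H (Q x H) j)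
          ((real (card (Q x H)) * real_of_int \<lfloor>real K * H\<rfloor> / sigma2 I M z H) ^ j
            * (\<sigma> * real y)) \<and>
        (M \<le> 3 \<or> real K * H \<in> \<int> \<longrightarrow>
          rel_close (C * H powr (- (M - 2)))
            (n_moment I M K y z H (Q x H) j)
            ((real (card (Q x H)) * (real K * H) / sigma2 I M z H) ^ j * (\<sigma> * real y)))))"
proof -
  note \<delta> = assms(1,2) and K = assms(4) and \<xi> = assms(5) and M = assms(6)
  \<comment> \<open>\<open>\<rho> > 0\<close> is drawn from the parameter inequality because
    \<open>c0\<close>, and with it \<open>C\<close>, is fixed before any system is given.\<close>
  have "0 < (4 + \<delta>) * 10 powr (2 * \<delta>) / ln (1 / (2 * \<delta>))" using \<delta> by (intro divide_pos_pos mult_pos_pos ln_gt_zero) auto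
  hence \<rho>: "\<rho> > 0" using assms(3) by linarith
  \<comment> \<open>Half the constant in the asymptotic size of \<open>Q x H\<close>, which is used
    with \<open>\<epsilon> = 1/2\<close>.\<close>
  define c0 where "c0 = \<rho> * (1 - 1 / \<xi>) / 2"
  define a1 where "a1 = 8 * real K ^ 2 * exp (8 * real K ^ 2 * B)"
  define s1 where "s1 = 24 * a1 * B ^ 2"
  define C0 where "C0 = 24 * real K ^ 2 * B ^ 2 + (4 / c0 + 1) * s1 * exp s1 + 1"
  \<comment> \<open>The constants of (i) and of (ii), (iii) are added; the last 1 pays for replacing
    the floor of \<open>K * H\<close>.\<close>
  define C where "C = (9 + 55296 * B ^ 2) + (2 * C0 + 1)"
  have c0: "c0 > 0" unfolding c0_def using \<rho> \<xi> by simp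
  have a1: "a1 \<ge> 0" and s1: "s1 \<ge> 0" by (simp_all add: a1_def s1_def)
  have C0: "C0 > 0" unfolding C0_def using s1 c0 by (intro add_nonneg_pos add_nonneg_nonneg mult_nonneg_nonneg) auto
  have C: "C > 0" "9 + 55296 * B ^ 2 \<le> C" "2 * C0 \<le> C" "2 * C0 + 1 \<le> C"
  proof -
    have "0 \<le> 55296 * B ^ 2" by simp
    thus "C > 0" "9 + 55296 * B ^ 2 \<le> C" "2 * C0 \<le> C" "2 * C0 + 1 \<le> C" unfolding C_def using C0 by linarith+
  qed
  show ?thesis
  proof (rule exI[of _ C], rule conjI[OF C(1)], intro allI impI, elim conjE, goal_cases)
    case (1 I Q)
    note I = 1(1-3) and od = 1(4) and Q = 1(6)
    interpret sieve I B by unfold_locales (rule I)+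
    have C1: "C\<^sub>1 > 0" using od by (simp add: one_dimensional_def)
    have aB: "2 * a1 * B \<ge> 0" using a1 B_nonneg by simp
    let ?y = "\<lambda>x. real (y_of \<delta> x)" and ?z = "z_of \<delta>"
    have ev_y: "\<forall>\<^sub>F x in at_top. x * ln x powr \<delta> \<le> ?y x \<and> x \<le> ?y x \<and> ?y x \<le> x ^ 2"
      using \<delta> by (intro y_of_bounds) auto
    have ev_x: "\<forall>\<^sub>F x::real in at_top. 1 < x" by (rule eventually_gt_at_top)
    have l1: "\<forall>\<^sub>F l::real in at_top. 4 \<le> l" "\<forall>\<^sub>F l::real in at_top. 4 / C\<^sub>1 \<le> l" by (rule eventually_ge_at_top)+
    have l2: "\<forall>\<^sub>F l::real in at_top. 1 \<le> ln l" by real_asymp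
    have l3: "\<forall>\<^sub>F l::real in at_top. l powr M \<le> exp (l / 2)" using M by real_asymp
    have l4: "\<forall>\<^sub>F l::real in at_top. exp (l / 2) \<le> exp l * ln l / sqrt l" by real_asymp
    have l5: "\<forall>\<^sub>F l::real in at_top. ln l \<le> sqrt l" by real_asymp
    \<comment> \<open>\<open>2 * l powr \<delta>\<close> is a lower bound for all scales; exceeding
      this sum gives every lower bound on \<open>H\<close> at once.\<close>
    have l6: "\<forall>\<^sub>F l::real in at_top. \<xi> + real K + 1 + 4 * real K * B \<le> 2 * l powr \<delta>" using \<delta>(1) by real_asymp
    have l7: "\<forall>\<^sub>F l::real in at_top. l / 4 \<le> exp (l / 2)" by real_asymp
    have l8: "\<forall>\<^sub>F l in at_top. exp (2 * a1 * B * (l / ln l)) \<le> min 1 c0 / (l * l powr M) * exp (l / 2)"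
      using aB c0 M by (intro eventually_exp_l_over_ln) auto
    have l9: "\<forall>\<^sub>F l in at_top. 2 * real K * l * exp (4 * real K * sqrt l) \<le> min 1 c0 / (l * l powr M) * exp (l / 2)"
      using K c0 M by (intro eventually_exp_sqrt) auto
    note ev_l = l1[THEN eventually_at_ln] l2[THEN eventually_at_ln] l3[THEN eventually_at_ln] l4[THEN eventually_at_ln]
      l5[THEN eventually_at_ln] l6[THEN eventually_at_ln] l7[THEN eventually_at_ln] l8[THEN eventually_at_ln] l9[THEN eventually_at_ln]
    have ln_y: "filterlim (\<lambda>x. ln (?y x)) at_top at_top"
    proof (rule filterlim_at_top_mono[OF ln_at_top])
      show "\<forall>\<^sub>F x in at_top. ln x \<le> ln (?y x)"
        using ev_y ev_x by eventually_elim (auto intro: ln_mono)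
    qed
    have t1: "\<forall>\<^sub>F t::real in at_top. 16 \<le> t" "\<forall>\<^sub>F t::real in at_top. 64 * B \<le> t" "\<forall>\<^sub>F t::real in at_top. 4608 * B ^ 2 \<le> t"
      by (rule eventually_ge_at_top)+
    have t2: "\<forall>\<^sub>F t::real in at_top. exp (3 * t / 8) * t powr (48 * B) * t \<le> exp t"
      using B_nonneg by (intro eventually_exp_powr) auto
    have t3: "\<forall>\<^sub>F t::real in at_top. t ^ 5 \<le> exp t" by real_asymp
    note ev_t = t1[THEN eventually_compose_filterlim[OF _ ln_y]] t2[THEN eventually_compose_filterlim[OF _ ln_y]]
      t3[THEN eventually_compose_filterlim[OF _ ln_y]]
    have z_eq: "?z x = ?y x * ln (ln x) / sqrt (ln x)" if "4 \<le> ln x" for x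
      using that by (simp add: z_of_def powr_half_sqrt)
    \<comment> \<open>A bound as weak as \<open>sqrt x\<close> suffices, since the remainders to be
      beaten are \<open>exp (O (l / ln l))\<close> and \<open>exp (O (sqrt l))\<close>.\<close>
    have ev_z: "\<forall>\<^sub>F x in at_top. exp (ln x / 2) \<le> ?z x"
      using ev_y ev_x ev_l(1) ev_l(3) ev_l(5)
    proof eventually_elim
      case (elim x)
      have "exp (ln x) = x" using elim by simp
      hence "exp (ln x / 2) \<le> x * ln (ln x) / sqrt (ln x)" using elim by (simp only:)
      also have "\<dots> \<le> ?y x * ln (ln x) / sqrt (ln x)" using elim by (intro divide_right_mono mult_right_mono) auto
      finally show ?case using z_eq elim by simp
    qed
    have z_lim: "filterlim ?z at_top at_top"
      by (rule filterlim_at_top_mono[OF _ ev_z]) real_asymp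
    have "\<forall>\<^sub>F w in at_top. \<bar>C\<^sub>1 / ln w\<bar> \<le> 2 * \<bar>sieve_density I (primes_upto w)\<bar>"
      using od by (intro asymp_equiv_eventually_half_le) (simp add: one_dimensional_def)
    from eventually_compose_filterlim[OF this z_lim]
    have ev_\<sigma>: "\<forall>\<^sub>F x in at_top. \<bar>C\<^sub>1 / ln (?z x)\<bar> \<le> 2 * \<bar>sieve_density I (primes_upto (?z x))\<bar>" .
    have ev_Q: "\<forall>\<^sub>F x in at_top. \<forall>H \<in> scales \<delta> \<xi> x.
        \<bar>real (card (Q x H)) - \<rho> * (1 - 1/\<xi>) * ?y x / (H * ln x)\<bar> \<le> (1/2) * (\<rho> * (1 - 1/\<xi>) * ?y x / (H * ln x))"
      using conjunct2[OF Q[unfolded admissible_choice_def], THEN spec, of "1/2"] by (rule mp) simp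
    show ?case
      using ev_y ev_x ev_l ev_t ev_z ev_\<sigma> ev_Q
    proof eventually_elim
      case (elim x)
      define y where "y = y_of \<delta> x"
      define z where "z = z_of \<delta> x"
      define l where "l = ln x"
      define t where "t = ln (real y)"
      define \<sigma> where "\<sigma> = sieve_density I (primes_upto z)"
      note el = elim[folded y_def z_def l_def, folded t_def, folded \<sigma>_def]
      have x: "x > 1" and y: "x * l powr \<delta> \<le> real y" "x \<le> real y" "real y \<le> x ^ 2" using el(1,2) by auto
      have l: "4 \<le> l" "1 \<le> ln l" "l > 0" "ln l > 0" "sqrt l > 0" using el(3,5) by auto
      have lt: "l \<le> t" unfolding l_def t_def using x y by (intro ln_mono) auto
      have t2l: "t \<le> 2 * l"
      proof -
        have "t \<le> ln (x ^ 2)" unfolding t_def using x y by (intro ln_mono) auto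
        thus ?thesis using x by (simp add: l_def ln_realpow)
      qed
      have zl: "exp (l / 2) \<le> z" by (rule el(18))
      have tz: "t / 8 \<le> z"
      proof -
        have "l / 4 \<le> exp (l / 2)" by (rule el(10))
        thus ?thesis using t2l zl by linarith
      qed
      have z: "z = real y * ln l / sqrt l" using z_eq l by (simp add: z_def y_def l_def)
      \<comment> \<open>Since \<open>ln z \<le> 2 * l\<close>, one-dimensionality up to a factor 2
        gives \<open>\<sigma> \<ge> C\<^sub>1 / (4 * l)\<close>. Weakening this to
        \<open>1 / l ^ 2\<close> once \<open>l \<ge> 4 / C\<^sub>1\<close> keeps
        \<open>C\<^sub>1\<close> out of the constants.\<close>
      have \<sigma>_ge: "1 / l ^ 2 \<le> \<sigma>"
      proof -
        have "ln l / sqrt l \<le> 1" using el(8) l by (simp add: pos_divide_le_eq)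
        hence "z \<le> real y" unfolding z using mult_left_mono[of "ln l / sqrt l" 1 "real y"] by simp
        moreover have z0: "z > 1" using zl l by (smt (verit) one_less_exp_iff half_gt_zero)
        ultimately have "ln z \<le> t" unfolding t_def by (intro ln_mono) auto
        hence lnz: "ln z \<le> 2 * l" "ln z > 0" using t2l z0 by auto
        have "1 / l ^ 2 \<le> C\<^sub>1 / (4 * l)" using el(4) l C1 by (simp add: field_simps power2_eq_square)
        also have "\<dots> = C\<^sub>1 / (2 * l) / 2" by simp
        also have "\<dots> \<le> C\<^sub>1 / ln z / 2" using lnz C1 by (intro divide_right_mono divide_left_mono) auto
        also have "\<dots> \<le> \<bar>\<sigma>\<bar>" using el(19) C1 lnz by simp
        also have "\<bar>\<sigma>\<bar> = \<sigma>" unfolding \<sigma>_def using sieve_density_pos[of "primes_upto z"] by (simp add: primes_upto_def)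
        finally show ?thesis .
      qed
      have \<sigma>0: "\<sigma> \<ge> 0" using \<sigma>_ge l by (meson order_trans zero_le_divide_1_iff zero_le_power2)
      have count: "expect_shift I z (\<lambda>b. real (card (random_S I z b \<inter> {1..int y}))) = \<sigma> * real y"
        "rel_close (C / t) (expect_shift I z (\<lambda>b. (real (card (random_S I z b \<inter> {1..int y})))\<^sup>2)) ((\<sigma> * real y)\<^sup>2)"
      proof -
        have h: "16 \<le> ln (real y)" "64 * B \<le> ln (real y)" "4608 * B ^ 2 \<le> ln (real y)" "ln (real y) / 8 \<le> z"
          "1 \<le> l" "l \<le> ln (real y)"
          "exp (3 * ln (real y) / 8) * ln (real y) powr (48 * B) * ln (real y) \<le> exp (ln (real y))"
          "ln (real y) ^ 5 \<le> exp (ln (real y))"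
          using el(13-17) tz lt l unfolding t_def by linarith+
        note c = count_moments_at_scale[OF h(1-6) \<sigma>_ge[unfolded \<sigma>_def] h(7,8), folded \<sigma>_def t_def]
        show "expect_shift I z (\<lambda>b. real (card (random_S I z b \<inter> {1..int y}))) = \<sigma> * real y" by (rule c(1))
        have "(9 + 55296 * B ^ 2) / t \<le> C / t" using C lt l by (intro divide_right_mono) auto
        thus "rel_close (C / t) (expect_shift I z (\<lambda>b. (real (card (random_S I z b \<inter> {1..int y})))\<^sup>2)) ((\<sigma> * real y)\<^sup>2)"
          by (rule rel_close_mono[OF c(2)]) simp
      qed
      have scale: "rel_close (C * H powr (- (M - 2))) (q_moment I M K y z H (Q x H) j) (((real K + 1) * real y) ^ j * real (card (Q x H)))"
        "rel_close (C * H powr (- (M - 2))) (n_moment I M K y z H (Q x H) j)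
          ((real (card (Q x H)) * real_of_int \<lfloor>real K * H\<rfloor> / sigma2 I M z H) ^ j * (\<sigma> * real y))"
        "M \<le> 3 \<or> real K * H \<in> \<int> \<Longrightarrow>
          rel_close (C * H powr (- (M - 2))) (n_moment I M K y z H (Q x H) j)
            ((real (card (Q x H)) * (real K * H) / sigma2 I M z H) ^ j * (\<sigma> * real y))"
        if H: "H \<in> scales \<delta> \<xi> x" and j: "j \<in> {0, 1, 2}" for H j
      proof -
        have yp: "0 < real y" using x y by linarith
        have xp: "0 < x" using x by simp
        note sb = scales_bounds[OF H xp \<xi>, folded l_def y_def z_def, OF l(3,4) y(1) yp]
        have h0: "\<xi> + real K + 1 + 4 * real K * B \<le> H" using sb(1) el(9) by linarith
        have KB: "0 \<le> 4 * real K * B" using B_nonneg by simp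
        have H1: "\<xi> \<le> H" "real K < H" "4 * real K * B \<le> H" using h0 KB \<xi> by linarith+
        have H2: "H > 1" using H1 \<xi> by linarith
        have Hl: "H \<le> l"
        proof -
          have "H * 1 \<le> H * ln l" using l H2 by (intro mult_left_mono) auto
          hence "H \<le> sqrt l" using sb(2) by simp
          also have "sqrt l \<le> l" by (rule real_le_lsqrt) (use l self_le_power[of l 2] in auto)
          finally show ?thesis .
        qed
        have Qsub: "Q x H \<subseteq> primes_between (real y / (\<xi> * H)) (real y / H)"
          using Q H unfolding admissible_choice_def y_def by blast
        have finQ: "finite (Q x H)" by (rule finite_subset[OF Qsub]) simp
        have cQ: "c0 * (real y / H) / l \<le> real (card (Q x H))"
        proof -
          have "\<bar>real (card (Q x H)) - \<rho> * (1 - 1/\<xi>) * real y / (H * l)\<bar> \<le> (1/2) * (\<rho> * (1 - 1/\<xi>) * real y / (H * l))"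
            using elim(20) H unfolding y_def l_def by blast
          hence "(1/2) * (\<rho> * (1 - 1/\<xi>) * real y / (H * l)) \<le> real (card (Q x H))" by linarith
          thus ?thesis by (simp add: c0_def)
        qed
        have E: "l powr M \<le> exp (l / 2)"
          "exp (2 * a1 * B * (l / ln l)) \<le> min 1 c0 / (l * l powr M) * exp (l / 2)"
          "2 * real K * l * exp (4 * real K * sqrt l) \<le> min 1 c0 / (l * l powr M) * exp (l / 2)"
          by (rule el(6) el(11) el(12))+
        have K1: "K \<ge> 1" using K by simp
        note m = moments_at_scale[OF K1 M \<xi> c0 H1 sb(2) Hl l(2) l(1) zl sb(3) E(1) \<sigma>_ge[unfolded \<sigma>_def] finQ Qsub cQ,
            folded a1_def, folded s1_def, folded C0_def, OF E(2,3) j, folded \<sigma>_def]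
        have h2: "H powr (- (M - 2)) \<ge> 0" by simp
        have s2: "sigma2 I M z H > 0" unfolding sigma2_def by (rule sieve_density_pos) (simp add: primes_between_def)
        have KH: "real K * H > 0" using K H2 by simp
        have fl: "real_of_int \<lfloor>real K * H\<rfloor> = real (nat \<lfloor>real K * H\<rfloor>)" using KH by simp
        have C2: "2 * C0 * H powr (- (M - 2)) \<le> C * H powr (- (M - 2))"
          "(2 * C0 + 1) * H powr (- (M - 2)) \<le> C * H powr (- (M - 2))" by (rule mult_right_mono[OF C(3) h2], rule mult_right_mono[OF C(4) h2])
        show "rel_close (C * H powr (- (M - 2))) (q_moment I M K y z H (Q x H) j) (((real K + 1) * real y) ^ j * real (card (Q x H)))"
          by (rule rel_close_mono[OF m(1) C2(1)]) simp
        show n: "rel_close (C * H powr (- (M - 2))) (n_moment I M K y z H (Q x H) j)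
          ((real (card (Q x H)) * real_of_int \<lfloor>real K * H\<rfloor> / sigma2 I M z H) ^ j * (\<sigma> * real y))"
          unfolding fl using s2 \<sigma>0 by (intro rel_close_mono[OF m(2) C2(1)]) simp
        assume "M \<le> 3 \<or> real K * H \<in> \<int>"
        thus "rel_close (C * H powr (- (M - 2))) (n_moment I M K y z H (Q x H) j)
            ((real (card (Q x H)) * (real K * H) / sigma2 I M z H) ^ j * (\<sigma> * real y))"
        proof
          assume "real K * H \<in> \<int>"
          hence "real_of_int \<lfloor>real K * H\<rfloor> = real K * H" by (auto elim: Ints_cases)
          thus ?thesis using n by (simp only:)
        next
          assume M3: "M \<le> 3"
          \<comment> \<open>\<open>K \<ge> 2\<close> absorbs the 2, and \<open>M \<le> 3\<close>
            compares \<open>1 / H\<close> with the error term.\<close>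
          have "2 / (real K * H) \<le> H powr (- (M - 2))"
          proof -
            have "2 / (real K * H) \<le> 2 / (2 * H)" using K H2 by (intro divide_left_mono mult_right_mono) auto
            also have "\<dots> = H powr (- 1)" using H2 by (simp add: powr_minus_divide)
            also have "\<dots> \<le> H powr (- (M - 2))" using M3 H2 by (intro powr_mono) auto
            finally show ?thesis .
          qed
          from rel_close_floor[OF m(2) j _ _ _ s2 _ _ KH this]
          have "rel_close (2 * C0 * H powr (- (M - 2)) + H powr (- (M - 2))) (n_moment I M K y z H (Q x H) j)
            ((real (card (Q x H)) * (real K * H) / sigma2 I M z H) ^ j * (\<sigma> * real y))"
            using KH \<sigma>0 C0 h2 by simp
          hence "rel_close ((2 * C0 + 1) * H powr (- (M - 2))) (n_moment I M K y z H (Q x H) j)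
            ((real (card (Q x H)) * (real K * H) / sigma2 I M z H) ^ j * (\<sigma> * real y))"
            by (simp only: distrib_right mult_1)
          thus ?thesis by (rule rel_close_mono[OF _ C2(2)]) (use s2 \<sigma>0 KH in simp)
        qed
      qed
      show ?case unfolding Let_def y_def[symmetric] z_def[symmetric] \<sigma>_def[symmetric] t_def[symmetric]
        using count scale by blast
    qed
  qed
qed

end
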